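(* Let $(\mathcal{B},\|\cdot\|)$ be a real separable Banach space and let $1<p<2$. The following two properties are equivalent: (1) $\mathcal{B}$ is of stable type $p$. (2) For every sequence $(\mathbf{X}_n)_{n\geq 1}$ of independent, strongly centered $\mathcal{B}$-valued random variables such that $$\int_0^{+\infty} g^{1/p}(t)\,dt<+\infty,\qquad\text{where } g(t):=\sup_{n\geq 1}\mathbb{P}(\|\mathbf{X}_n\|>t)\ \text{ for all } t>0,$$ the sequence $\left(\frac{\mathbf{S}_n}{n^{1/p}}\right)_{n\ge 1}$, with $\mathbf{S}_n:=\mathbf{X}_1+\cdots+\mathbf{X}_n$, is a quasimartingale.
   Context: A $\mathcal{B}$-valued random variable is a measurable function from a probability space $(\Omega,\mathcal{T},\mathbb{P})$ to $\mathcal{B}$ equipped with its Borel $\sigma$-field. Such a random variable $\mathbf{X}$ is strongly centered if $\mathbb{E}\|\mathbf{X}\|<+\infty$ and $\mathbb{E}f(\mathbf{X})=0$ for every $f$ in the dual $\mathcal{B}'$. Weak-$\ell_p$ norm: for a finite sequence $a=(a_1,\ldots,a_n)$ of real numbers, $\|a\|_{p,\infty}:=\sup_{t>0}\left(t^p\,\mathrm{Card}\{i:|a_i|>t\}\right)^{1/p}=\sup_{1\le k\le n}a_k^*k^{1/p}$, where $(a_1^*,\ldots,a_n^* )$ is the non-increasing rearrangement of $(|a_1|,\ldots,|a_n|)$. Stable type: let $(\varepsilon_k)$ be independent Rademacher random variables, i.e. $\mathbb{P}(\varepsilon_k=1)=\mathbb{P}(\varepsilon_k=-1)=\frac12$.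 The space $\mathcal{B}$ is of stable type $p$ if there is a constant $C(p)>0$ such that for every finite sequence $(x_1,\ldots,x_n)$ in $\mathcal{B}$, $\mathbb{E}\left\|\sum_{i=1}^n\varepsilon_i x_i\right\|\leq C(p)\left\|(\|x_1\|,\ldots,\|x_n\|)\right\|_{p,\infty}$. Quasimartingale: for a sequence $(\mathbf{X}_k)$ of independent, strongly centered $\mathcal{B}$-valued random variables, with $\mathbf{S}_n=\mathbf{X}_1+\cdots+\mathbf{X}_n$ and $\mathcal{F}_n:=\sigma(\mathbf{X}_1,\ldots,\mathbf{X}_n)$, the sequence $\left(\frac{\mathbf{S}_n}{n^{1/p}}\right)$ is called a quasimartingale (with respect to $(\mathcal{F}_n)$) if $$\sum_{n=1}^{+\infty}\mathbb{E}\left\|\mathbb{E}\left(\frac{\mathbf{S}_{n+1}}{(n+1)^{1/p}}-\frac{\mathbf{S}_n}{n^{1/p}}\,\Big|\,\mathcal{F}_n\right)\right\|<+\infty.$$ *)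

theory Defs
  imports "HOL-Probability.Probability"
begin

definition strongly_centered :: "'w measure \<Rightarrow> ('w \<Rightarrow> 'b::{banach,second_countable_topology}) \<Rightarrow> bool" where
  "strongly_centered M X \<longleftrightarrow>
     X \<in> borel_measurable M \<and>
     integrable M (\<lambda>w. norm (X w)) \<and>
     (\<forall>f :: 'b \<Rightarrow> real. bounded_linear f \<longrightarrow> (\<integral>w. f (X w) \<partial>M) = 0)"

definition weak_lp_norm :: "real \<Rightarrow> real list \<Rightarrow> real" where
  "weak_lp_norm p a =
     (SUP t\<in>{0<..}. (t powr p * real (card {i. i < length a \<and> \<bar>a ! i\<bar> > t})) powr (1 / p))"

lemma bdd_above_weak_lp_norm:
  assumes "0 < p"
  shows "bdd_above ((\<lambda>t. (t powr p * real (card {i. i < length a \<and> \<bar>a ! i\<bar> > t})) powr (1 / p)) ` {0<..})"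
proof (rule bdd_aboveI2)
  fix t :: real
  assume t: "t \<in> {0<..}"
  let ?m = "\<Sum>i<length a. \<bar>a ! i\<bar>"
  let ?A = "{i. i < length a \<and> \<bar>a ! i\<bar> > t}"
  have m0: "0 \<le> ?m" by (simp add: sum_nonneg)
  have "t powr p * real (card ?A) \<le> ?m powr p * real (length a)"
  proof (cases "?A = {}")
    case False
    then obtain i where i: "i < length a" "\<bar>a ! i\<bar> > t" by blast
    have "\<bar>a ! i\<bar> \<le> ?m" using i by (intro member_le_sum) auto
    then have "t powr p \<le> ?m powr p" using i t assms by (intro powr_mono2) auto
    moreover have "card ?A \<le> card {..<length a}" by (intro card_mono) auto
    ultimately show ?thesis by (intro mult_mono) auto
  next
    case True
    show ?thesis unfolding True by simp
  qed
  then show "(t powr p * real (card ?A)) powr (1 / p) \<le> (?m powr p * real (length a)) powr (1 / p)"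
    using assms by (intro powr_mono2) auto
qed

text \<open>The canonical sequence of independent Rademacher variables: the coordinates of the
  infinite product of the uniform distribution on \<open>{-1, 1}\<close>.\<close>

definition rademacher_space :: "(nat \<Rightarrow> real) measure" where
  "rademacher_space = Pi\<^sub>M UNIV (\<lambda>_. measure_pmf (pmf_of_set {-1, 1}))"

lemma prob_space_rademacher_space: "prob_space rademacher_space"
  unfolding rademacher_space_def by (intro prob_space_PiM prob_space_measure_pmf)

lemma rademacher_prob:
  assumes "s \<in> {-1, 1}"
  shows "measure rademacher_space {\<epsilon> \<in> space rademacher_space. \<epsilon> k = s} = 1 / 2"
proof -
  let ?P = "measure_pmf (pmf_of_set {-1, 1 :: real})"
  have "measure rademacher_space {\<epsilon> \<in> space rademacher_space. \<epsilon> k = s}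
      = measure (distr rademacher_space ?P (\<lambda>\<epsilon>. \<epsilon> k)) {s}"
    unfolding rademacher_space_def
    by (subst measure_distr) (auto intro!: arg_cong[where f = "measure _"])
  also have "distr rademacher_space ?P (\<lambda>\<epsilon>. \<epsilon> k) = ?P"
    unfolding rademacher_space_def by (rule distr_PiM_component) (auto intro: prob_space_measure_pmf)
  also have "measure ?P {s} = 1 / 2"
    using assms by (subst measure_pmf_single) (auto simp: pmf_of_set)
  finally show ?thesis .
qed

lemma rademacher_indep:
  "prob_space.indep_vars rademacher_space (\<lambda>_. borel) (\<lambda>k \<epsilon>. \<epsilon> k) UNIV"
proof -
  let ?P = "measure_pmf (pmf_of_set {-1, 1 :: real})"
  interpret prob_space rademacher_space by (rule prob_space_rademacher_space)
  have "indep_vars (\<lambda>_. ?P) (\<lambda>k \<epsilon>. \<epsilon> k) UNIV"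
  proof (subst indep_vars_iff_distr_eq_PiM')
    have "distr rademacher_space (Pi\<^sub>M UNIV (\<lambda>_. ?P)) (\<lambda>\<epsilon>. \<lambda>k\<in>UNIV. \<epsilon> k) = rademacher_space"
      unfolding rademacher_space_def by (simp add: restrict_UNIV distr_id)
    moreover have "distr rademacher_space ?P (\<lambda>\<epsilon>. \<epsilon> k) = ?P" for k
      unfolding rademacher_space_def by (rule distr_PiM_component) (auto intro: prob_space_measure_pmf)
    ultimately show "distr rademacher_space (Pi\<^sub>M UNIV (\<lambda>_. ?P)) (\<lambda>\<epsilon>. \<lambda>k\<in>UNIV. \<epsilon> k)
        = Pi\<^sub>M UNIV (\<lambda>k. distr rademacher_space ?P (\<lambda>\<epsilon>. \<epsilon> k))"
      by (simp add: rademacher_space_def)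
  qed (auto simp: rademacher_space_def)
  then have "indep_vars (\<lambda>_. borel) (\<lambda>k. (\<lambda>x. x) \<circ> (\<lambda>\<epsilon>. \<epsilon> k)) UNIV"
    by (rule indep_vars_compose) auto
  then show ?thesis by (simp add: comp_def)
qed

definition stable_type :: "'b::{banach,second_countable_topology} itself \<Rightarrow> real \<Rightarrow> bool" where
  "stable_type _ p \<longleftrightarrow>
     (\<exists>C>0. \<forall>x :: 'b list.
        (\<integral>\<epsilon>. norm (\<Sum>i<length x. \<epsilon> i *\<^sub>R x ! i) \<partial>rademacher_space)
          \<le> C * weak_lp_norm p (map norm x))"

text \<open>Conditional expectation of a Bochner integrable function: \<open>g\<close> is a version of
  \<open>E(f | F)\<close>. As for \<^const>\<open>real_cond_exp\<close>, the sub-\<open>\<sigma>\<close>-algebra is given as a measure \<open>F\<close> of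
  which only the measurable sets matter. By the classical existence and uniqueness theorem,
  versions exist for every integrable \<open>f\<close> and agree almost everywhere, so the choice made in
  \<open>cond_expectation\<close> is immaterial.\<close>

definition is_cond_exp :: "'w measure \<Rightarrow> 'w measure \<Rightarrow>
    ('w \<Rightarrow> 'b::{banach,second_countable_topology}) \<Rightarrow> ('w \<Rightarrow> 'b) \<Rightarrow> bool" where
  "is_cond_exp M F f g \<longleftrightarrow>
     integrable M f \<and> integrable M g \<and> g \<in> borel_measurable F \<and>
     (\<forall>A\<in>sets F. set_lebesgue_integral M A g = set_lebesgue_integral M A f)"

definition cond_expectation :: "'w measure \<Rightarrow> 'w measure \<Rightarrow>
    ('w \<Rightarrow> 'b::{banach,second_countable_topology}) \<Rightarrow> 'w \<Rightarrow> 'b" where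
  "cond_expectation M F f = (SOME g. is_cond_exp M F f g)"

definition partial_sum :: "(nat \<Rightarrow> 'w \<Rightarrow> 'b::real_normed_vector) \<Rightarrow> nat \<Rightarrow> 'w \<Rightarrow> 'b" where
  "partial_sum X n w = (\<Sum>k = 1..n. X k w)"

definition generated_filtration ::
    "'w measure \<Rightarrow> (nat \<Rightarrow> 'w \<Rightarrow> 'b::real_normed_vector) \<Rightarrow> nat \<Rightarrow> 'w measure" where
  "generated_filtration M X n =
     sigma (space M) {X k -` A \<inter> space M | k A. k \<in> {1..n} \<and> A \<in> sets borel}"

text \<open>The series ranges over \<open>n \<ge> 1\<close>, which \<open>n = Suc m\<close> parametrises; it is taken in
  \<^typ>\<open>ennreal\<close>, so that divergence is the value \<open>\<infinity>\<close>.\<close>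

definition quasimartingale :: "'w measure \<Rightarrow> (nat \<Rightarrow> 'w measure) \<Rightarrow>
    (nat \<Rightarrow> 'w \<Rightarrow> 'b::{banach,second_countable_topology}) \<Rightarrow> bool" where
  "quasimartingale M F Y \<longleftrightarrow>
     (\<Sum>m. \<integral>\<^sup>+w. ennreal (norm (cond_expectation M (F (Suc m))
        (\<lambda>v. Y (Suc m + 1) v - Y (Suc m) v) w)) \<partial>M) < \<infinity>"

definition sup_tail :: "'w measure \<Rightarrow> (nat \<Rightarrow> 'w \<Rightarrow> 'b::real_normed_vector) \<Rightarrow> real \<Rightarrow> real" where
  "sup_tail M X t = (SUP n\<in>{1..}. measure M {w \<in> space M. norm (X n w) > t})"

text \<open>The second property, for the random variables defined on probability spaces whose
  underlying set is of type \<open>'w\<close>. The value \<open>X 0\<close> is never used.\<close>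

definition quasimartingale_property ::
    "'b::{banach,second_countable_topology} itself \<Rightarrow> 'w itself \<Rightarrow> real \<Rightarrow> bool" where
  "quasimartingale_property _ _ p \<longleftrightarrow>
     (\<forall>(M :: 'w measure) (X :: nat \<Rightarrow> 'w \<Rightarrow> 'b).
        prob_space M \<and>
        prob_space.indep_vars M (\<lambda>_. borel) X {1..} \<and>
        (\<forall>n\<ge>1. strongly_centered M (X n)) \<and>
        (\<integral>\<^sup>+t\<in>{0<..}. ennreal (sup_tail M X t powr (1 / p)) \<partial>lborel) < \<infinity>
        \<longrightarrow> quasimartingale M (generated_filtration M X)
              (\<lambda>n w. partial_sum X n w /\<^sub>R (real n powr (1 / p))))"

end

theory Submission
  imports Defs "HOL-Library.Discrete_Functions"
begin

text \<open>
  Write \<open>\<alpha> = 1 / p\<close>. Since \<open>S\<^sub>n\<close> is measurable for the past up to time \<open>n\<close>, while \<open>X\<^sub>n\<^sub>+\<^sub>1\<close> is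
  centered and independent of that past, the conditional expectation of the increment of
  \<open>S\<^sub>n / n\<^sup>\<alpha>\<close> is \<open>((n + 1) powr (- \<alpha>) - n powr (- \<alpha>)) S\<^sub>n\<close>. Hence the quasimartingale property says
  that \<open>\<Sum> w\<^sub>n E \<parallel>S\<^sub>n\<parallel> < \<infinity>\<close> with weights \<open>w\<^sub>n = n powr (- \<alpha>) - (n + 1) powr (- \<alpha>)\<close>, which are of
  order \<open>n powr (- 1 - \<alpha>)\<close> (\<open>quasimartingale_iff\<close>).

  Both properties are compared with the growth of \<open>\<phi>(n)\<close>, the supremum of \<open>E \<parallel>\<Sum> \<epsilon>\<^sub>i x\<^sub>i\<parallel>\<close> over \<open>n\<close>
  vectors of the unit ball (\<open>rad_sup\<close>). There are two growth conditions:
  \<^item> little-o growth: for every \<open>\<theta> > 0\<close> there is \<open>c\<close> with \<open>\<phi>(n) \<le> \<theta> n\<^sup>\<alpha> + c\<close> for all \<open>n\<close>;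
  \<^item> power saving: \<open>\<phi>(n) \<le> C n\<^sup>\<beta>\<close> for some \<open>\<beta> < \<alpha>\<close>.

  Each of the two properties implies little-o growth, little-o growth improves itself to a power
  saving, and a power saving implies each of the two properties.

  \<^emph>\<open>Stable type gives little-o growth\<close> (\<open>stable_type_imp_rad_sup_small\<close>). Split many vectors
  of the unit ball into groups of sizes about \<open>n / l\<close>, \<open>l = 1, \<dots>, L\<close>. Stable type is applied inside
  each group and then, conditionally on the group sums, to the list of these sums. There are about \<open>n H\<^sub>L\<close> vectors,
  \<open>H\<^sub>L\<close> the harmonic number, but the norm of the sum is only of order \<open>n\<^sup>\<alpha> H\<^sub>L powr (1 / 2)\<close>; as
  \<open>\<alpha> > 1 / 2\<close>, this gains a factor \<open>H\<^sub>L powr (1 / 2 - \<alpha>)\<close>.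

  \<^emph>\<open>The quasimartingale property gives little-o growth\<close>
  (\<open>quasimartingale_property_imp_rad_sup_small\<close>). Apply it to \<open>X\<^sub>k = \<epsilon>\<^sub>k x\<^sub>k\<close>, where the \<open>x\<^sub>k\<close> with
  \<open>2\<^sup>j \<le> k < 2\<^sup>j\<^sup>+\<^sup>1\<close> are extremal for \<open>\<phi>(2\<^sup>j)\<close> up to a factor 2.

  \<^emph>\<open>Power saving\<close> (\<open>rad_sup_power_saving\<close>). The best constant in the type 2 inequality for \<open>N\<close>
  vectors is submultiplicative in \<open>N\<close>, and little-o growth makes it at most \<open>N powr (\<alpha> - 1 / 2) / 2\<close>
  for one large \<open>N\<close>. First and second moments are comparable by an inequality of Kahane type
  (\<open>kahane\<close>), proved by the spectral argument of Latala and Oleszkiewicz.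

  \<^emph>\<open>Consequences of a power saving\<close>. Integrating over the levels of the norms gives
  \<open>E \<parallel>\<Sum> \<epsilon>\<^sub>i x\<^sub>i\<parallel> \<le> \<integral> \<phi>(#{i. \<parallel>x\<^sub>i\<parallel> > t}) dt\<close> (\<open>rad_mean_layer_cake\<close>). For deterministic vectors this
  yields stable type. For random vectors, after symmetrization, the expected integrand is at most a
  constant times \<open>min (n g(t)) ((n g(t))\<^sup>\<beta>)\<close>, and summing over \<open>n\<close> against \<open>w\<^sub>n\<close> leaves a multiple of
  \<open>\<integral> g(t)\<^sup>\<alpha> dt\<close>; here \<open>\<beta> < \<alpha>\<close> is what makes the series converge.
\<close>

section \<open>Rademacher averages of lists\<close>

text \<open>\<open>rad_mean [x\<^sub>1, \<dots>, x\<^sub>n] F\<close> is the average of \<open>F (\<plusminus>x\<^sub>1 \<dots> \<plusminus>x\<^sub>n)\<close> over all \<open>2\<^sup>n\<close> choices of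
  signs. The recursion on the list, with \<open>F\<close> varying, replaces integrals over the Rademacher space
  by finite computations.\<close>

primrec rad_mean :: "'b::real_normed_vector list \<Rightarrow> ('b \<Rightarrow> real) \<Rightarrow> real" where
  "rad_mean [] F = F 0"
| "rad_mean (x # xs) F = (rad_mean xs (\<lambda>v. F (v + x)) + rad_mean xs (\<lambda>v. F (v - x))) / 2"

lemma rad_mean_mono: "(\<And>v. F v \<le> G v) \<Longrightarrow> rad_mean xs F \<le> rad_mean xs G"
proof (induction xs arbitrary: F G)
  case (Cons x xs)
  have "rad_mean xs (\<lambda>v. F (v + x)) \<le> rad_mean xs (\<lambda>v. G (v + x))"
    "rad_mean xs (\<lambda>v. F (v - x)) \<le> rad_mean xs (\<lambda>v. G (v - x))"
    by (intro Cons.IH Cons.prems)+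
  then show ?case by simp
qed simp

lemma rad_mean_add: "rad_mean xs (\<lambda>v. F v + G v) = rad_mean xs F + rad_mean xs G"
  by (induction xs arbitrary: F G) (simp_all add: add_divide_distrib)

lemma rad_mean_cmult: "rad_mean xs (\<lambda>v. c * F v) = c * rad_mean xs F"
  by (induction xs arbitrary: F) (simp_all add: algebra_simps)

lemma rad_mean_const: "rad_mean xs (\<lambda>v. c) = c"
  by (induction xs) simp_all

lemma rad_mean_nonneg: "(\<And>v. 0 \<le> F v) \<Longrightarrow> 0 \<le> rad_mean xs F"
  using rad_mean_mono[of "\<lambda>_. 0" F xs] by (simp add: rad_mean_const)

lemma rad_mean_append:
  "rad_mean (xs @ ys) F = rad_mean xs (\<lambda>u. rad_mean ys (\<lambda>v. F (u + v)))"
proof (induction xs arbitrary: F)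
  case (Cons x xs)
  show ?case by (simp add: Cons.IH) (simp add: algebra_simps)
qed simp

lemma rad_mean_uminus: "rad_mean xs (\<lambda>v. F (- v)) = rad_mean xs F"
proof (induction xs arbitrary: F)
  case (Cons x xs)
  have "rad_mean xs (\<lambda>v. F (- (v + x))) = rad_mean xs (\<lambda>v. F (v - x))"
    using Cons.IH[of "\<lambda>v. F (v - x)"] by (simp add: algebra_simps)
  moreover have "rad_mean xs (\<lambda>v. F (- (v - x))) = rad_mean xs (\<lambda>v. F (v + x))"
    using Cons.IH[of "\<lambda>v. F (v + x)"] by (simp add: algebra_simps)
  ultimately show ?case by simp
qed simp

lemma rad_mean_power2_le: "(rad_mean xs F)\<^sup>2 \<le> rad_mean xs (\<lambda>v. (F v)\<^sup>2)"
proof (induction xs arbitrary: F)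
  case (Cons x xs)
  let ?a = "rad_mean xs (\<lambda>v. F (v + x))" and ?b = "rad_mean xs (\<lambda>v. F (v - x))"
  have "((?a + ?b) / 2)\<^sup>2 \<le> (?a\<^sup>2 + ?b\<^sup>2) / 2"
    using zero_le_power2[of "?a - ?b"] by (simp add: power2_eq_square field_simps)
  also have "\<dots> \<le> (rad_mean xs (\<lambda>v. (F (v + x))\<^sup>2) + rad_mean xs (\<lambda>v. (F (v - x))\<^sup>2)) / 2"
    using Cons.IH[of "\<lambda>v. F (v + x)"] Cons.IH[of "\<lambda>v. F (v - x)"] by simp
  finally show ?case by simp
qed simp

lemma norm_le_rad_mean: "norm v \<le> rad_mean xs (\<lambda>u. norm (u + v))"
proof (induction xs arbitrary: v)
  case (Cons x xs)
  have "2 * norm v = norm ((x + v) + (v - x))" by (simp flip: scaleR_2)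
  also have "\<dots> \<le> norm (x + v) + norm (v - x)" by (rule norm_triangle_ineq)
  also have "\<dots> \<le> rad_mean xs (\<lambda>u. norm (u + (x + v))) + rad_mean xs (\<lambda>u. norm (u + (v - x)))"
    by (intro add_mono Cons.IH)
  finally show ?case by (simp add: algebra_simps)
qed simp

text \<open>Removing summands does not increase the average norm: the removed part is symmetric, so this is
  convexity of the norm.\<close>

lemma rad_mean_norm_append:
  "rad_mean xs norm \<le> rad_mean (xs @ ys) norm" "rad_mean ys norm \<le> rad_mean (xs @ ys) norm"
proof -
  have "rad_mean xs norm \<le> rad_mean xs (\<lambda>u. rad_mean ys (\<lambda>v. norm (u + v)))"
    using norm_le_rad_mean[of _ ys] by (intro rad_mean_mono[of norm]) (simp add: add.commute)
  then show "rad_mean xs norm \<le> rad_mean (xs @ ys) norm" by (simp add: rad_mean_append)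
  have *: "norm (v::'a) \<le> norm (u + v) / 2 + norm (v - u) / 2" for u v
    using norm_triangle_ineq[of "u + v" "v - u"] by (simp flip: scaleR_2)
  have "rad_mean ys norm \<le> rad_mean ys (\<lambda>v. norm (u + v))" for u
  proof -
    have "rad_mean ys norm \<le> rad_mean ys (\<lambda>v. 1 / 2 * norm (u + v) + 1 / 2 * norm (v - u))"
      using * by (intro rad_mean_mono) simp
    also have "\<dots> = 1 / 2 * rad_mean ys (\<lambda>v. norm (u + v)) + 1 / 2 * rad_mean ys (\<lambda>v. norm (v - u))"
      by (simp only: rad_mean_add rad_mean_cmult)
    also have "rad_mean ys (\<lambda>v. norm (v - u)) = rad_mean ys (\<lambda>v. norm (u + v))"
      using rad_mean_uminus[of ys "\<lambda>v. norm (v - u)"]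
      by (simp add: norm_minus_commute)
    finally show ?thesis by simp
  qed
  then have "rad_mean xs (\<lambda>u. rad_mean ys norm) \<le> rad_mean xs (\<lambda>u. rad_mean ys (\<lambda>v. norm (u + v)))"
    by (rule rad_mean_mono)
  then show "rad_mean ys norm \<le> rad_mean (xs @ ys) norm"
    by (simp add: rad_mean_append rad_mean_const)
qed

lemma rad_mean_scaleR: "rad_mean (map (\<lambda>x. c *\<^sub>R x) xs) F = rad_mean xs (\<lambda>v. F (c *\<^sub>R v))"
  by (induction xs arbitrary: F) (simp_all add: algebra_simps)

lemma rad_mean_le_sum_list: "rad_mean xs (\<lambda>u. norm (u + v)) \<le> norm v + sum_list (map norm xs)"
proof (induction xs arbitrary: v)
  case (Cons x xs)
  have "rad_mean xs (\<lambda>u. norm (u + (x + v))) \<le> norm v + norm x + sum_list (map norm xs)"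
    using Cons.IH[of "x + v"] norm_triangle_ineq[of x v] by linarith
  moreover have "rad_mean xs (\<lambda>u. norm (u + (v - x))) \<le> norm v + norm x + sum_list (map norm xs)"
    using Cons.IH[of "v - x"] norm_triangle_ineq4[of v x] by linarith
  ultimately show ?case by (simp add: algebra_simps)
qed simp

lemma rad_mean_filter:
  "rad_mean (map (\<lambda>x. if P x then f x else 0) xs) F = rad_mean (map f (filter P xs)) F"
  by (induction xs arbitrary: F) simp_all

section \<open>Comparison of the first two moments\<close>

text \<open>Functions on the discrete cube are functions of sign lists, \<open>True\<close> standing for the sign \<open>+\<close>.
  \<open>cube_mean n f\<close> is the average of \<open>f\<close> over the lists of length \<open>n\<close>.\<close>

primrec cube_mean :: "nat \<Rightarrow> (bool list \<Rightarrow> real) \<Rightarrow> real" where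
  "cube_mean 0 f = f []"
| "cube_mean (Suc n) f = (cube_mean n (\<lambda>s. f (True # s)) + cube_mean n (\<lambda>s. f (False # s))) / 2"

text \<open>The Dirichlet form of the cube: the average over \<open>s\<close> of the sum over all coordinates \<open>i\<close> of
  \<open>((f s - f s\<^sup>i) / 2)\<^sup>2\<close>, where \<open>s\<^sup>i\<close> is \<open>s\<close> with its \<open>i\<close>-th sign flipped. In the recursion the first
  coordinate contributes the last summand.\<close>

primrec cube_energy :: "nat \<Rightarrow> (bool list \<Rightarrow> real) \<Rightarrow> real" where
  "cube_energy 0 f = 0"
| "cube_energy (Suc n) f =
     (cube_energy n (\<lambda>s. f (True # s)) + cube_energy n (\<lambda>s. f (False # s))) / 2
     + cube_mean n (\<lambda>s. ((f (True # s) - f (False # s)) / 2)\<^sup>2)"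

text \<open>The sum of the values of \<open>f\<close> at the neighbours of a vertex of the cube.\<close>

primrec flip_sum :: "(bool list \<Rightarrow> real) \<Rightarrow> bool list \<Rightarrow> real" where
  "flip_sum f [] = 0"
| "flip_sum f (b # s) = flip_sum (\<lambda>r. f (b # r)) s + f ((\<not> b) # s)"

text \<open>The signed sum; only lists of equal lengths matter, and the default value \<open>0\<close> is reached
  legitimately for two empty lists.\<close>

fun signed_sum :: "bool list \<Rightarrow> 'b::real_normed_vector list \<Rightarrow> 'b" where
  "signed_sum (b # s) (x # xs) = (if b then x else - x) + signed_sum s xs"
| "signed_sum _ _ = 0"

lemma cube_mean_mono:
  "(\<And>s. length s = n \<Longrightarrow> f s \<le> g s) \<Longrightarrow> cube_mean n f \<le> cube_mean n g"
proof (induction n arbitrary: f g)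
  case (Suc n)
  have "cube_mean n (\<lambda>s. f (b # s)) \<le> cube_mean n (\<lambda>s. g (b # s))" for b
    by (intro Suc.IH Suc.prems) simp
  from this[of True] this[of False] show ?case by simp
qed simp

lemma cube_mean_cong:
  "(\<And>s. length s = n \<Longrightarrow> f s = g s) \<Longrightarrow> cube_mean n f = cube_mean n g"
  by (intro antisym cube_mean_mono) simp_all

lemma cube_mean_add: "cube_mean n (\<lambda>s. f s + g s) = cube_mean n f + cube_mean n g"
  by (induction n arbitrary: f g) (simp_all add: add_divide_distrib)

lemma cube_mean_cmult: "cube_mean n (\<lambda>s. c * f s) = c * cube_mean n f"
  by (induction n arbitrary: f) (simp_all add: algebra_simps)

lemma cube_mean_power2_le: "(cube_mean n f)\<^sup>2 \<le> cube_mean n (\<lambda>s. (f s)\<^sup>2)"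
proof (induction n arbitrary: f)
  case (Suc n)
  let ?a = "cube_mean n (\<lambda>s. f (True # s))" and ?b = "cube_mean n (\<lambda>s. f (False # s))"
  have "((?a + ?b) / 2)\<^sup>2 \<le> (?a\<^sup>2 + ?b\<^sup>2) / 2"
    using zero_le_power2[of "?a - ?b"] by (simp add: power2_eq_square field_simps)
  also have "\<dots> \<le> (cube_mean n (\<lambda>s. (f (True # s))\<^sup>2) + cube_mean n (\<lambda>s. (f (False # s))\<^sup>2)) / 2"
    using Suc.IH[of "\<lambda>s. f (True # s)"] Suc.IH[of "\<lambda>s. f (False # s)"] by simp
  finally show ?case by simp
qed simp

lemma cube_mean_parallelogram:
  "(cube_mean n (\<lambda>s. (f s)\<^sup>2) + cube_mean n (\<lambda>s. (g s)\<^sup>2)) / 2 =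
     cube_mean n (\<lambda>s. ((f s + g s) / 2)\<^sup>2) + cube_mean n (\<lambda>s. ((f s - g s) / 2)\<^sup>2)"
proof -
  have "(cube_mean n (\<lambda>s. (f s)\<^sup>2) + cube_mean n (\<lambda>s. (g s)\<^sup>2)) / 2
      = cube_mean n (\<lambda>s. 1 / 2 * ((f s)\<^sup>2 + (g s)\<^sup>2))"
    unfolding cube_mean_cmult cube_mean_add by simp
  also have "\<dots> = cube_mean n (\<lambda>s. ((f s + g s) / 2)\<^sup>2 + ((f s - g s) / 2)\<^sup>2)"
    by (intro cube_mean_cong) (simp add: power2_eq_square field_simps)
  finally show ?thesis by (simp add: cube_mean_add)
qed

lemma cube_energy_parallelogram:
  "(cube_energy n f + cube_energy n g) / 2 =
     cube_energy n (\<lambda>s. (f s + g s) / 2) + cube_energy n (\<lambda>s. (f s - g s) / 2)"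
proof (induction n arbitrary: f g)
  case (Suc n)
  have T: "(cube_energy n (\<lambda>s. f (b # s)) + cube_energy n (\<lambda>s. g (b # s))) / 2 =
     cube_energy n (\<lambda>s. (f (b # s) + g (b # s)) / 2) +
     cube_energy n (\<lambda>s. (f (b # s) - g (b # s)) / 2)" for b
    by (rule Suc.IH)
  let ?u = "\<lambda>s. (f (True # s) - f (False # s)) / 2" and ?v = "\<lambda>s. (g (True # s) - g (False # s)) / 2"
  have eq: "((f (True # s) + g (True # s)) / 2 - (f (False # s) + g (False # s)) / 2) / 2 = (?u s + ?v s) / 2"
     "((f (True # s) - g (True # s)) / 2 - (f (False # s) - g (False # s)) / 2) / 2 = (?u s - ?v s) / 2"
    for s by (simp_all add: field_simps)
  show ?case
    unfolding cube_energy.simps eq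
    using T[of True] T[of False] cube_mean_parallelogram[of n ?u ?v] by argo
qed simp

lemma cube_poincare: "cube_mean n (\<lambda>s. (f s)\<^sup>2) - (cube_mean n f)\<^sup>2 \<le> cube_energy n f"
proof (induction n arbitrary: f)
  case (Suc n)
  let ?a = "\<lambda>s. f (True # s)" and ?b = "\<lambda>s. f (False # s)"
  have "cube_mean n (\<lambda>s. (?a s - ?b s) / 2) = (cube_mean n ?a - cube_mean n ?b) / 2"
    using cube_mean_add[of n "\<lambda>s. 1/2 * ?a s" "\<lambda>s. (-1/2) * ?b s"]
    unfolding cube_mean_cmult by (simp add: field_simps)
  then have "((cube_mean n ?a - cube_mean n ?b) / 2)\<^sup>2 \<le> cube_mean n (\<lambda>s. ((?a s - ?b s) / 2)\<^sup>2)"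
    using cube_mean_power2_le[of n "\<lambda>s. (?a s - ?b s) / 2"] by (simp only:)
  with Suc.IH[of ?a] Suc.IH[of ?b] show ?case
    by (simp add: power2_eq_square field_simps)
qed simp

lemma cube_mean_odd:
  "(\<And>s. length s = n \<Longrightarrow> f (map Not s) = - f s) \<Longrightarrow> cube_mean n f = 0"
proof -
  have *: "cube_mean n (\<lambda>s. f (map Not s)) = cube_mean n f" for f
  proof (induction n arbitrary: f)
    case (Suc n)
    show ?case
      using Suc.IH[of "\<lambda>s. f (True # s)"] Suc.IH[of "\<lambda>s. f (False # s)"] by simp
  qed simp
  assume "\<And>s. length s = n \<Longrightarrow> f (map Not s) = - f s"
  then have "cube_mean n (\<lambda>s. f (map Not s)) = cube_mean n (\<lambda>s. (-1) * f s)"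
    by (intro cube_mean_cong) simp
  then show ?thesis unfolding * cube_mean_cmult by simp
qed

text \<open>Even functions have no Walsh coefficients of degree one, so that the spectral gap doubles. In the
  induction, \<open>f\<close> is decomposed along its first coordinate into the average \<open>g\<close> over the first sign,
  which is again even, and the coefficient \<open>h\<close> of that sign, which is odd and hence has mean zero.\<close>

lemma cube_poincare_even:
  "(\<And>s. length s = n \<Longrightarrow> f (map Not s) = f s) \<Longrightarrow>
     2 * (cube_mean n (\<lambda>s. (f s)\<^sup>2) - (cube_mean n f)\<^sup>2) \<le> cube_energy n f"
proof (induction n arbitrary: f)
  case (Suc n)
  let ?a = "\<lambda>s. f (True # s)" and ?b = "\<lambda>s. f (False # s)"
  define g where "g s = (?a s + ?b s) / 2" for s
  define h where "h s = (?a s - ?b s) / 2" for s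
  have sym: "?a (map Not s) = ?b s" "?b (map Not s) = ?a s" if "length s = n" for s
    using Suc.prems[of "True # s"] Suc.prems[of "False # s"] that by simp_all
  have "cube_mean n h = 0" by (rule cube_mean_odd) (simp add: h_def sym field_simps)
  moreover have "2 * (cube_mean n (\<lambda>s. (g s)\<^sup>2) - (cube_mean n g)\<^sup>2) \<le> cube_energy n g"
    by (rule Suc.IH) (simp add: g_def sym field_simps)
  moreover have "cube_mean n (\<lambda>s. (h s)\<^sup>2) - (cube_mean n h)\<^sup>2 \<le> cube_energy n h"
    by (rule cube_poincare)
  moreover have "cube_energy (Suc n) f = cube_energy n g + cube_energy n h + cube_mean n (\<lambda>s. (h s)\<^sup>2)"
    using cube_energy_parallelogram[of n ?a ?b] by (simp add: g_def[abs_def] h_def[abs_def])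
  moreover have "cube_mean (Suc n) (\<lambda>s. (f s)\<^sup>2) = cube_mean n (\<lambda>s. (g s)\<^sup>2) + cube_mean n (\<lambda>s. (h s)\<^sup>2)"
    using cube_mean_parallelogram[of n ?a ?b] by (simp add: g_def h_def)
  moreover have "cube_mean (Suc n) f = cube_mean n g"
    using cube_mean_cmult[of n "1/2" "\<lambda>s. ?a s + ?b s"] by (simp add: g_def[abs_def] cube_mean_add)
  ultimately show ?case by (simp del: cube_mean.simps cube_energy.simps)
qed simp

lemma cube_energy_eq:
  "cube_energy n f = cube_mean n (\<lambda>s. f s * (real n * f s - flip_sum f s) / 2)"
proof (induction n arbitrary: f)
  case (Suc n)
  let ?a = "\<lambda>s. f (True # s)" and ?b = "\<lambda>s. f (False # s)"
  let ?h = "\<lambda>f s. f s * (real n * f s - flip_sum f s) / 2"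
  have "cube_energy (Suc n) f = (cube_mean n (?h ?a) + cube_mean n (?h ?b)) / 2
      + cube_mean n (\<lambda>s. ((?a s - ?b s) / 2)\<^sup>2)"
    by (simp add: Suc.IH[of ?a] Suc.IH[of ?b])
  also have "\<dots> = cube_mean n (\<lambda>s. 1 / 2 * (?h ?a s + ?h ?b s) + ((?a s - ?b s) / 2)\<^sup>2)"
    unfolding cube_mean_add cube_mean_cmult by simp
  also have "\<dots> = cube_mean n (\<lambda>s. 1 / 2 *
     (?a s * (real (Suc n) * ?a s - (flip_sum ?a s + ?b s)) / 2 +
      ?b s * (real (Suc n) * ?b s - (flip_sum ?b s + ?a s)) / 2))"
    by (intro cube_mean_cong) (simp add: power2_eq_square field_simps)
  also have "\<dots> = (cube_mean n (\<lambda>s. ?a s * (real (Suc n) * ?a s - (flip_sum ?a s + ?b s)) / 2)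
     + cube_mean n (\<lambda>s. ?b s * (real (Suc n) * ?b s - (flip_sum ?b s + ?a s)) / 2)) / 2"
    unfolding cube_mean_add cube_mean_cmult by simp
  finally show ?case by simp
qed simp

lemma rad_mean_eq_cube_mean: "rad_mean xs F = cube_mean (length xs) (\<lambda>s. F (signed_sum s xs))"
proof (induction xs arbitrary: F)
  case (Cons x xs)
  show ?case using Cons.IH[of "\<lambda>v. F (v + x)"] Cons.IH[of "\<lambda>v. F (v - x)"]
    by (simp add: add.commute)
qed simp

text \<open>By the triangle inequality the sum over the neighbours dominates the norm of the sum of the
  neighbouring values; flipping each sign once turns \<open>n\<close> copies of the signed sum into \<open>n - 2\<close>.\<close>

lemma flip_sum_norm_ge:
  "length s = length xs \<Longrightarrow>
     norm (real (length xs) *\<^sub>R v + (real (length xs) - 2) *\<^sub>R signed_sum s xs)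
     \<le> flip_sum (\<lambda>s. norm (v + signed_sum s xs)) s"
proof (induction xs arbitrary: s v)
  case (Cons x xs)
  then obtain b r where s: "s = b # r" "length r = length xs" by (cases s) auto
  define y where "y = (if b then x else - x)"
  define S where "S = signed_sum r xs"
  let ?n = "real (length xs)"
  have "real (length (x # xs)) *\<^sub>R v + (real (length (x # xs)) - 2) *\<^sub>R signed_sum s (x # xs)
     = (?n *\<^sub>R (v + y) + (?n - 2) *\<^sub>R S) + (v - y + S)"
    by (simp add: s y_def S_def algebra_simps scaleR_2)
  also have "norm \<dots> \<le> norm (?n *\<^sub>R (v + y) + (?n - 2) *\<^sub>R S) + norm (v - y + S)"
    by (rule norm_triangle_ineq)
  also have "\<dots> \<le> flip_sum (\<lambda>s. norm (v + y + signed_sum s xs)) r + norm (v - y + S)"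
    using Cons.IH[OF s(2), of "v + y"] by (simp add: S_def)
  also have "\<dots> = flip_sum (\<lambda>s. norm (v + signed_sum s (x # xs))) s"
    by (cases b) (simp_all add: s y_def S_def algebra_simps)
  finally show ?case .
qed simp

text \<open>For \<open>f = \<parallel>\<Sum> s\<^sub>i x\<^sub>i\<parallel>\<close> the bound on neighbours gives \<open>cube_energy f \<le> E f\<^sup>2\<close>, while evenness gives
  \<open>2 (E f\<^sup>2 - (E f)\<^sup>2) \<le> cube_energy f\<close>.\<close>

lemma kahane: "rad_mean xs (\<lambda>v. (norm v)\<^sup>2) \<le> 2 * (rad_mean xs norm)\<^sup>2"
proof -
  define n where "n = length xs"
  define f where "f s = norm (signed_sum s xs)" for s
  have neg: "length s = length ys \<Longrightarrow> signed_sum (map Not s) ys = - signed_sum s ys" for s and ys :: "'a list"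
    by (induction s ys rule: list_induct2) auto
  have "2 * (cube_mean n (\<lambda>s. (f s)\<^sup>2) - (cube_mean n f)\<^sup>2) \<le> cube_energy n f"
    by (rule cube_poincare_even) (simp add: f_def neg n_def)
  also have "\<dots> \<le> cube_mean n (\<lambda>s. (f s)\<^sup>2)"
    unfolding cube_energy_eq
  proof (rule cube_mean_mono)
    fix s :: "bool list" assume s: "length s = n"
    have "(real n - 2) * f s \<le> norm ((real n - 2) *\<^sub>R signed_sum s xs)"
      by (simp add: f_def mult_right_mono)
    also have "\<dots> \<le> flip_sum f s"
      using flip_sum_norm_ge[of s xs 0] s by (simp add: n_def f_def[abs_def])
    finally have "f s * (real n * f s - flip_sum f s) \<le> f s * (2 * f s)"
      by (intro mult_left_mono) (simp_all add: f_def algebra_simps)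
    then show "f s * (real n * f s - flip_sum f s) / 2 \<le> (f s)\<^sup>2"
      by (simp add: power2_eq_square)
  qed
  finally show ?thesis by (simp add: rad_mean_eq_cube_mean n_def f_def[abs_def])
qed

section \<open>Averages over blocks\<close>

text \<open>The average of \<open>G (y\<^sub>1, \<dots>, y\<^sub>m)\<close>, where the \<open>y\<^sub>l\<close> are independent Rademacher sums, \<open>y\<^sub>l\<close> being formed
  from the \<open>l\<close>-th list.\<close>

primrec block_mean :: "'b::real_normed_vector list list \<Rightarrow> ('b list \<Rightarrow> real) \<Rightarrow> real" where
  "block_mean [] G = G []"
| "block_mean (xs # xss) G = rad_mean xs (\<lambda>y. block_mean xss (\<lambda>ys. G (y # ys)))"

lemma block_mean_mono:
  "(\<And>ys. length ys = length xss \<Longrightarrow> G ys \<le> H ys) \<Longrightarrow> block_mean xss G \<le> block_mean xss H"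
proof (induction xss arbitrary: G H)
  case (Cons xs xss)
  show ?case by (auto intro!: rad_mean_mono Cons)
qed simp

lemma block_mean_cmult: "block_mean xss (\<lambda>ys. c * G ys) = c * block_mean xss G"
  by (induction xss arbitrary: G) (simp_all add: rad_mean_cmult)

lemma block_mean_add: "block_mean xss (\<lambda>ys. G ys + H ys) = block_mean xss G + block_mean xss H"
  by (induction xss arbitrary: G H) (simp_all add: rad_mean_add)

lemma block_mean_const: "block_mean xss (\<lambda>ys. c) = c"
  by (induction xss) (simp_all add: rad_mean_const)

lemma block_mean_power2_le: "(block_mean xss G)\<^sup>2 \<le> block_mean xss (\<lambda>ys. (G ys)\<^sup>2)"
proof (induction xss arbitrary: G)
  case (Cons xs xss)
  have "(block_mean (xs # xss) G)\<^sup>2 \<le> rad_mean xs (\<lambda>y. (block_mean xss (\<lambda>ys. G (y # ys)))\<^sup>2)"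
    by (simp add: rad_mean_power2_le)
  also have "\<dots> \<le> rad_mean xs (\<lambda>y. block_mean xss (\<lambda>ys. (G (y # ys))\<^sup>2))"
    by (intro rad_mean_mono Cons.IH)
  finally show ?case by simp
qed simp

lemma block_mean_sum:
  "block_mean xss (\<lambda>ys. \<Sum>l<length xss. w l * f (ys ! l))
     = (\<Sum>l<length xss. w l * rad_mean (xss ! l) f)"
proof (induction xss arbitrary: w)
  case (Cons xs xss)
  show ?case
    using Cons.IH[of "\<lambda>l. w (Suc l)"]
    by (simp add: sum.lessThan_Suc_shift block_mean_add block_mean_const rad_mean_add
        rad_mean_const rad_mean_cmult del: sum.lessThan_Suc)
qed simp

text \<open>Block sums are symmetric, so multiplying them by further independent signs does not change the
  distribution of the total sum.\<close>

lemma rad_mean_concat: "rad_mean (concat xss) F = block_mean xss (\<lambda>ys. rad_mean ys F)"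
proof (induction xss arbitrary: F)
  case (Cons xs xss)
  have "block_mean (xs # xss) (\<lambda>ys. rad_mean ys F)
     = rad_mean xs (\<lambda>y. 1 / 2 * rad_mean (concat xss) (\<lambda>v. F (v + y))
         + 1 / 2 * rad_mean (concat xss) (\<lambda>v. F (v - y)))"
    by (simp add: Cons.IH block_mean_add flip: block_mean_cmult)
       (simp add: add_divide_distrib block_mean_add)
  also have "\<dots> = 1 / 2 * rad_mean xs (\<lambda>y. rad_mean (concat xss) (\<lambda>v. F (v + y)))
         + 1 / 2 * rad_mean xs (\<lambda>y. rad_mean (concat xss) (\<lambda>v. F (v - y)))"
    unfolding rad_mean_add rad_mean_cmult ..
  also have "rad_mean xs (\<lambda>y. rad_mean (concat xss) (\<lambda>v. F (v - y)))
      = rad_mean xs (\<lambda>y. rad_mean (concat xss) (\<lambda>v. F (v + y)))"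
    using rad_mean_uminus[of xs "\<lambda>y. rad_mean (concat xss) (\<lambda>v. F (v + y))"] by simp
  finally show ?case by (simp add: rad_mean_append add.commute)
qed simp

section \<open>The largest average of vectors in the unit ball\<close>

text \<open>The function \<open>\<phi>\<close> of the introduction. The set is nonempty and bounded by \<open>n\<close>, so that the supremum
  is a genuine one.\<close>

definition rad_sup :: "'b::real_normed_vector itself \<Rightarrow> nat \<Rightarrow> real" where
  "rad_sup _ n = (SUP xs\<in>{xs :: 'b list. length xs = n \<and> (\<forall>x\<in>set xs. norm x \<le> 1)}. rad_mean xs norm)"

lemma rad_mean_norm_le_length:
  assumes "\<forall>x\<in>set xs. norm x \<le> 1"
  shows "rad_mean xs norm \<le> real (length xs)"
proof -
  have "sum_list (map norm xs) \<le> real (length xs)" using assms by (induction xs) auto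
  then show ?thesis using rad_mean_le_sum_list[of xs 0] by simp
qed

lemma rad_mean_le_rad_sup:
  fixes xs :: "'b::real_normed_vector list"
  assumes "\<forall>x\<in>set xs. norm x \<le> 1"
  shows "rad_mean xs norm \<le> rad_sup TYPE('b) (length xs)"
  unfolding rad_sup_def
  by (rule cSUP_upper) (use assms rad_mean_norm_le_length in \<open>force intro: bdd_aboveI2\<close>)+

lemma rad_sup_least:
  assumes "\<And>xs :: 'b::real_normed_vector list.
    length xs = n \<Longrightarrow> \<forall>x\<in>set xs. norm x \<le> 1 \<Longrightarrow> rad_mean xs norm \<le> c"
  shows "rad_sup TYPE('b) n \<le> c"
  unfolding rad_sup_def
proof (rule cSUP_least)
  have "replicate n (0::'b) \<in> {xs. length xs = n \<and> (\<forall>x\<in>set xs. norm x \<le> 1)}" by simp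
  then show "{xs :: 'b list. length xs = n \<and> (\<forall>x\<in>set xs. norm x \<le> 1)} \<noteq> {}" by blast
qed (use assms in auto)

lemma rad_sup_nonneg: "0 \<le> rad_sup TYPE('b::real_normed_vector) n"
proof -
  have "0 \<le> rad_mean (replicate n (0::'b)) norm" by (rule rad_mean_nonneg) simp
  also have "\<dots> \<le> rad_sup TYPE('b) n"
    using rad_mean_le_rad_sup[of "replicate n (0::'b)"] by simp
  finally show ?thesis .
qed

lemma rad_sup_le: "rad_sup TYPE('b::real_normed_vector) n \<le> real n"
  by (rule rad_sup_least) (use rad_mean_norm_le_length in blast)

lemma rad_sup_mono:
  assumes "m \<le> n"
  shows "rad_sup TYPE('b::real_normed_vector) m \<le> rad_sup TYPE('b) n"
proof (rule rad_sup_least)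
  fix xs :: "'b list" assume xs: "length xs = m" "\<forall>x\<in>set xs. norm x \<le> 1"
  have "rad_mean xs norm \<le> rad_mean (xs @ replicate (n - m) 0) norm" by (rule rad_mean_norm_append)
  also have "\<dots> \<le> rad_sup TYPE('b) n"
    using rad_mean_le_rad_sup[of "xs @ replicate (n - m) 0"] xs assms by (simp add: ball_Un)
  finally show "rad_mean xs norm \<le> rad_sup TYPE('b) n" .
qed

lemma rad_sup_attained_up_to_2:
  "\<exists>xs :: 'b::real_normed_vector list. length xs = n \<and> (\<forall>x\<in>set xs. norm x \<le> 1) \<and>
     rad_sup TYPE('b) n \<le> 2 * rad_mean xs norm"
proof (rule ccontr)
  assume "\<not> ?thesis"
  then have *: "2 * rad_mean xs norm < rad_sup TYPE('b) n"
    if "length xs = n" "\<forall>x\<in>set xs. norm x \<le> 1" for xs :: "'b list"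
    using that by force
  have "rad_sup TYPE('b) n \<le> rad_sup TYPE('b) n / 2"
    by (rule rad_sup_least) (use * in force)
  moreover have "0 < rad_sup TYPE('b) n"
  proof -
    have "0 \<le> rad_mean (replicate n (0::'b)) norm" by (rule rad_mean_nonneg) simp
    then show ?thesis using *[of "replicate n 0"] by simp
  qed
  ultimately show False by simp
qed

section \<open>Averages as integrals over the Rademacher space\<close>

lemma measurable_rademacher_coordinate:
  "(\<lambda>\<epsilon>. \<epsilon> i) \<in> borel_measurable rademacher_space"
proof -
  have "(\<lambda>\<epsilon>. \<epsilon> i) \<in> measurable rademacher_space (measure_pmf (pmf_of_set {-1, 1 :: real}))"
    unfolding rademacher_space_def by (rule measurable_component_singleton) simp
  moreover have "(\<lambda>x. x) \<in> measurable (measure_pmf (pmf_of_set {-1, 1 :: real})) borel" by simp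
  ultimately show ?thesis by (rule measurable_compose)
qed

text \<open>The product space is split into its first coordinate and the shifted sequence, which matches the
  recursion defining \<open>rad_mean\<close>.\<close>

lemma nn_integral_rademacher:
  fixes xs :: "'b::{banach,second_countable_topology} list"
  assumes "F \<in> borel_measurable borel" "\<And>v. 0 \<le> F v"
  shows "(\<integral>\<^sup>+\<epsilon>. ennreal (F (\<Sum>i<length xs. \<epsilon> i *\<^sub>R xs ! i)) \<partial>rademacher_space) = ennreal (rad_mean xs F)"
  using assms
proof (induction xs arbitrary: F)
  case Nil
  interpret prob_space rademacher_space by (rule prob_space_rademacher_space)
  show ?case by (simp add: emeasure_space_1)
next
  case (Cons x xs)
  note [measurable] = Cons.prems(1) measurable_rademacher_coordinate
  let ?P = "measure_pmf (pmf_of_set {-1, 1 :: real})"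
  interpret sequence_space ?P
    by unfold_locales
  have S: "S = rademacher_space" by (simp add: rademacher_space_def)
  let ?f = "\<lambda>\<epsilon>. ennreal (F (\<Sum>i<length (x # xs). \<epsilon> i *\<^sub>R (x # xs) ! i))"
  let ?g = "\<lambda>\<epsilon>. \<Sum>i<length xs. \<epsilon> i *\<^sub>R xs ! i"
  have m: "?f \<in> borel_measurable S" unfolding S by measurable
  have c: "(\<lambda>(s, \<omega>). case_nat s \<omega>) \<in> measurable (?P \<Otimes>\<^sub>M S) S"
    by measurable
  have "(\<integral>\<^sup>+\<epsilon>. ?f \<epsilon> \<partial>S) = (\<integral>\<^sup>+y. ?f (case y of (s, \<omega>) \<Rightarrow> case_nat s \<omega>) \<partial>(?P \<Otimes>\<^sub>M S))"
    using m by (subst PiM_iter[symmetric], subst nn_integral_distr[OF c]) simp_all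
  also have "\<dots> = (\<integral>\<^sup>+s. \<integral>\<^sup>+\<omega>. ?f (case_nat s \<omega>) \<partial>S \<partial>?P)"
    using measurable_compose[OF c m]
    by (subst P.nn_integral_fst[symmetric]) simp_all
  also have "\<dots> = (\<integral>\<^sup>+s. \<integral>\<^sup>+\<omega>. ennreal (F (?g \<omega> + s *\<^sub>R x)) \<partial>S \<partial>?P)"
    by (simp add: sum.lessThan_Suc_shift add.commute del: sum.lessThan_Suc)
  also have "\<dots> = ((\<integral>\<^sup>+\<omega>. ennreal (F (?g \<omega> + x)) \<partial>S) + (\<integral>\<^sup>+\<omega>. ennreal (F (?g \<omega> - x)) \<partial>S)) / 2"
    by (subst nn_integral_pmf_of_set) (simp_all add: add.commute)
  also have "(\<integral>\<^sup>+\<omega>. ennreal (F (?g \<omega> + x)) \<partial>S) = ennreal (rad_mean xs (\<lambda>v. F (v + x)))"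
    unfolding S by (rule Cons.IH) (use Cons.prems in simp_all)
  also have "(\<integral>\<^sup>+\<omega>. ennreal (F (?g \<omega> - x)) \<partial>S) = ennreal (rad_mean xs (\<lambda>v. F (v - x)))"
    unfolding S by (rule Cons.IH) (use Cons.prems in simp_all)
  finally show ?case
    using Cons.prems(2)
    by (simp add: S rad_mean_nonneg ennreal_plus[symmetric] divide_ennreal[symmetric]
        del: ennreal_plus)
qed

lemma integral_rademacher_norm:
  fixes xs :: "'b::{banach,second_countable_topology} list"
  shows "(\<integral>\<epsilon>. norm (\<Sum>i<length xs. \<epsilon> i *\<^sub>R xs ! i) \<partial>rademacher_space) = rad_mean xs norm"
proof -
  note [measurable] = measurable_rademacher_coordinate
  have "(\<integral>\<epsilon>. norm (\<Sum>i<length xs. \<epsilon> i *\<^sub>R xs ! i) \<partial>rademacher_space)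
     = enn2real (\<integral>\<^sup>+\<epsilon>. ennreal (norm (\<Sum>i<length xs. \<epsilon> i *\<^sub>R xs ! i)) \<partial>rademacher_space)"
    by (rule integral_eq_nn_integral) auto
  also have "\<dots> = rad_mean xs norm"
    by (subst nn_integral_rademacher) (simp_all add: rad_mean_nonneg)
  finally show ?thesis .
qed

lemma stable_type_iff:
  "stable_type TYPE('b::{banach,second_countable_topology}) p \<longleftrightarrow>
     (\<exists>C>0. \<forall>x :: 'b list. rad_mean x norm \<le> C * weak_lp_norm p (map norm x))"
  unfolding stable_type_def integral_rademacher_norm ..

section \<open>The layer-cake bound\<close>

lemma measurable_rad_mean:
  fixes h :: "'a \<Rightarrow> 'b::{banach,second_countable_topology}"
  assumes "\<forall>f\<in>set fs. f \<in> borel_measurable M" "h \<in> borel_measurable M"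
  shows "(\<lambda>t. rad_mean (map (\<lambda>f. f t) fs) (\<lambda>v. norm (h t + v))) \<in> borel_measurable M"
  using assms
proof (induction fs arbitrary: h)
  case (Cons f fs)
  have "(\<lambda>t. rad_mean (map (\<lambda>f. f t) fs) (\<lambda>v. norm (h t + f t + v))) \<in> borel_measurable M"
    "(\<lambda>t. rad_mean (map (\<lambda>f. f t) fs) (\<lambda>v. norm (h t - f t + v))) \<in> borel_measurable M"
    by (rule Cons.IH; use Cons.prems in \<open>auto intro: borel_measurable_add borel_measurable_diff\<close>)+
  then show ?case by (simp add: algebra_simps)
qed simp

text \<open>Minkowski's inequality for Rademacher averages. The function \<open>h\<close> absorbs the summands whose signs
  have already been fixed.\<close>

lemma rad_mean_norm_integral_le:
  fixes h :: "'a \<Rightarrow> 'b::{banach,second_countable_topology}"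
  assumes "\<forall>f\<in>set fs. integrable M f" "integrable M h"
  shows "ennreal (rad_mean (map (\<lambda>f. \<integral>t. f t \<partial>M) fs) (\<lambda>v. norm ((\<integral>t. h t \<partial>M) + v)))
    \<le> (\<integral>\<^sup>+t. ennreal (rad_mean (map (\<lambda>f. f t) fs) (\<lambda>v. norm (h t + v))) \<partial>M)"
  using assms
proof (induction fs arbitrary: h)
  case Nil
  then show ?case by (simp add: integral_norm_bound_ennreal)
next
  case (Cons f fs)
  let ?R = "\<lambda>h t. rad_mean (map (\<lambda>f. f t) fs) (\<lambda>v. norm (h t + v))"
  let ?L = "\<lambda>a. rad_mean (map (\<lambda>f. \<integral>t. f t \<partial>M) fs) (\<lambda>v. norm (a + v))"
  have int: "integrable M f" "integrable M h" "\<forall>f\<in>set fs. integrable M f" using Cons.prems by auto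
  have nn: "0 \<le> rad_mean ys (\<lambda>v. norm (a + v))" for ys and a :: 'b
    by (intro rad_mean_nonneg norm_ge_zero)
  have meas: "?R (\<lambda>t. h t + f t) \<in> borel_measurable M" "?R (\<lambda>t. h t - f t) \<in> borel_measurable M"
    using int by (auto intro!: measurable_rad_mean)
  have half: "ennreal ((a + b) / 2) = (ennreal a + ennreal b) / 2" if "0 \<le> a" "0 \<le> b" for a b
    using that by (simp add: divide_ennreal[symmetric])
  have "ennreal ((?L ((\<integral>t. h t \<partial>M) + (\<integral>t. f t \<partial>M)) + ?L ((\<integral>t. h t \<partial>M) - (\<integral>t. f t \<partial>M))) / 2)
     = (ennreal (?L (\<integral>t. h t + f t \<partial>M)) + ennreal (?L (\<integral>t. h t - f t \<partial>M))) / 2"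
    using nn int by (simp add: half)
  also have "\<dots> \<le> ((\<integral>\<^sup>+t. ennreal (?R (\<lambda>t. h t + f t) t) \<partial>M) + (\<integral>\<^sup>+t. ennreal (?R (\<lambda>t. h t - f t) t) \<partial>M)) / 2"
    by (intro divide_right_mono_ennreal add_mono Cons.IH) (use int in auto)
  also have "\<dots> = (\<integral>\<^sup>+t. (ennreal (?R (\<lambda>t. h t + f t) t) + ennreal (?R (\<lambda>t. h t - f t) t)) / 2 \<partial>M)"
    using meas by (simp add: nn_integral_divide nn_integral_add)
  also have "\<dots> = (\<integral>\<^sup>+t. ennreal ((?R (\<lambda>t. h t + f t) t + ?R (\<lambda>t. h t - f t) t) / 2) \<partial>M)"
    using nn by (simp add: half)
  finally show ?case by (simp add: algebra_simps)
qed

text \<open>Write \<open>x\<close> as the integral of its unit vector over \<open>0 < t < \<parallel>x\<parallel>\<close>. For each \<open>t\<close> only the unit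
  vectors belonging to the \<open>x\<close> with \<open>\<parallel>x\<parallel> > t\<close> enter.\<close>

lemma rad_mean_layer_cake:
  fixes xs :: "'b::{banach,second_countable_topology} list"
  shows "ennreal (rad_mean xs norm) \<le>
    (\<integral>\<^sup>+t\<in>{0<..}. ennreal (rad_sup TYPE('b) (length (filter (\<lambda>x. t < norm x) xs))) \<partial>lborel)"
proof -
  define u where "u x = x /\<^sub>R norm x" for x :: 'b
  define f where "f x = (\<lambda>t. indicator {0<..<norm x} t *\<^sub>R u x)" for x :: 'b
  have u_le: "norm (u x) \<le> 1" for x
    by (cases "x = 0") (simp_all add: u_def)
  have int: "integrable lborel (f x)" for x
    unfolding f_def by (auto intro!: integrable_scaleR_left integrable_real_indicator)
  have val: "(\<integral>t. f x t \<partial>lborel) = x" for x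
    by (cases "x = 0") (simp_all add: f_def u_def)
  have "ennreal (rad_mean xs norm) \<le> (\<integral>\<^sup>+t. ennreal (rad_mean (map (\<lambda>x. f x t) xs) norm) \<partial>lborel)"
    using rad_mean_norm_integral_le[of "map f xs" lborel "\<lambda>_. 0"] int
    by (simp add: comp_def val)
  also have "\<dots> \<le> (\<integral>\<^sup>+t\<in>{0<..}. ennreal (rad_sup TYPE('b) (length (filter (\<lambda>x. t < norm x) xs))) \<partial>lborel)"
  proof (rule nn_integral_mono)
    fix t :: real
    show "ennreal (rad_mean (map (\<lambda>x. f x t) xs) norm) \<le>
       ennreal (rad_sup TYPE('b) (length (filter (\<lambda>x. t < norm x) xs))) * indicator {0<..} t"
    proof (cases "t > 0")
      case True
      have "map (\<lambda>x. f x t) xs = map (\<lambda>x. if t < norm x then u x else 0) xs"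
        using True by (auto simp: f_def)
      then have "rad_mean (map (\<lambda>x. f x t) xs) norm = rad_mean (map u (filter (\<lambda>x. t < norm x) xs)) norm"
        by (simp only: rad_mean_filter)
      also have "\<dots> \<le> rad_sup TYPE('b) (length (map u (filter (\<lambda>x. t < norm x) xs)))"
        using u_le by (intro rad_mean_le_rad_sup) auto
      finally show ?thesis using True by (simp add: ennreal_leI)
    next
      case False
      then have "map (\<lambda>x. f x t) xs = map (\<lambda>x. if False then u x else 0) xs"
        by (auto simp: f_def)
      then have "rad_mean (map (\<lambda>x. f x t) xs) norm = 0"
        by (simp only: rad_mean_filter) simp
      then show ?thesis by simp
    qed
  qed
  finally show ?thesis .
qed

section \<open>Self-improvement of the growth exponent\<close>

lemma length_filter_sum_squares:
  fixes xs :: "'b::real_normed_vector list"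
  assumes "0 \<le> t"
  shows "real (length (filter (\<lambda>x. t < norm x) xs)) * t\<^sup>2 \<le> sum_list (map (\<lambda>x. (norm x)\<^sup>2) xs)"
proof (induction xs)
  case (Cons x xs)
  have "t\<^sup>2 \<le> (norm x)\<^sup>2" if "t < norm x" using that assms by (intro power_mono) auto
  with Cons show ?case by (auto simp: algebra_simps intro: add_increasing)
qed simp

text \<open>A type 2 bound for lists of length at most \<open>N\<close> whose squared norms sum to at most \<open>1\<close>: for such
  lists the counting function at level \<open>t\<close> is at most \<open>min N (1 / t\<^sup>2)\<close> and vanishes beyond \<open>1\<close>.\<close>

lemma rad_mean_le_if_rad_sup_le:
  fixes xs :: "'b::{banach,second_countable_topology} list"
  assumes \<alpha>: "1 / 2 < \<alpha>" and \<theta>: "0 \<le> \<theta>" and c: "0 \<le> c"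
    and bound: "\<And>m. rad_sup TYPE('b) m \<le> \<theta> * real m powr \<alpha> + c"
    and squares: "sum_list (map (\<lambda>x. (norm x)\<^sup>2) xs) \<le> 1"
    and N: "length xs \<le> N" "1 \<le> N"
  shows "rad_mean xs norm \<le> c + \<theta> * (2 * \<alpha> / (2 * \<alpha> - 1)) * real N powr (\<alpha> - 1 / 2)"
proof -
  \<comment> \<open>the level at which the two bounds \<open>N\<close> and \<open>1 / t\<^sup>2\<close> on the counting function coincide\<close>
  define \<tau> where "\<tau> = real N powr (- 1 / 2)"
  have \<tau>: "0 < \<tau>" using N by (simp add: \<tau>_def)
  let ?A = "\<lambda>t. ennreal c * indicator {0..1} t :: ennreal"
  let ?B = "\<lambda>t. ennreal (\<theta> * real N powr \<alpha>) * indicator {0..\<tau>} t :: ennreal"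
  let ?C = "\<lambda>t. ennreal \<theta> * ennreal (indicator {\<tau>..} t * t powr (- (2 * \<alpha>)))"
  let ?n = "\<lambda>t. length (filter (\<lambda>x. t < norm x) xs)"
  have pw: "ennreal (rad_sup TYPE('b) (?n t)) * indicator {0<..} t \<le> ?A t + ?B t + ?C t" for t
  proof (cases "0 < t \<and> 1 \<le> ?n t")
    case False
    moreover have "rad_sup TYPE('b) 0 = 0" using rad_sup_le[where 'b='b, of 0] rad_sup_nonneg[where 'b='b, of 0] by simp
    ultimately have z: "ennreal (rad_sup TYPE('b) (?n t)) * indicator {0<..} t = 0"
      by (cases "0 < t") (simp_all add: not_le)
    show ?thesis unfolding z by (rule zero_le)
  next
    case True
    then have t: "0 < t" "1 \<le> real (?n t)" by simp_all
    have n2: "real (?n t) * t\<^sup>2 \<le> 1"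
      using length_filter_sum_squares[of t xs] squares t by linarith
    have "t\<^sup>2 \<le> real (?n t) * t\<^sup>2" using t by simp
    with n2 have "t\<^sup>2 \<le> 1" by linarith
    then have t1: "t \<le> 1" using t by (simp add: power2_le_iff_abs_le[of 1, simplified])
    have "rad_sup TYPE('b) (?n t) \<le> c + \<theta> * real (?n t) powr \<alpha>" using bound[of "?n t"] by simp
    also have "\<dots> \<le> c + (if t \<le> \<tau> then \<theta> * real N powr \<alpha> else \<theta> * t powr (- (2 * \<alpha>)))"
    proof (cases "t \<le> \<tau>")
      case True
      have "?n t \<le> N" using N(1) length_filter_le[of "\<lambda>x. t < norm x" xs] by linarith
      then have "real (?n t) powr \<alpha> \<le> real N powr \<alpha>" using \<alpha> by (intro powr_mono2) auto
      with True \<theta> show ?thesis by (simp add: mult_left_mono)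
    next
      case False
      have "real (?n t) \<le> t powr (-2)"
        using n2 t by (simp add: powr_minus field_simps)
      then have "real (?n t) powr \<alpha> \<le> (t powr (-2)) powr \<alpha>" using \<alpha> by (intro powr_mono2) auto
      also have "\<dots> = t powr (- (2 * \<alpha>))" by (simp add: powr_powr)
      finally show ?thesis using False \<theta> by (simp add: mult_left_mono)
    qed
    finally have "ennreal (rad_sup TYPE('b) (?n t)) \<le>
       ennreal (c + (if t \<le> \<tau> then \<theta> * real N powr \<alpha> else \<theta> * t powr (- (2 * \<alpha>))))"
      by (rule ennreal_leI)
    also have "\<dots> \<le> ?A t + ?B t + ?C t"
      using t t1 \<theta> c \<tau> by (auto simp: ennreal_mult intro: add_increasing2)
    finally show ?thesis using t by simp
  qed
  have "((\<lambda>t. t powr (- (2 * \<alpha>))) has_integral - (\<tau> powr (- (2 * \<alpha>) + 1)) / (- (2 * \<alpha>) + 1)) {\<tau>..}"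
    by (rule has_integral_powr_to_inf) (use \<alpha> \<tau> in auto)
  moreover have eq: "- (\<tau> powr (- (2 * \<alpha>) + 1)) / (- (2 * \<alpha>) + 1) = \<tau> powr (1 - (2 * \<alpha>)) / (2 * \<alpha> - 1)"
    using \<alpha> by (auto simp: field_simps)
  ultimately have C: "(\<integral>\<^sup>+t. ennreal (indicator {\<tau>..} t * t powr (- (2 * \<alpha>))) \<partial>lborel)
      = ennreal (\<tau> powr (1 - (2 * \<alpha>)) / (2 * \<alpha> - 1))"
    by (subst nn_integral_has_integral_lebesgue) (simp_all only: eq, simp)
  have "ennreal (rad_mean xs norm) \<le> (\<integral>\<^sup>+t. (?A t + ?B t) + ?C t \<partial>lborel)"
    using rad_mean_layer_cake[of xs] by (rule order_trans) (intro nn_integral_mono pw)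
  also have "\<dots> = ennreal c + ennreal (\<theta> * real N powr \<alpha>) * ennreal \<tau>
      + ennreal \<theta> * ennreal (\<tau> powr (1 - (2 * \<alpha>)) / (2 * \<alpha> - 1))"
    using \<tau> by (simp add: nn_integral_add nn_integral_cmult C)
  also have "\<dots> = ennreal (c + \<theta> * (real N powr \<alpha> * \<tau>) + \<theta> * (\<tau> powr (1 - (2 * \<alpha>)) / (2 * \<alpha> - 1)))"
    using \<alpha> \<theta> c \<tau>
    by (simp add: ennreal_mult[symmetric] ennreal_plus[symmetric] mult.assoc del: ennreal_plus)
  also have "real N powr \<alpha> * \<tau> = real N powr (\<alpha> - 1 / 2)"
    by (simp add: \<tau>_def flip: powr_add)
  also have "\<tau> powr (1 - (2 * \<alpha>)) = real N powr (\<alpha> - 1 / 2)"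
    unfolding \<tau>_def powr_powr
    by (rule arg_cong[where f = "\<lambda>e. real N powr e"]) (simp add: field_simps)
  finally have "rad_mean xs norm \<le> c + \<theta> * real N powr (\<alpha> - 1 / 2)
      + \<theta> * (real N powr (\<alpha> - 1 / 2) / (2 * \<alpha> - 1))"
    using \<alpha> \<theta> c by (subst (asm) ennreal_le_iff) auto
  also have "\<dots> = c + \<theta> * (2 * \<alpha> / (2 * \<alpha> - 1)) * real N powr (\<alpha> - 1 / 2)"
    using \<alpha> by (simp add: field_simps)
  finally show ?thesis .
qed

lemma concat_split:
  "sum_list ns = length xs \<Longrightarrow> \<exists>xss. concat xss = xs \<and> map length xss = ns"
proof (induction ns arbitrary: xs)
  case (Cons n ns)
  then obtain xss where "concat xss = drop n xs" "map length xss = ns"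
    using Cons.IH[of "drop n xs"] by force
  with Cons.prems show ?case
    by (intro exI[of _ "take n xs # xss"]) auto
qed simp

lemma sum_list_concat_nth:
  "sum_list (map f (concat xss)) = (\<Sum>l<length xss. sum_list (map f (xss ! l)))"
  for f :: "'a \<Rightarrow> real"
  by (induction xss) (simp_all add: sum.lessThan_Suc_shift del: sum.lessThan_Suc)

text \<open>Submultiplicativity of the type 2 constants: a list of length \<open>N ^ (k + 1)\<close> is cut into \<open>N\<close> blocks
  of length \<open>N ^ k\<close>, and the inequality is applied first to the block sums and then inside the
  blocks.\<close>

lemma type2_power:
  fixes R :: real
  assumes R: "0 \<le> R"
    and type2: "\<And>xs :: 'b::real_normed_vector list. length xs = N \<Longrightarrow>
      rad_mean xs (\<lambda>v. (norm v)\<^sup>2) \<le> R * sum_list (map (\<lambda>x. (norm x)\<^sup>2) xs)"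
  shows "length (xs :: 'b list) = N ^ k \<Longrightarrow>
    rad_mean xs (\<lambda>v. (norm v)\<^sup>2) \<le> R ^ k * sum_list (map (\<lambda>x. (norm x)\<^sup>2) xs)"
proof (induction k arbitrary: xs)
  case 0
  then obtain x where "xs = [x]" by (auto simp: length_Suc_conv)
  then show ?case by simp
next
  case (Suc k)
  let ?q = "\<lambda>xs :: 'b list. sum_list (map (\<lambda>x. (norm x)\<^sup>2) xs)"
  have "sum_list (replicate N (N ^ k)) = length xs" using Suc.prems by (simp add: sum_list_replicate)
  then obtain xss where xss: "concat xss = xs" "map length xss = replicate N (N ^ k)"
    using concat_split by blast
  have len: "length xss = N" using arg_cong[OF xss(2), of length] by simp
  have len': "length (xss ! l) = N ^ k" if "l < N" for l
    using arg_cong[OF xss(2), of "\<lambda>ns. ns ! l"] that len by simp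
  have "rad_mean xs (\<lambda>v. (norm v)\<^sup>2) = block_mean xss (\<lambda>ys. rad_mean ys (\<lambda>v. (norm v)\<^sup>2))"
    by (simp flip: xss(1) add: rad_mean_concat)
  also have "\<dots> \<le> block_mean xss (\<lambda>ys. \<Sum>l<length xss. R * (norm (ys ! l))\<^sup>2)"
  proof (rule block_mean_mono)
    fix ys :: "'b list" assume ys: "length ys = length xss"
    have "?q ys = (\<Sum>l<length xss. (norm (ys ! l))\<^sup>2)"
      by (simp add: ys sum_list_sum_nth atLeast0LessThan)
    then show "rad_mean ys (\<lambda>v. (norm v)\<^sup>2) \<le> (\<Sum>l<length xss. R * (norm (ys ! l))\<^sup>2)"
      using type2[of ys] ys len by (simp add: sum_distrib_left)
  qed
  also have "\<dots> = (\<Sum>l<length xss. R * rad_mean (xss ! l) (\<lambda>v. (norm v)\<^sup>2))"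
    by (rule block_mean_sum)
  also have "\<dots> \<le> (\<Sum>l<length xss. R * (R ^ k * ?q (xss ! l)))"
    using R len len' by (intro sum_mono mult_left_mono Suc.IH) auto
  also have "\<dots> = R ^ Suc k * ?q xs"
    by (simp add: sum_list_concat_nth sum_distrib_left mult_ac flip: xss(1))
  finally show ?case .
qed

text \<open>Little-o growth at the exponent \<open>\<alpha> > 1 / 2\<close> forces growth at a strictly smaller exponent.\<close>

lemma rad_sup_power_saving:
  assumes \<alpha>: "1 / 2 < \<alpha>"
    and small: "\<And>\<theta>. 0 < \<theta> \<Longrightarrow> \<exists>c. \<forall>m.
      rad_sup TYPE('b::{banach,second_countable_topology}) m \<le> \<theta> * real m powr \<alpha> + c"
  obtains \<beta> C where "0 < \<beta>" "\<beta> < \<alpha>" "0 \<le> C" "\<And>m. rad_sup TYPE('b) m \<le> C * real m powr \<beta>"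
proof -
  define a where "a = \<alpha> - 1 / 2"
  have a: "0 < a" using \<alpha> by (simp add: a_def)
  define K where "K = 2 * \<alpha> / (2 * \<alpha> - 1)"
  have K: "0 < K" using \<alpha> by (simp add: K_def)
  \<comment> \<open>the choice of \<open>\<theta> = 1 / (8 K)\<close> makes the main term of the type 2 bound \<open>N\<^sup>a / 8\<close>, and \<open>N\<close> is then
    taken so large that \<open>c \<le> N\<^sup>a / 8\<close> as well\<close>
  obtain c where c': "\<And>m. rad_sup TYPE('b) m \<le> (1 / (8 * K)) * real m powr \<alpha> + c"
    using small[of "1 / (8 * K)"] K by auto
  have c0: "0 \<le> c" using c'[of 0] rad_sup_nonneg[where 'b='b, of 0] \<alpha> by simp
  obtain N :: nat where "max 2 ((8 * c + 3) powr (1 / a)) \<le> real N"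
    using real_arch_simple by blast
  then have "2 \<le> N" "(8 * c + 3) powr (1 / a) \<le> real N" by simp_all
  then have "((8 * c + 3) powr (1 / a)) powr a \<le> real N powr a"
    using a by (intro powr_mono2) auto
  then have N: "8 * c + 3 \<le> real N powr a" "2 \<le> N"
    using a c0 \<open>2 \<le> N\<close> by (simp_all add: powr_powr)
  define R where "R = (real N powr a / 2)\<^sup>2"
  have type2: "rad_mean xs (\<lambda>v. (norm v)\<^sup>2) \<le> R * sum_list (map (\<lambda>x. (norm x)\<^sup>2) xs)"
    if len: "length xs = N" for xs :: "'b list"
  proof -
    define W where "W = sqrt (sum_list (map (\<lambda>x. (norm x)\<^sup>2) xs))"
    have sq: "W\<^sup>2 = sum_list (map (\<lambda>x. (norm x)\<^sup>2) xs)" and W0: "0 \<le> W"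
      by (auto simp: W_def intro!: sum_list_nonneg real_sqrt_pow2)
    show ?thesis
    proof (cases "W = 0")
      case True
      then have "sum_list (map (\<lambda>x. (norm x)\<^sup>2) xs) = 0" using sq by simp
      then have "sum_list (map norm xs) = 0"
        by (subst (asm) sum_list_nonneg_eq_0_iff; induction xs) auto
      then have "rad_mean xs norm \<le> 0" using rad_mean_le_sum_list[of xs 0] by simp
      moreover have "0 \<le> rad_mean xs norm" by (simp add: rad_mean_nonneg)
      ultimately show ?thesis using kahane[of xs] sq True by simp
    next
      case False
      define ys where "ys = map (\<lambda>x. (1 / W) *\<^sub>R x) xs"
      have xs: "xs = map (\<lambda>x. W *\<^sub>R x) ys" using False by (simp add: ys_def comp_def)
      have "sum_list (map (\<lambda>x. (norm x)\<^sup>2) ys) = sum_list (map (\<lambda>x. (1 / W)\<^sup>2 * (norm x)\<^sup>2) xs)"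
        by (simp add: ys_def comp_def power_mult_distrib power_divide)
      also have "\<dots> = (1 / W)\<^sup>2 * W\<^sup>2" by (simp add: sq sum_list_const_mult)
      finally have q: "sum_list (map (\<lambda>x. (norm x)\<^sup>2) ys) \<le> 1" using False by (simp add: power_divide)
      have "rad_mean ys norm \<le> c + 1 / (8 * K) * K * real N powr a"
        unfolding K_def a_def
        by (rule rad_mean_le_if_rad_sup_le[OF \<alpha> _ c0 c'[unfolded K_def] q])
           (use N len \<alpha> in \<open>auto simp: ys_def\<close>)
      also have "\<dots> \<le> real N powr a / 4" using N c0 K by simp
      finally have "(rad_mean ys norm)\<^sup>2 \<le> (real N powr a / 4)\<^sup>2"
        by (intro power_mono rad_mean_nonneg) auto
      then have "rad_mean ys (\<lambda>v. (norm v)\<^sup>2) \<le> 2 * (real N powr a / 4)\<^sup>2"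
        using kahane[of ys] by linarith
      also have "\<dots> \<le> R" by (simp add: R_def power_divide)
      finally have "rad_mean ys (\<lambda>v. (norm v)\<^sup>2) \<le> R" .
      moreover have "rad_mean xs (\<lambda>v. (norm v)\<^sup>2) = W\<^sup>2 * rad_mean ys (\<lambda>v. (norm v)\<^sup>2)"
        by (subst xs) (simp add: rad_mean_scaleR power_mult_distrib rad_mean_cmult)
      ultimately show ?thesis by (simp add: sq[symmetric] mult.commute[of R] mult_left_mono)
    qed
  qed
  have R0: "0 \<le> R" by (simp add: R_def)
  \<comment> \<open>chosen so that \<open>N\<^sup>\<beta> = N\<^sup>\<alpha> / 2\<close>\<close>
  define \<beta> where "\<beta> = \<alpha> - log (real N) 2"
  have N1: "1 < real N" using N by simp
  have powN: "real N powr \<beta> = real N powr \<alpha> / 2"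
    using N1 by (simp add: \<beta>_def powr_diff)
  have "2 < real N powr a" using N c0 by linarith
  also have "\<dots> \<le> real N powr \<alpha>" using N1 by (intro powr_mono) (auto simp: a_def)
  finally have "1 < real N powr \<beta>" by (simp add: powN)
  then have \<beta>0: "0 < \<beta>" using N1 powr_mono[of \<beta> 0 "real N"] by (cases "0 < \<beta>") auto
  have pow: "rad_sup TYPE('b) (N ^ k) \<le> (real N powr \<beta>) ^ k" for k
  proof (rule rad_sup_least)
    fix xs :: "'b list" assume xs: "length xs = N ^ k" "\<forall>x\<in>set xs. norm x \<le> 1"
    have "sum_list (map (\<lambda>x. (norm x)\<^sup>2) xs) \<le> sum_list (map (\<lambda>x. 1) xs)"
      using xs(2) by (intro sum_list_mono) (auto simp: power_le_one)
    then have "sum_list (map (\<lambda>x. (norm x)\<^sup>2) xs) \<le> real N ^ k" by (simp add: sum_list_triv xs)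
    then have "(rad_mean xs norm)\<^sup>2 \<le> R ^ k * real N ^ k"
      using type2_power[OF R0 type2 xs(1)] rad_mean_power2_le[of xs norm] R0
      by (meson mult_left_mono order_trans zero_le_power)
    also have "\<dots> = ((real N powr \<beta>) ^ k)\<^sup>2"
    proof -
      have "R * real N = (real N powr a)\<^sup>2 * real N powr 1 / 4" using N1 by (simp add: R_def power_divide)
      also have "(real N powr a)\<^sup>2 * real N powr 1 = (real N powr \<alpha>)\<^sup>2"
        unfolding power2_eq_square by (simp only: powr_add[symmetric]) (simp add: a_def)
      finally have "R * real N = (real N powr \<beta>)\<^sup>2" by (simp add: powN power_divide)
      then show ?thesis by (simp add: power_mult_distrib[symmetric] power_even_eq[symmetric] power_mult[symmetric] mult.commute)
    qed
    finally show "rad_mean xs norm \<le> (real N powr \<beta>) ^ k"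
      by (rule power2_le_imp_le) simp
  qed
  have "rad_sup TYPE('b) m \<le> real N powr \<beta> * real m powr \<beta>" for m
  proof (cases "m = 0")
    case True
    then show ?thesis using rad_sup_le[where 'b='b, of 0] by simp
  next
    case False
    then obtain k where k: "N ^ k \<le> m" "m < N ^ (k + 1)" using ex_power_ivl1[of N m] N by auto
    have "rad_sup TYPE('b) m \<le> rad_sup TYPE('b) (N ^ (k + 1))" using k by (intro rad_sup_mono) simp
    also have "\<dots> \<le> (real N powr \<beta>) ^ (k + 1)" by (rule pow)
    also have "\<dots> = real N powr \<beta> * real (N ^ k) powr \<beta>"
      using N1 by (simp add: powr_power powr_powr mult.commute flip: powr_realpow)
    also have "\<dots> \<le> real N powr \<beta> * real m powr \<beta>"
      using k(1) \<beta>0 by (intro mult_left_mono powr_mono2) (auto simp flip: of_nat_power)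
    finally show ?thesis .
  qed
  moreover have "\<beta> < \<alpha>" using N1 by (simp add: \<beta>_def)
  ultimately show ?thesis using that[of \<beta> "real N powr \<beta>"] \<beta>0 by simp
qed

section \<open>The weak Lebesgue norm\<close>

lemma card_eq_length_filter:
  "card {i. i < length (map norm xs) \<and> \<bar>map norm xs ! i\<bar> > t} = length (filter (\<lambda>x. t < norm x) xs)"
proof -
  have "{i. i < length (map norm xs) \<and> \<bar>map norm xs ! i\<bar> > t} = {i. i < length xs \<and> t < norm (xs ! i)}"
    by auto
  then show ?thesis by (simp add: length_filter_conv_card)
qed

lemma weak_lp_norm_le:
  fixes xs :: "'b::real_normed_vector list"
  assumes p: "0 < p" and c: "0 \<le> c"
    and le: "\<And>t. 0 < t \<Longrightarrow> t powr p * real (length (filter (\<lambda>x. t < norm x) xs)) \<le> c powr p"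
  shows "weak_lp_norm p (map norm xs) \<le> c"
  unfolding weak_lp_norm_def card_eq_length_filter
proof (rule cSUP_least)
  fix t :: real assume "t \<in> {0<..}"
  then have "(t powr p * real (length (filter (\<lambda>x. t < norm x) xs))) powr (1 / p) \<le> (c powr p) powr (1 / p)"
    using le[of t] p by (intro powr_mono2) auto
  then show "(t powr p * real (length (filter (\<lambda>x. t < norm x) xs))) powr (1 / p) \<le> c"
    using p c by (simp add: powr_powr)
qed (use gt_ex in auto)

lemma weak_lp_norm_ge:
  fixes xs :: "'b::real_normed_vector list"
  assumes p: "0 < p" and t: "0 < t"
  shows "(t powr p * real (length (filter (\<lambda>x. t < norm x) xs))) powr (1 / p) \<le> weak_lp_norm p (map norm xs)"
proof -
  have "t \<in> {0<..}" using t by simp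
  from cSUP_upper[OF this bdd_above_weak_lp_norm[OF p, of "map norm xs"]]
  show ?thesis unfolding weak_lp_norm_def card_eq_length_filter .
qed

lemma weak_lp_norm_nonneg: "0 < p \<Longrightarrow> 0 \<le> weak_lp_norm p (map norm xs)"
  by (rule order_trans[OF powr_ge_zero weak_lp_norm_ge[of p 1]]) simp_all

lemma tail_count_le_weak_lp_norm:
  fixes xs :: "'b::real_normed_vector list"
  assumes p: "0 < p" and t: "0 < t"
  shows "t powr p * real (length (filter (\<lambda>x. t < norm x) xs)) \<le> weak_lp_norm p (map norm xs) powr p"
proof -
  let ?u = "t powr p * real (length (filter (\<lambda>x. t < norm x) xs))"
  have "(?u powr (1 / p)) powr p \<le> weak_lp_norm p (map norm xs) powr p"
    using weak_lp_norm_ge[OF p t, of xs] p by (intro powr_mono2) auto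
  moreover have "(?u powr (1 / p)) powr p = ?u" using p by (simp add: powr_powr)
  ultimately show ?thesis by simp
qed

text \<open>If \<open>W\<close> is the weak norm, then the counting function at level \<open>t\<close> is at most \<open>(W / t)\<^sup>p\<close>, and it
  vanishes for \<open>t > W\<close>; the layer-cake integral is \<open>\<integral> (W / t) powr (p \<beta>) dt\<close> over \<open>0 < t \<le> W\<close>, which
  converges as \<open>p \<beta> < 1\<close>.\<close>

lemma stable_type_if_rad_sup_le:
  assumes p: "0 < p" and \<beta>: "0 < \<beta>" "\<beta> < 1 / p" and C: "0 \<le> C"
    and bound: "\<And>m. rad_sup TYPE('b::{banach,second_countable_topology}) m \<le> C * real m powr \<beta>"
  shows "stable_type TYPE('b) p"
  unfolding stable_type_iff
proof (intro exI[of _ "C / (1 - p * \<beta>) + 1"] conjI allI)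
  have p\<beta>: "p * \<beta> < 1" using p \<beta> by (simp add: field_simps)
  show "0 < C / (1 - p * \<beta>) + 1" using p\<beta> C by (intro add_nonneg_pos divide_nonneg_pos) auto
  fix xs :: "'b list"
  define W where "W = weak_lp_norm p (map norm xs)"
  have W: "0 \<le> W" using p by (simp add: W_def weak_lp_norm_nonneg)
  let ?n = "\<lambda>t. length (filter (\<lambda>x. t < norm x) xs)"
  have pw: "ennreal (rad_sup TYPE('b) (?n t)) * indicator {0<..} t
      \<le> ennreal (C * W powr (p * \<beta>)) * ennreal (indicator {0..W} t * t powr (- (p * \<beta>)))" for t
  proof (cases "0 < t \<and> 1 \<le> ?n t")
    case False
    moreover have "rad_sup TYPE('b) 0 = 0" using rad_sup_le[where 'b='b, of 0] rad_sup_nonneg[where 'b='b, of 0] by simp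
    ultimately have z: "ennreal (rad_sup TYPE('b) (?n t)) * indicator {0<..} t = 0"
      by (cases "0 < t") (simp_all add: not_le)
    show ?thesis unfolding z by (rule zero_le)
  next
    case True
    then have t: "0 < t" "1 \<le> real (?n t)" by simp_all
    have n: "t powr p * real (?n t) \<le> W powr p"
      using tail_count_le_weak_lp_norm[OF p t(1), of xs] by (simp add: W_def)
    have "t powr p * 1 \<le> t powr p * real (?n t)" using t by (intro mult_left_mono) auto
    then have "t powr p \<le> W powr p" using n by linarith
    then have tW: "t \<le> W" using p t W by (meson not_le powr_less_mono2)
    have "real (?n t) \<le> W powr p * t powr (- p)" using n t by (simp add: powr_minus field_simps)
    then have "real (?n t) powr \<beta> \<le> (W powr p * t powr (- p)) powr \<beta>"
      using \<beta> by (intro powr_mono2) auto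
    also have "\<dots> = W powr (p * \<beta>) * t powr (- (p * \<beta>))" by (simp add: powr_mult powr_powr)
    finally have "C * real (?n t) powr \<beta> \<le> C * W powr (p * \<beta>) * t powr (- (p * \<beta>))"
      using C by (simp add: mult_left_mono mult.assoc)
    with bound[of "?n t"] have "ennreal (rad_sup TYPE('b) (?n t)) \<le> ennreal (C * W powr (p * \<beta>) * t powr (- (p * \<beta>)))"
      by (intro ennreal_leI) linarith
    then show ?thesis using t tW C by (simp add: ennreal_mult[symmetric])
  qed
  have I: "(\<integral>\<^sup>+t. ennreal (indicator {0..W} t * t powr (- (p * \<beta>))) \<partial>lborel)
      = ennreal (W powr (- (p * \<beta>) + 1) / (- (p * \<beta>) + 1))"
    by (rule nn_integral_has_integral_lebesgue[OF _ has_integral_powr_from_0]) (use p\<beta> W in auto)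
  have "ennreal (rad_mean xs norm)
     \<le> (\<integral>\<^sup>+t. ennreal (C * W powr (p * \<beta>)) * ennreal (indicator {0..W} t * t powr (- (p * \<beta>))) \<partial>lborel)"
    using rad_mean_layer_cake[of xs] by (rule order_trans) (intro nn_integral_mono pw)
  also have "\<dots> = ennreal (C * W powr (p * \<beta>)) * ennreal (W powr (- (p * \<beta>) + 1) / (- (p * \<beta>) + 1))"
    by (subst nn_integral_cmult) (simp_all only: I, simp)
  also have "\<dots> = ennreal (C / (1 - p * \<beta>) * (W powr (p * \<beta>) * W powr (- (p * \<beta>) + 1)))"
    using C p\<beta> by (simp add: ennreal_mult[symmetric] mult_ac)
  also have "W powr (p * \<beta>) * W powr (- (p * \<beta>) + 1) = W"
    using W by (simp flip: powr_add)
  finally have "rad_mean xs norm \<le> C / (1 - p * \<beta>) * W"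
    using C p\<beta> W by (subst (asm) ennreal_le_iff) auto
  then show "rad_mean xs norm \<le> (C / (1 - p * \<beta>) + 1) * weak_lp_norm p (map norm xs)"
    using W by (simp add: W_def algebra_simps)
qed

section \<open>Growth under stable type\<close>

text \<open>At least half of the elements of \<open>A\<close> are no smaller than half of its cardinality.\<close>

lemma powr_sum_ge:
  fixes A :: "nat set"
  assumes A: "finite A" and \<sigma>: "0 \<le> \<sigma>"
  shows "(real (card A) / 2) powr (1 + \<sigma>) \<le> (\<Sum>l\<in>A. real (l + 1) powr \<sigma>)"
proof (cases "A = {}")
  case False
  define k where "k = card A"
  have k: "0 < k" using False A by (simp add: k_def card_gt_0_iff)
  define B where "B = A - {..<k div 2}"
  have "card A - card {..<k div 2} \<le> card B" unfolding B_def by (rule diff_card_le_card_Diff) simp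
  then have B: "real k / 2 \<le> real (card B)" by (simp add: k_def)
  have "(real k / 2) powr (1 + \<sigma>) = real k / 2 * (real k / 2) powr \<sigma>"
    using k by (simp add: powr_add)
  also have "\<dots> \<le> real (card B) * (real k / 2) powr \<sigma>"
    using B by (intro mult_right_mono) auto
  also have "\<dots> = (\<Sum>l\<in>B. (real k / 2) powr \<sigma>)" by simp
  also have "\<dots> \<le> (\<Sum>l\<in>B. real (l + 1) powr \<sigma>)"
  proof (rule sum_mono)
    fix l assume "l \<in> B"
    then have "k div 2 \<le> l" by (simp add: B_def)
    then have "real k / 2 \<le> real (l + 1)" by linarith
    then show "(real k / 2) powr \<sigma> \<le> real (l + 1) powr \<sigma>" using \<sigma> by (intro powr_mono2) auto
  qed
  also have "\<dots> \<le> (\<Sum>l\<in>A. real (l + 1) powr \<sigma>)"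
    using A by (intro sum_mono2) (auto simp: B_def)
  finally show ?thesis by (simp add: k_def)
qed simp

text \<open>As the weights increase with the position, a set of \<open>k\<close> positions has total weight at least of order
  \<open>k powr (2 / p)\<close>. The right-hand side is additive over the positions, so that its expectation for
  random vectors needs no information on their joint distribution.\<close>

lemma weak_lp_norm_le_weighted_l2:
  fixes ys :: "'b::real_normed_vector list"
  assumes p: "1 < p" "p < 2"
  shows "(weak_lp_norm p (map norm ys))\<^sup>2
    \<le> 4 * (\<Sum>l<length ys. real (l + 1) powr (2 / p - 1) * (norm (ys ! l))\<^sup>2)"
proof -
  define Q where "Q = (\<Sum>l<length ys. real (l + 1) powr (2 / p - 1) * (norm (ys ! l))\<^sup>2)"
  have Q: "0 \<le> Q" unfolding Q_def by (intro sum_nonneg mult_nonneg_nonneg) auto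
  have "weak_lp_norm p (map norm ys) \<le> 2 powr (1 / p) * sqrt Q"
  proof (rule weak_lp_norm_le)
    fix t :: real assume t: "0 < t"
    define A where "A = {l. l < length ys \<and> t < norm (ys ! l)}"
    have A: "finite A" "A \<subseteq> {..<length ys}" by (auto simp: A_def)
    have card: "length (filter (\<lambda>x. t < norm x) ys) = card A"
      by (simp add: A_def length_filter_conv_card)
    have "t\<^sup>2 * (real (card A) / 2) powr (2 / p) \<le> t\<^sup>2 * (\<Sum>l\<in>A. real (l + 1) powr (2 / p - 1))"
      using powr_sum_ge[OF A(1), of "2 / p - 1"] p by (intro mult_left_mono) auto
    also have "\<dots> \<le> (\<Sum>l\<in>A. real (l + 1) powr (2 / p - 1) * (norm (ys ! l))\<^sup>2)"
      unfolding sum_distrib_left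
    proof (rule sum_mono)
      fix l assume "l \<in> A"
      then have "t\<^sup>2 \<le> (norm (ys ! l))\<^sup>2" using t by (intro power_mono) (auto simp: A_def)
      then show "t\<^sup>2 * real (l + 1) powr (2 / p - 1) \<le> real (l + 1) powr (2 / p - 1) * (norm (ys ! l))\<^sup>2"
        by (subst mult.commute) (intro mult_left_mono, auto)
    qed
    also have "\<dots> \<le> Q"
      unfolding Q_def using A by (intro sum_mono2) auto
    finally have "(t\<^sup>2 * (real (card A) / 2) powr (2 / p)) powr (p / 2) \<le> Q powr (p / 2)"
      using p by (intro powr_mono2) auto
    moreover have "(t\<^sup>2 * (real (card A) / 2) powr (2 / p)) powr (p / 2) = t powr p * (real (card A) / 2)"
    proof -
      have t2: "t\<^sup>2 = t powr 2" using t by simp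
      show ?thesis unfolding t2 using p by (simp add: powr_mult powr_powr)
    qed
    ultimately have "t powr p * real (card A) \<le> 2 * Q powr (p / 2)" by simp
    also have "\<dots> = (2 powr (1 / p) * sqrt Q) powr p"
      using p Q by (simp add: powr_mult powr_powr powr_half_sqrt[symmetric])
    finally show "t powr p * real (length (filter (\<lambda>x. t < norm x) ys)) \<le> (2 powr (1 / p) * sqrt Q) powr p"
      by (simp add: card)
  qed (use p Q in auto)
  then have "(weak_lp_norm p (map norm ys))\<^sup>2 \<le> (2 powr (1 / p) * sqrt Q)\<^sup>2"
    using p by (intro power_mono weak_lp_norm_nonneg) auto
  also have "\<dots> = (2 powr (1 / p))\<^sup>2 * Q" using Q by (simp add: power_mult_distrib)
  also have "\<dots> \<le> 4 * Q"
  proof (rule mult_right_mono[OF _ Q])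
    have "(2::real) powr (1 / p) \<le> 2 powr 1" using p by (intro powr_mono) auto
    then have "((2::real) powr (1 / p))\<^sup>2 \<le> 2\<^sup>2" by (intro power_mono) auto
    then show "((2::real) powr (1 / p))\<^sup>2 \<le> 4" by simp
  qed
  finally show ?thesis by (simp add: Q_def)
qed

text \<open>Groups of sizes \<open>n div (l + 1)\<close>: by stable type and comparison of moments, the second moment of the
  \<open>l\<close>-th group sum is at most \<open>2 C\<^sup>2 (n / (l + 1)) powr (2 / p)\<close>. Against the weights
  \<open>(l + 1) powr (2 / p - 1)\<close> these add up to a harmonic sum.\<close>

lemma rad_sup_harm_gain:
  assumes p: "1 < p" "p < 2" and C: "0 < C"
    and stable: "\<And>xs :: 'b::{banach,second_countable_topology} list.
      rad_mean xs norm \<le> C * weak_lp_norm p (map norm xs)"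
  shows "rad_sup TYPE('b) (\<Sum>l<L. n div (l + 1)) \<le> 3 * C\<^sup>2 * real n powr (1 / p) * sqrt (harm L)"
proof (rule rad_sup_least)
  fix xs :: "'b list" assume xs: "length xs = (\<Sum>l<L. n div (l + 1))" "\<forall>x\<in>set xs. norm x \<le> 1"
  define \<sigma> where "\<sigma> = 2 / p - 1"
  have "sum_list (map (\<lambda>l. n div (l + 1)) [0..<L]) = length xs"
    by (simp add: xs interv_sum_list_conv_sum_set_nat atLeast0LessThan)
  then obtain xss where xss: "concat xss = xs" "map length xss = map (\<lambda>l. n div (l + 1)) [0..<L]"
    using concat_split by blast
  have len: "length xss = L" using arg_cong[OF xss(2), of length] by simp
  have len': "length (xss ! l) = n div (l + 1)" if "l < L" for l
    using arg_cong[OF xss(2), of "\<lambda>ns. ns ! l"] that len by simp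
  have second: "rad_mean (xss ! l) (\<lambda>v. (norm v)\<^sup>2) \<le> 2 * (C * (real n / real (l + 1)) powr (1 / p))\<^sup>2"
    if "l < L" for l
  proof -
    let ?c = "(real n / real (l + 1)) powr (1 / p)"
    have "weak_lp_norm p (map norm (xss ! l)) \<le> ?c"
    proof (rule weak_lp_norm_le)
      fix t :: real assume t: "0 < t"
      show "t powr p * real (length (filter (\<lambda>x. t < norm x) (xss ! l))) \<le> ?c powr p"
      proof (cases "t < 1")
        case True
        have "real (length (filter (\<lambda>x. t < norm x) (xss ! l))) \<le> real (n div (l + 1))"
          using length_filter_le[of "\<lambda>x. t < norm x" "xss ! l"] len'[OF that] by simp
        also have "\<dots> \<le> real n / real (l + 1)" by (rule of_nat_div_le_of_nat)
        finally have "t powr p * real (length (filter (\<lambda>x. t < norm x) (xss ! l))) \<le> 1 * (real n / real (l + 1))"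
          using True t p by (intro mult_mono) (auto intro: powr_le1)
        also have "\<dots> = ?c powr p" using p by (simp add: powr_powr)
        finally show ?thesis .
      next
        case False
        have "set (xss ! l) \<subseteq> set xs" using that len xss(1) by fastforce
        then have "filter (\<lambda>x. t < norm x) (xss ! l) = []"
          using xs(2) False by (force simp: filter_empty_conv)
        then show ?thesis by simp
      qed
    qed (use p in auto)
    then have "rad_mean (xss ! l) norm \<le> C * ?c"
      using stable[of "xss ! l"] C by (meson mult_left_mono less_imp_le order_trans)
    then have "(rad_mean (xss ! l) norm)\<^sup>2 \<le> (C * ?c)\<^sup>2"
      by (intro power_mono rad_mean_nonneg) auto
    then show ?thesis using kahane[of "xss ! l"] by linarith
  qed
  have "(rad_mean xs norm)\<^sup>2 = (block_mean xss (\<lambda>ys. rad_mean ys norm))\<^sup>2"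
    by (simp flip: xss(1) add: rad_mean_concat)
  also have "\<dots> \<le> block_mean xss (\<lambda>ys. (rad_mean ys norm)\<^sup>2)" by (rule block_mean_power2_le)
  also have "\<dots> \<le> block_mean xss (\<lambda>ys. \<Sum>l<length xss. (C\<^sup>2 * 4 * real (l + 1) powr \<sigma>) * (norm (ys ! l))\<^sup>2)"
  proof (rule block_mean_mono)
    fix ys :: "'b list" assume ys: "length ys = length xss"
    have "(rad_mean ys norm)\<^sup>2 \<le> (C * weak_lp_norm p (map norm ys))\<^sup>2"
      using stable[of ys] by (intro power_mono rad_mean_nonneg) auto
    also have "\<dots> \<le> C\<^sup>2 * (4 * (\<Sum>l<length ys. real (l + 1) powr \<sigma> * (norm (ys ! l))\<^sup>2))"
      unfolding power_mult_distrib \<sigma>_def using weak_lp_norm_le_weighted_l2[OF p]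
      by (intro mult_left_mono) auto
    also have "\<dots> = (\<Sum>l<length xss. (C\<^sup>2 * 4 * real (l + 1) powr \<sigma>) * (norm (ys ! l))\<^sup>2)"
      by (simp add: ys sum_distrib_left mult.assoc)
    finally show "(rad_mean ys norm)\<^sup>2 \<le> (\<Sum>l<length xss. (C\<^sup>2 * 4 * real (l + 1) powr \<sigma>) * (norm (ys ! l))\<^sup>2)" .
  qed
  also have "\<dots> = (\<Sum>l<L. (C\<^sup>2 * 4 * real (l + 1) powr \<sigma>) * rad_mean (xss ! l) (\<lambda>v. (norm v)\<^sup>2))"
    using block_mean_sum[of xss "\<lambda>l. C\<^sup>2 * 4 * real (l + 1) powr \<sigma>" "\<lambda>v. (norm v)\<^sup>2"]
    by (simp only: len)
  also have "\<dots> \<le> (\<Sum>l<L. (C\<^sup>2 * 4 * real (l + 1) powr \<sigma>) * (2 * (C * (real n / real (l + 1)) powr (1 / p))\<^sup>2))"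
    using second by (intro sum_mono mult_left_mono) auto
  also have "\<dots> = (\<Sum>l<L. 8 * C\<^sup>2 * C\<^sup>2 * (real n powr (1 / p))\<^sup>2 * inverse (real (Suc l)))"
  proof (rule sum.cong[OF refl])
    fix l
    have "((real n / real (l + 1)) powr (1 / p))\<^sup>2 = (real n powr (1 / p))\<^sup>2 * real (l + 1) powr (- (2 / p))"
    proof -
      have "(real (l + 1) powr (1 / p))\<^sup>2 = real (l + 1) powr (2 / p)"
        by (simp add: power2_eq_square flip: powr_add)
      then show ?thesis by (simp only: powr_divide power_divide powr_minus_divide) simp
    qed
    moreover have "real (l + 1) powr \<sigma> * real (l + 1) powr (- (2 / p)) = inverse (real (Suc l))"
    proof -
      have "real (l + 1) powr \<sigma> * real (l + 1) powr (- (2 / p)) = real (l + 1) powr (- 1)"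
        by (simp only: powr_add[symmetric]) (simp add: \<sigma>_def)
      then show ?thesis by (simp add: powr_minus)
    qed
    ultimately show "(C\<^sup>2 * 4 * real (l + 1) powr \<sigma>) * (2 * (C * (real n / real (l + 1)) powr (1 / p))\<^sup>2)
       = 8 * C\<^sup>2 * C\<^sup>2 * (real n powr (1 / p))\<^sup>2 * inverse (real (Suc l))"
      by (simp add: power_mult_distrib mult_ac)
  qed
  also have "\<dots> = 8 * C\<^sup>2 * C\<^sup>2 * (real n powr (1 / p))\<^sup>2 * harm L"
    by (simp add: harm_altdef sum_distrib_left)
  also have "\<dots> \<le> 9 * C\<^sup>2 * C\<^sup>2 * (real n powr (1 / p))\<^sup>2 * harm L"
    by (intro mult_right_mono) (auto simp: harm_nonneg)
  also have "\<dots> = (3 * C\<^sup>2 * real n powr (1 / p) * sqrt (harm L))\<^sup>2"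
    by (simp add: power_mult_distrib harm_nonneg power2_eq_square)
  finally show "rad_mean xs norm \<le> 3 * C\<^sup>2 * real n powr (1 / p) * sqrt (harm L)"
    using C by (elim power2_le_imp_le) (simp add: harm_nonneg)
qed

text \<open>The groups contain about \<open>n H\<^sub>L\<close> vectors, so \<open>m\<close> vectors are covered with \<open>n\<close> of order \<open>m / H\<^sub>L\<close>. The
  bound becomes a constant times \<open>m powr (1 / p) H\<^sub>L powr (1 / 2 - 1 / p)\<close>, and \<open>H\<^sub>L\<close> is
  unbounded.\<close>

lemma stable_type_imp_rad_sup_small:
  assumes p: "1 < p" "p < 2" and st: "stable_type TYPE('b::{banach,second_countable_topology}) p"
    and \<theta>: "0 < \<theta>"
  shows "\<exists>c. \<forall>m. rad_sup TYPE('b) m \<le> \<theta> * real m powr (1 / p) + c"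
proof -
  obtain C where C: "0 < C" and stable: "\<And>xs :: 'b list. rad_mean xs norm \<le> C * weak_lp_norm p (map norm xs)"
    using st unfolding stable_type_iff by blast
  define a where "a = 1 / p - 1 / 2"
  have a: "0 < a" using p by (simp add: a_def field_simps)
  have "eventually (\<lambda>L. (6 * C\<^sup>2 / \<theta>) powr (1 / a) + 1 \<le> harm L) sequentially"
    using harm_at_top by (simp add: filterlim_at_top)
  then obtain L :: nat where L: "(6 * C\<^sup>2 / \<theta>) powr (1 / a) + 1 \<le> harm L"
    by (auto simp: eventually_sequentially)
  define h :: real where "h = harm L"
  have h: "1 \<le> h" using L powr_ge_zero[of "6 * C\<^sup>2 / \<theta>" "1 / a"] unfolding h_def by linarith
  have "((6 * C\<^sup>2 / \<theta>) powr (1 / a)) powr a \<le> h powr a"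
    using L a by (intro powr_mono2) (auto simp: h_def)
  then have "6 * C\<^sup>2 / \<theta> \<le> h powr a" using a C \<theta> by (simp add: powr_powr)
  then have ha: "6 * C\<^sup>2 * h powr (- a) \<le> \<theta>" using \<theta> h by (simp add: powr_minus field_simps)
  show ?thesis
  proof (intro exI[of _ "real L + h"] allI)
    fix m
    show "rad_sup TYPE('b) m \<le> \<theta> * real m powr (1 / p) + (real L + h)"
    proof (cases "real m \<le> real L + h")
      case True
      moreover have "0 \<le> \<theta> * real m powr (1 / p)" using \<theta> by simp
      ultimately show ?thesis using rad_sup_le[where 'b='b, of m] by linarith
    next
      case False
      define n where "n = nat \<lceil>(real m + real L) / h\<rceil>"
      have n: "(real m + real L) / h \<le> real n" by (simp add: n_def) linarith
      have "0 \<le> (real m + real L) / h" using h by simp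
      then have "real n \<le> (real m + real L) / h + 1" unfolding n_def by linarith
      also have "\<dots> = (real m + real L + h) / h" using h by (simp add: field_simps)
      also have "\<dots> \<le> 2 * real m / h" using False h by (intro divide_right_mono) auto
      finally have n': "real n \<le> 2 * real m / h" .
      have "real m \<le> real n * h - real L" using n h by (simp add: field_simps)
      also have "\<dots> = (\<Sum>l<L. real n / real (l + 1) - 1)"
        by (simp add: h_def harm_altdef sum_subtractf sum_distrib_left divide_inverse)
      also have "\<dots> \<le> (\<Sum>l<L. real (n div (l + 1)))"
      proof (rule sum_mono)
        fix l show "real n / real (l + 1) - 1 \<le> real (n div (l + 1))"
          using floor_divide_of_nat_eq[of n "l + 1", where 'a = real] by linarith
      qed
      finally have "m \<le> (\<Sum>l<L. n div (l + 1))" by (simp flip: of_nat_sum)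
      then have "rad_sup TYPE('b) m \<le> rad_sup TYPE('b) (\<Sum>l<L. n div (l + 1))" by (rule rad_sup_mono)
      also have "\<dots> \<le> 3 * C\<^sup>2 * real n powr (1 / p) * sqrt h"
        unfolding h_def by (rule rad_sup_harm_gain[OF p C stable])
      also have "\<dots> \<le> 3 * C\<^sup>2 * (2 * (real m powr (1 / p) * h powr (- (1 / p)))) * h powr (1 / 2)"
      proof -
        have "real n powr (1 / p) \<le> (2 * real m / h) powr (1 / p)" using n' p by (intro powr_mono2) auto
        also have "\<dots> = 2 powr (1 / p) * (real m powr (1 / p) * h powr (- (1 / p)))"
          using h by (simp add: powr_mult powr_divide powr_minus field_simps)
        also have "\<dots> \<le> 2 powr 1 * (real m powr (1 / p) * h powr (- (1 / p)))"
          using p by (intro mult_right_mono powr_mono) auto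
        finally have le: "real n powr (1 / p) \<le> 2 * (real m powr (1 / p) * h powr (- (1 / p)))" by simp
        have "sqrt h = h powr (1 / 2)" using h by (simp add: powr_half_sqrt)
        then show ?thesis by (simp only:) (intro mult_right_mono mult_left_mono le, auto)
      qed
      also have "\<dots> = 6 * C\<^sup>2 * (h powr (- (1 / p)) * h powr (1 / 2)) * real m powr (1 / p)"
        by simp
      also have "h powr (- (1 / p)) * h powr (1 / 2) = h powr (- a)"
        by (simp add: a_def flip: powr_add)
      also have "6 * C\<^sup>2 * h powr (- a) * real m powr (1 / p) \<le> \<theta> * real m powr (1 / p)"
        using ha by (intro mult_right_mono) auto
      finally show ?thesis using h by simp
    qed
  qed
qed

section \<open>Separation of points by functionals\<close>

text \<open>A form of the Hahn-Banach theorem. By Zorn's lemma there is a maximal convex cone \<open>P\<close> that contains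
  the cone generated by an open ball around \<open>v\<close> and omits \<open>0\<close>. Maximality makes \<open>P\<close> the positive cone
  of a total order, in which \<open>v\<close> is an order unit, and \<open>f x = Sup {t. x - t v \<in> P}\<close> is linear with
  \<open>f v \<noteq> 0\<close>.\<close>

lemma bounded_linear_separates_zero:
  fixes v :: "'b::real_normed_vector"
  assumes v: "v \<noteq> 0"
  obtains f :: "'b \<Rightarrow> real" where "bounded_linear f" "f v \<noteq> 0"
proof -
  define cone where "cone P \<longleftrightarrow> (\<forall>x\<in>P. \<forall>y\<in>P. x + y \<in> P) \<and> (\<forall>r>0. \<forall>x\<in>P. r *\<^sub>R x \<in> P)" for P :: "'b set"
  define P\<^sub>0 where "P\<^sub>0 = {x. \<exists>r>0. norm (x - r *\<^sub>R v) < r * norm v}"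
  define \<A> where "\<A> = {P. P\<^sub>0 \<subseteq> P \<and> 0 \<notin> P \<and> cone P}"
  have "cone P\<^sub>0"
    unfolding cone_def
  proof (intro conjI ballI allI impI)
    fix x y assume "x \<in> P\<^sub>0" "y \<in> P\<^sub>0"
    then obtain r s where rs: "0 < r" "norm (x - r *\<^sub>R v) < r * norm v"
      "0 < s" "norm (y - s *\<^sub>R v) < s * norm v" by (auto simp: P\<^sub>0_def)
    have "norm (x + y - (r + s) *\<^sub>R v) \<le> norm (x - r *\<^sub>R v) + norm (y - s *\<^sub>R v)"
      using norm_triangle_ineq[of "x - r *\<^sub>R v" "y - s *\<^sub>R v"] by (simp add: algebra_simps)
    then have "norm (x + y - (r + s) *\<^sub>R v) < (r + s) * norm v" using rs by (simp add: algebra_simps)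
    then show "x + y \<in> P\<^sub>0" using rs unfolding P\<^sub>0_def by (intro CollectI exI[of _ "r + s"]) auto
  next
    fix c :: real and x assume c: "0 < c" and "x \<in> P\<^sub>0"
    then obtain r where r: "0 < r" "norm (x - r *\<^sub>R v) < r * norm v" by (auto simp: P\<^sub>0_def)
    have "norm (c *\<^sub>R x - (c * r) *\<^sub>R v) = c * norm (x - r *\<^sub>R v)"
      using c by (metis abs_of_pos norm_scaleR scaleR_diff_right scaleR_scaleR)
    also have "\<dots> < c * r * norm v" using c r by simp
    finally show "c *\<^sub>R x \<in> P\<^sub>0" using c r unfolding P\<^sub>0_def by (intro CollectI exI[of _ "c * r"]) auto
  qed
  moreover have "0 \<notin> P\<^sub>0" by (auto simp: P\<^sub>0_def)
  ultimately have "P\<^sub>0 \<in> \<A>" by (simp add: \<A>_def)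
  have "\<exists>P\<in>\<A>. \<forall>Q\<in>\<A>. P \<subseteq> Q \<longrightarrow> Q = P"
  proof (rule subset_Zorn_nonempty)
    show "\<A> \<noteq> {}" using \<open>P\<^sub>0 \<in> \<A>\<close> by blast
    fix C assume C: "C \<noteq> {}" "subset.chain \<A> C"
    then have sub: "\<And>P. P \<in> C \<Longrightarrow> P \<in> \<A>" and total: "\<And>P Q. P \<in> C \<Longrightarrow> Q \<in> C \<Longrightarrow> P \<subseteq> Q \<or> Q \<subseteq> P"
      by (auto simp: subset_chain_def)
    have "x + y \<in> \<Union>C" if xy: "x \<in> \<Union>C" "y \<in> \<Union>C" for x y
    proof -
      obtain P Q where PQ: "P \<in> C" "x \<in> P" "Q \<in> C" "y \<in> Q" using xy by blast
      then obtain R where "R \<in> C" "x \<in> R" "y \<in> R" using total[of P Q] by blast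
      then show ?thesis using sub[of R] by (auto simp: \<A>_def cone_def)
    qed
    moreover have "r *\<^sub>R x \<in> \<Union>C" if "0 < r" "x \<in> \<Union>C" for r x
      using that sub by (fastforce simp: \<A>_def cone_def)
    moreover have "P\<^sub>0 \<subseteq> \<Union>C" "0 \<notin> \<Union>C" using C(1) sub by (auto simp: \<A>_def)
    ultimately show "\<Union>C \<in> \<A>" by (simp add: \<A>_def cone_def)
  qed
  then obtain P where PA: "P \<in> \<A>" and max: "\<And>Q. Q \<in> \<A> \<Longrightarrow> P \<subseteq> Q \<Longrightarrow> Q = P" by blast
  have P0: "P\<^sub>0 \<subseteq> P" and P: "0 \<notin> P" "\<And>x y. x \<in> P \<Longrightarrow> y \<in> P \<Longrightarrow> x + y \<in> P"
    "\<And>r x. 0 < r \<Longrightarrow> x \<in> P \<Longrightarrow> r *\<^sub>R x \<in> P"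
    using PA by (auto simp: \<A>_def cone_def)
  have total: "x \<in> P \<or> - x \<in> P" if "x \<noteq> 0" for x
  proof (rule disjCI)
    assume nx: "- x \<notin> P"
    \<comment> \<open>the cone generated by \<open>P\<close> and \<open>x\<close>; it omits \<open>0\<close> because \<open>- x \<notin> P\<close>\<close>
    define Q where "Q = {y. \<exists>t\<ge>0. y - t *\<^sub>R x \<in> P} \<union> {t *\<^sub>R x |t. 0 < t}"
    have "P \<subseteq> Q" by (auto simp: Q_def intro: exI[of _ 0])
    have "y + z \<in> Q" if yz: "y \<in> Q" "z \<in> Q" for y z
    proof -
      have A: "y + z \<in> Q" if "t \<ge> 0" "y - t *\<^sub>R x \<in> P" "s \<ge> 0" "z - s *\<^sub>R x \<in> P \<or> z = s *\<^sub>R x" for t s y z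
      proof -
        have eq: "(y + z) - (t + s) *\<^sub>R x = (y - t *\<^sub>R x) + (z - s *\<^sub>R x)" by (simp add: algebra_simps)
        have "(y + z) - (t + s) *\<^sub>R x \<in> P" unfolding eq using that P(2) by auto
        then show ?thesis using that unfolding Q_def by (intro UnI1 CollectI exI[of _ "t + s"]) auto
      qed
      consider t where "t \<ge> 0" "y - t *\<^sub>R x \<in> P" | t s where "0 < t" "y = t *\<^sub>R x" "s \<ge> 0" "z - s *\<^sub>R x \<in> P"
        | t s where "0 < t" "y = t *\<^sub>R x" "0 < s" "z = s *\<^sub>R x" using yz by (auto simp: Q_def)
      then show ?thesis
      proof cases
        case 1
        with A[of _ y _ z] yz(2) show ?thesis unfolding Q_def by (smt (verit) Un_iff mem_Collect_eq)
      next
        case 2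
        with A[of s z t y] show ?thesis by (simp add: add.commute)
      next
        case 3
        then show ?thesis unfolding Q_def by (intro UnI2 CollectI exI[of _ "t + s"]) (auto simp: algebra_simps)
      qed
    qed
    moreover have "r *\<^sub>R y \<in> Q" if r: "0 < r" and y: "y \<in> Q" for r y
    proof -
      consider t where "t \<ge> 0" "y - t *\<^sub>R x \<in> P" | t where "0 < t" "y = t *\<^sub>R x" using y by (auto simp: Q_def)
      then show ?thesis
      proof cases
        case 1
        then have "r *\<^sub>R y - (r * t) *\<^sub>R x \<in> P" using P(3)[OF r 1(2)] by (simp add: scaleR_diff_right)
        then show ?thesis using 1 r unfolding Q_def by (intro UnI1 CollectI exI[of _ "r * t"]) auto
      next
        case 2
        then show ?thesis using r unfolding Q_def by (intro UnI2 CollectI exI[of _ "r * t"]) auto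
      qed
    qed
    moreover have "0 \<notin> Q"
    proof
      assume "0 \<in> Q"
      then consider t where "t \<ge> 0" "- (t *\<^sub>R x) \<in> P" | t where "0 < t" "t *\<^sub>R x = 0" by (auto simp: Q_def)
      then show False
      proof cases
        case 1
        then have "0 < t" using P(1) by (cases "t = 0") auto
        then have "(1 / t) *\<^sub>R (- (t *\<^sub>R x)) \<in> P" using 1 by (intro P(3)) auto
        then show False using nx \<open>0 < t\<close> by simp
      qed (use \<open>x \<noteq> 0\<close> in auto)
    qed
    ultimately have "Q \<in> \<A>" using P0 \<open>P \<subseteq> Q\<close> by (auto simp: \<A>_def cone_def)
    then have "Q = P" using max \<open>P \<subseteq> Q\<close> by blast
    moreover have "1 *\<^sub>R x \<in> Q" unfolding Q_def by (intro UnI2 CollectI exI[of _ 1]) auto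
    ultimately show "x \<in> P" by simp
  qed
  have vP: "t *\<^sub>R v \<in> P" if "0 < t" for t
  proof -
    have "v \<in> P\<^sub>0" unfolding P\<^sub>0_def using v by (intro CollectI exI[of _ 1]) auto
    then show ?thesis using P0 P(3) that by blast
  qed
  have dom: "s *\<^sub>R v + x \<in> P" if "norm x < s * norm v" for s x
  proof -
    have "0 < s * norm v" using that norm_ge_zero[of x] by linarith
    then have "0 < s" using v by (simp add: zero_less_mult_iff)
    then have "s *\<^sub>R v + x \<in> P\<^sub>0" unfolding P\<^sub>0_def using that by (intro CollectI exI[of _ s]) auto
    then show ?thesis using P0 by blast
  qed
  define f where "f x = Sup {t. x - t *\<^sub>R v \<in> P}" for x
  have ub: "t \<le> norm x / norm v" if "x - t *\<^sub>R v \<in> P" for t x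
  proof (rule ccontr)
    assume "\<not> ?thesis"
    then have "norm (- x) < t * norm v" using v by (simp add: field_simps)
    from dom[OF this] that P(2)[of "x - t *\<^sub>R v" "t *\<^sub>R v + - x"] P(1) show False by simp
  qed
  have ne: "{t. x - t *\<^sub>R v \<in> P} \<noteq> {}" for x
  proof -
    define c where "c = norm x / norm v + 1"
    have "norm x < c * norm v" using v by (simp add: c_def field_simps)
    from dom[OF this] have "x - (- c) *\<^sub>R v \<in> P" by (simp add: add.commute)
    then show ?thesis by blast
  qed
  have bdd: "bdd_above {t. x - t *\<^sub>R v \<in> P}" for x
    using ub by (intro bdd_aboveI[of _ "norm x / norm v"]) auto
  have le_f: "t \<le> f x" if "x - t *\<^sub>R v \<in> P" for x t
    unfolding f_def using that bdd by (intro cSup_upper) auto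
  have less_f: "x - t *\<^sub>R v \<in> P" if "t < f x" for x t
  proof -
    obtain s where s: "x - s *\<^sub>R v \<in> P" "t < s"
      using \<open>t < f x\<close> ne bdd unfolding f_def by (auto simp: less_cSup_iff)
    have "(x - s *\<^sub>R v) + (s - t) *\<^sub>R v \<in> P" using s by (intro P(2) vP) auto
    then show ?thesis by (simp add: algebra_simps)
  qed
  have super: "f x + f y \<le> f (x + y)" for x y
  proof (rule ccontr)
    assume neg: "\<not> ?thesis"
    define e where "e = (f x + f y - f (x + y)) / 3"
    have e: "0 < e" using neg by (simp add: e_def)
    define a b where "a = f x - e" and "b = f y - e"
    have "(x - a *\<^sub>R v) + (y - b *\<^sub>R v) \<in> P"
      using e by (intro P(2) less_f) (auto simp: a_def b_def)
    then have "(x + y) - (a + b) *\<^sub>R v \<in> P" by (simp add: algebra_simps)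
    then have "a + b \<le> f (x + y)" by (rule le_f)
    then show False using e by (simp add: a_def b_def e_def field_simps)
  qed
  have f0: "f 0 \<le> 0"
  proof (rule ccontr)
    assume "\<not> ?thesis"
    then have "0 - 0 *\<^sub>R v \<in> P" by (intro less_f) simp
    then show False using P(1) by simp
  qed
  have odd: "f (- x) = - f x" for x
  proof (rule antisym)
    show "f (- x) \<le> - f x" using super[of x "- x"] f0 by simp
    show "- f x \<le> f (- x)"
    proof (rule dense_le)
      fix t assume t: "t < - f x"
      have nP: "x + s *\<^sub>R v \<notin> P" if "s < - f x" for s
        using le_f[of x "- s"] that by auto
      have "x + t *\<^sub>R v \<noteq> 0"
      proof
        assume z: "x + t *\<^sub>R v = 0"
        obtain s where s: "t < s" "s < - f x" using t dense by blast
        have "x + s *\<^sub>R v = (x + t *\<^sub>R v) + (s - t) *\<^sub>R v" by (simp add: algebra_simps)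
        then have "x + s *\<^sub>R v \<in> P" using z vP[of "s - t"] s by simp
        then show False using nP s by blast
      qed
      then have "- (x + t *\<^sub>R v) \<in> P" using total[of "x + t *\<^sub>R v"] nP[OF t] by blast
      then show "t \<le> f (- x)" by (intro le_f) (simp add: algebra_simps)
    qed
  qed
  have add: "f (x + y) = f x + f y" for x y
    using super[of x y] super[of "- x" "- y"] odd[of x] odd[of y] odd[of "x + y"] by simp
  have scale_ge: "r * f x \<le> f (r *\<^sub>R x)" if r: "0 < r" for r x
  proof (rule dense_le)
    fix t assume "t < r * f x"
    then have "t / r < f x" using r by (simp add: field_simps)
    then have "r *\<^sub>R (x - (t / r) *\<^sub>R v) \<in> P" using r by (intro P(3) less_f)
    then show "t \<le> f (r *\<^sub>R x)" using r by (intro le_f) (simp add: scaleR_diff_right)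
  qed
  have scale_pos: "f (r *\<^sub>R x) = r * f x" if r: "0 < r" for r x
    using scale_ge[OF r, of x] scale_ge[OF r, of "- x"] odd[of x] odd[of "r *\<^sub>R x"] by simp
  have f00: "f 0 = 0" using odd[of 0] by simp
  have scale: "f (r *\<^sub>R x) = r * f x" for r x
  proof (cases r "0 :: real" rule: linorder_cases)
    case less
    then show ?thesis using scale_pos[of "- r" x] odd[of "r *\<^sub>R x"] by simp
  qed (simp_all add: f00 scale_pos)
  have le: "f x \<le> norm x / norm v" for x
    unfolding f_def using ne ub by (intro cSup_least) auto
  have "bounded_linear f"
  proof (rule bounded_linear_intro)
    fix x show "norm (f x) \<le> norm x * (1 / norm v)"
      using le[of x] le[of "- x"] odd[of x] by (simp add: abs_le_iff)
  qed (simp_all add: add scale)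
  moreover have "f v \<noteq> 0"
  proof -
    have "1 / 2 \<le> f v" using vP[of "1 / 2"] by (intro le_f) (simp add: scaleR_left_diff_distrib[symmetric, of 1, simplified])
    then show ?thesis by simp
  qed
  ultimately show ?thesis using that by blast
qed

lemma eq_zero_if_functionals_vanish:
  fixes v :: "'b::real_normed_vector"
  assumes "\<And>f :: 'b \<Rightarrow> real. bounded_linear f \<Longrightarrow> f v = 0"
  shows "v = 0"
  using assms bounded_linear_separates_zero by blast

section \<open>Conditional expectation of Banach-valued variables\<close>

text \<open>The complement of the origin is covered by the balls \<open>ball d (\<parallel>d\<parallel> / 2)\<close> with \<open>d\<close> from a countable
  dense set. On the event that \<open>h\<close> lies in such a ball, the integral of \<open>h\<close> differs from the
  measure times \<open>d\<close> by at most half of the norm of the latter; as the integral is zero, the event is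
  null.\<close>

lemma AE_eq_zero_if_set_integrals_vanish:
  fixes h :: "'w \<Rightarrow> 'b::{banach,second_countable_topology}"
  assumes "finite_measure M" and sub: "subalgebra M F"
    and h: "h \<in> borel_measurable F" "integrable M h"
    and zero: "\<And>A. A \<in> sets F \<Longrightarrow> set_lebesgue_integral M A h = 0"
  shows "AE w in M. h w = 0"
proof -
  interpret finite_measure M by fact
  obtain D :: "'b set" where D: "countable D" "\<And>X. open X \<Longrightarrow> X \<noteq> {} \<Longrightarrow> \<exists>d\<in>D. d \<in> X"
    by (rule countable_dense_setE) blast
  have "AE w in M. \<not> dist (h w) d < norm d / 2" for d
  proof (cases "d = 0")
    case False
    define A where "A = {w \<in> space F. dist (h w) d < norm d / 2}"
    have AF: "A \<in> sets F" unfolding A_def using h(1) by measurable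
    then have AM: "A \<in> sets M" using sub by (auto simp: subalgebra_def)
    have i1: "integrable M (\<lambda>w. indicator A w *\<^sub>R h w)"
      using AM h(2) by (rule integrable_mult_indicator)
    have i2: "integrable M (\<lambda>w. indicator A w *\<^sub>R d)"
      using AM by (intro integrable_mult_indicator) auto
    have "measure M A * norm d = norm ((\<integral>w. indicator A w *\<^sub>R h w \<partial>M) - (\<integral>w. indicator A w *\<^sub>R d \<partial>M))"
    proof -
      have "(\<integral>w. indicator A w *\<^sub>R d \<partial>M) = measure M A *\<^sub>R d"
        using AM by (subst integral_scaleR_left) (auto simp: emeasure_eq_measure)
      then show ?thesis using zero[OF AF] by (simp add: set_lebesgue_integral_def)
    qed
    also have "\<dots> = norm (\<integral>w. indicator A w *\<^sub>R (h w - d) \<partial>M)"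
      using i1 i2 by (subst Bochner_Integration.integral_diff[symmetric]) (simp_all add: scaleR_diff_right)
    also have "\<dots> \<le> (\<integral>w. norm (indicator A w *\<^sub>R (h w - d)) \<partial>M)" by (rule integral_norm_bound)
    also have "\<dots> \<le> (\<integral>w. indicator A w * (norm d / 2) \<partial>M)"
    proof (rule integral_mono)
      show "integrable M (\<lambda>w. norm (indicator A w *\<^sub>R (h w - d)))"
        using Bochner_Integration.integrable_diff[OF i1 i2] by (intro integrable_norm) (simp add: scaleR_diff_right)
      show "integrable M (\<lambda>w. indicator A w * (norm d / 2))"
        using AM by (intro integrable_mult_left integrable_real_indicator) (auto simp: emeasure_eq_measure)
      fix w show "norm (indicator A w *\<^sub>R (h w - d)) \<le> indicator A w * (norm d / 2)"
        by (auto simp: A_def dist_norm split: split_indicator)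
    qed
    also have "\<dots> = measure M A * (norm d / 2)" using AM by simp
    finally have "measure M A = 0" using False measure_nonneg[of M A] by (simp add: field_simps)
    then have "emeasure M A = 0" by (simp add: emeasure_eq_measure)
    then show ?thesis
      using AM sub by (intro AE_I[of M _ A]) (auto simp: A_def subalgebra_def)
  qed simp
  then have "AE w in M. \<forall>d\<in>D. \<not> dist (h w) d < norm d / 2"
    using D(1) by (simp add: AE_ball_countable)
  then show ?thesis
  proof eventually_elim
    fix w assume w: "\<forall>d\<in>D. \<not> dist (h w) d < norm d / 2"
    show "h w = 0"
    proof (rule ccontr)
      assume "h w \<noteq> 0"
      then obtain d where d: "d \<in> D" "d \<in> ball (h w) (norm (h w) / 3)"
        using D(2)[of "ball (h w) (norm (h w) / 3)"] by auto
      have "norm (h w) \<le> norm d + dist (h w) d" using norm_triangle_ineq[of d "h w - d"] by (simp add: dist_norm)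
      then have "dist (h w) d < norm d / 2" using d(2) by simp
      then show False using w d(1) by blast
    qed
  qed
qed

lemma cond_expectation_AE_eq:
  assumes "finite_measure M" and sub: "subalgebra M F" and g: "is_cond_exp M F f g"
  shows "AE w in M. cond_expectation M F f w = g w"
proof -
  interpret finite_measure M by fact
  let ?h = "cond_expectation M F f"
  have h: "is_cond_exp M F f ?h" unfolding cond_expectation_def by (rule someI[of "is_cond_exp M F f", OF g])
  have "AE w in M. ?h w - g w = 0"
  proof (rule AE_eq_zero_if_set_integrals_vanish[OF assms(1) sub])
    show "(\<lambda>w. ?h w - g w) \<in> borel_measurable F" "integrable M (\<lambda>w. ?h w - g w)"
      using g h by (auto simp: is_cond_exp_def)
    fix A assume A: "A \<in> sets F"
    then have AM: "A \<in> sets M" using sub by (auto simp: subalgebra_def)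
    have "set_lebesgue_integral M A (\<lambda>w. ?h w - g w) = set_lebesgue_integral M A ?h - set_lebesgue_integral M A g"
      using g h AM by (intro set_integral_diff) (auto simp: is_cond_exp_def set_integrable_def intro: integrable_mult_indicator)
    then show "set_lebesgue_integral M A (\<lambda>w. ?h w - g w) = 0"
      using g h A by (simp add: is_cond_exp_def)
  qed
  then show ?thesis by simp
qed

lemma integrable_if_strongly_centered: "strongly_centered M X \<Longrightarrow> integrable M X"
  by (auto simp: strongly_centered_def intro: integrable_norm_cancel)

text \<open>Centering is defined through functionals; since these separate points, the Bochner integral itself
  vanishes.\<close>

lemma integral_strongly_centered:
  fixes X :: "'w \<Rightarrow> 'b::{banach,second_countable_topology}"
  assumes "strongly_centered M X"
  shows "(\<integral>w. X w \<partial>M) = 0"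
proof (rule eq_zero_if_functionals_vanish)
  fix f :: "'b \<Rightarrow> real" assume f: "bounded_linear f"
  have "f (\<integral>w. X w \<partial>M) = (\<integral>w. f (X w) \<partial>M)"
    by (rule integral_bounded_linear[OF f integrable_if_strongly_centered[OF assms], symmetric])
  then show "f (\<integral>w. X w \<partial>M) = 0" using assms f by (simp add: strongly_centered_def)
qed

lemma space_generated_filtration [simp]: "space (generated_filtration M X n) = space M"
  unfolding generated_filtration_def by (rule space_measure_of) auto

lemma sets_generated_filtration:
  "sets (generated_filtration M X n) =
     sigma_sets (space M) {X k -` A \<inter> space M |k A. k \<in> {1..n} \<and> A \<in> sets borel}"
  unfolding generated_filtration_def by (rule sets_measure_of) auto

lemma subalgebra_generated_filtration:
  assumes "\<And>k. k \<in> {1..n} \<Longrightarrow> X k \<in> borel_measurable M"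
  shows "subalgebra M (generated_filtration M X n)"
  unfolding subalgebra_def sets_generated_filtration
  using assms by (auto intro!: sets.sigma_sets_subset measurable_sets)

lemma measurable_generated_filtration:
  assumes "k \<in> {1..n}"
  shows "X k \<in> borel_measurable (generated_filtration M X n)"
proof (rule measurableI)
  fix A :: "'b set" assume "A \<in> sets borel"
  then show "X k -` A \<inter> space (generated_filtration M X n) \<in> sets (generated_filtration M X n)"
    using assms unfolding sets_generated_filtration by (auto intro!: sigma_sets.Basic)
qed simp

text \<open>Events of the past are preimages under the vector of the first \<open>n\<close> variables, which is independent of
  \<open>X (Suc n)\<close>.\<close>

lemma (in prob_space) set_integral_future_zero:
  fixes X :: "nat \<Rightarrow> 'a \<Rightarrow> 'b::{banach,second_countable_topology}"
  assumes ind: "indep_vars (\<lambda>_. borel) X {1..}" and cent: "strongly_centered M (X (Suc n))"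
    and A: "A \<in> sets (generated_filtration M X n)"
  shows "set_lebesgue_integral M A (X (Suc n)) = 0"
proof -
  have rv: "X k \<in> borel_measurable M" if "k \<ge> 1" for k
    using ind that by (auto simp: indep_vars_def)
  let ?\<phi> = "\<lambda>w. restrict (\<lambda>i. X i w) {1..n}" and ?\<psi> = "\<lambda>w. restrict (\<lambda>i. X i w) {Suc n}"
  let ?N = "PiM {1..n} (\<lambda>_. borel) :: (nat \<Rightarrow> 'b) measure"
  have \<phi>: "?\<phi> \<in> measurable M ?N" using rv by (intro measurable_restrict) auto
  have "sets (generated_filtration M X n) \<subseteq> sets (vimage_algebra (space M) ?\<phi> ?N)"
    unfolding sets_generated_filtration
  proof (rule sets.sigma_sets_subset')
    show "space M \<in> sets (vimage_algebra (space M) ?\<phi> ?N)"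
      using sets.top[of "vimage_algebra (space M) ?\<phi> ?N"] by simp
    show "{X k -` A \<inter> space M |k A. k \<in> {1..n} \<and> A \<in> sets borel}
      \<subseteq> sets (vimage_algebra (space M) ?\<phi> ?N)"
    proof safe
      fix k and B :: "'b set" assume k: "k \<in> {1..n}" and B: "B \<in> sets borel"
      have "(\<lambda>y. y k) -` B \<inter> space ?N \<in> sets ?N"
        using k B by (intro measurable_sets[of _ ?N borel]) auto
      then have "?\<phi> -` ((\<lambda>y. y k) -` B \<inter> space ?N) \<inter> space M \<in> sets (vimage_algebra (space M) ?\<phi> ?N)"
        by (rule in_vimage_algebra)
      also have "?\<phi> -` ((\<lambda>y. y k) -` B \<inter> space ?N) \<inter> space M = X k -` B \<inter> space M"
        using k by (auto simp: space_PiM)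
      finally show "X k -` B \<inter> space M \<in> sets (vimage_algebra (space M) ?\<phi> ?N)" .
    qed
  qed
  from subsetD[OF this A] have "A \<in> sets (vimage_algebra (space M) ?\<phi> ?N)" .
  also have "sets (vimage_algebra (space M) ?\<phi> ?N) = {?\<phi> -` B \<inter> space M |B. B \<in> sets ?N}"
    by (rule sets_vimage_algebra2) (rule Pi_I, erule measurable_space[OF \<phi>])
  finally obtain B where B: "B \<in> sets ?N" "A = ?\<phi> -` B \<inter> space M"
    unfolding mem_Collect_eq by (elim exE conjE)
  have AM: "A \<in> sets M" unfolding B(2) by (rule measurable_sets[OF \<phi> B(1)])
  have int: "integrable M (X (Suc n))" by (rule integrable_if_strongly_centered[OF cent])
  have "indep_var ?N ?\<phi> (PiM {Suc n} (\<lambda>_. borel)) ?\<psi>"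
    by (rule indep_var_restrict[OF ind]) auto
  show ?thesis
  proof (rule eq_zero_if_functionals_vanish)
    fix f :: "'b \<Rightarrow> real" assume f: "bounded_linear f"
    have [measurable]: "f \<in> borel_measurable borel"
      using f by (intro borel_measurable_continuous_onI linear_continuous_on) auto
    have "(\<lambda>y. f (y (Suc n))) \<in> borel_measurable (PiM {Suc n} (\<lambda>_. borel))" by measurable
    then have "indep_var borel (indicator B \<circ> ?\<phi>) borel ((\<lambda>y. f (y (Suc n))) \<circ> ?\<psi>)"
      using B(1) by (intro indep_var_compose[OF \<open>indep_var _ _ _ _\<close>]) auto
    then have ind': "indep_var borel (\<lambda>w. indicator B (?\<phi> w) :: real) borel (\<lambda>w. f (X (Suc n) w))"
      by (simp add: comp_def)
    have "f (set_lebesgue_integral M A (X (Suc n))) = (\<integral>w. f (indicator A w *\<^sub>R X (Suc n) w) \<partial>M)"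
      unfolding set_lebesgue_integral_def
      by (rule integral_bounded_linear[OF f, symmetric]) (rule integrable_mult_indicator[OF AM int])
    also have "\<dots> = (\<integral>w. indicator B (?\<phi> w) * f (X (Suc n) w) \<partial>M)"
      using f by (intro Bochner_Integration.integral_cong)
        (auto simp: B(2) linear_simps split: split_indicator)
    also have "\<dots> = (\<integral>w. indicator B (?\<phi> w) \<partial>M) * (\<integral>w. f (X (Suc n) w) \<partial>M)"
    proof (rule indep_var_lebesgue_integral[OF ind'])
      have "(\<lambda>w. indicator B (?\<phi> w) :: real) \<in> borel_measurable M"
        by (rule measurable_compose[OF \<phi>]) (use B(1) in simp)
      then show "integrable M (\<lambda>w. indicator B (?\<phi> w) :: real)"
        by (intro integrable_const_bound[of _ 1]) auto
      show "integrable M (\<lambda>w. f (X (Suc n) w))" by (rule integrable_bounded_linear[OF f int])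
    qed
    also have "(\<integral>w. f (X (Suc n) w) \<partial>M) = 0" using cent f by (simp add: strongly_centered_def)
    finally show "f (set_lebesgue_integral M A (X (Suc n))) = 0" by simp
  qed
qed

section \<open>Increments of the normalised sums\<close>

text \<open>The weight \<open>w\<^sub>n\<close> of \<open>E \<parallel>S\<^sub>n\<parallel>\<close> in the quasimartingale series.\<close>

definition norm_weight :: "real \<Rightarrow> nat \<Rightarrow> real" where
  "norm_weight \<alpha> n = 1 / real n powr \<alpha> - 1 / real (n + 1) powr \<alpha>"

lemma norm_weight_nonneg: "0 < \<alpha> \<Longrightarrow> 1 \<le> n \<Longrightarrow> 0 \<le> norm_weight \<alpha> n"
  unfolding norm_weight_def by (simp add: frac_le powr_mono2)

text \<open>The increment is \<open>(a - b) S\<^sub>n + a X\<^sub>n\<^sub>+\<^sub>1\<close> with \<open>a = (n + 1) powr (- \<alpha>)\<close> and \<open>b = n powr (- \<alpha>)\<close>; the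
  last term integrates to zero over every event of the past, so that \<open>(a - b) S\<^sub>n\<close> is a version of
  the conditional expectation.\<close>

lemma (in prob_space) nn_integral_norm_cond_expectation:
  fixes X :: "nat \<Rightarrow> 'a \<Rightarrow> 'b::{banach,second_countable_topology}"
  assumes ind: "indep_vars (\<lambda>_. borel) X {1..}" and cent: "\<And>n. n \<ge> 1 \<Longrightarrow> strongly_centered M (X n)"
    and \<alpha>: "0 < \<alpha>" and n: "1 \<le> n"
  shows "(\<integral>\<^sup>+w. ennreal (norm (cond_expectation M (generated_filtration M X n)
        (\<lambda>v. partial_sum X (n + 1) v /\<^sub>R (real (n + 1) powr \<alpha>) - partial_sum X n v /\<^sub>R (real n powr \<alpha>)) w)) \<partial>M)
     = ennreal (norm_weight \<alpha> n) * (\<integral>\<^sup>+w. ennreal (norm (partial_sum X n w)) \<partial>M)"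
proof -
  let ?F = "generated_filtration M X n"
  define a b where "a = inverse (real (n + 1) powr \<alpha>)" and "b = inverse (real n powr \<alpha>)"
  define f where "f v = partial_sum X (n + 1) v /\<^sub>R (real (n + 1) powr \<alpha>) - partial_sum X n v /\<^sub>R (real n powr \<alpha>)" for v
  define g where "g v = (a - b) *\<^sub>R partial_sum X n v" for v
  have rv: "X k \<in> borel_measurable M" if "k \<ge> 1" for k
    using cent[OF that] by (simp add: strongly_centered_def)
  have int: "integrable M (X k)" if "k \<ge> 1" for k
    using integrable_if_strongly_centered[OF cent[OF that]] .
  have sub: "subalgebra M ?F" using rv by (intro subalgebra_generated_filtration) auto
  have fg: "f v = g v + a *\<^sub>R X (n + 1) v" for v
    by (simp add: f_def g_def a_def b_def partial_sum_def algebra_simps)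
  have intS: "integrable M (partial_sum X n)"
    unfolding partial_sum_def[abs_def] using int by (intro Bochner_Integration.integrable_sum) auto
  have intg: "integrable M g" unfolding g_def[abs_def] using intS by (intro integrable_scaleR_right) auto
  have intX: "integrable M (\<lambda>v. a *\<^sub>R X (n + 1) v)" using int by (intro integrable_scaleR_right) auto
  have intf: "integrable M f" unfolding fg[abs_def] using intg intX by (rule Bochner_Integration.integrable_add)
  have "is_cond_exp M ?F f g"
    unfolding is_cond_exp_def
  proof (intro conjI ballI)
    show "g \<in> borel_measurable ?F"
      unfolding g_def[abs_def] partial_sum_def
      by (intro borel_measurable_scaleR borel_measurable_const borel_measurable_sum measurable_generated_filtration)
    fix A assume A: "A \<in> sets ?F"
    then have AM: "A \<in> sets M" using sub by (auto simp: subalgebra_def)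
    have "set_lebesgue_integral M A f = set_lebesgue_integral M A g + set_lebesgue_integral M A (\<lambda>v. a *\<^sub>R X (n + 1) v)"
      unfolding fg[abs_def] using intg intX AM
      by (intro set_integral_add; unfold set_integrable_def; intro integrable_mult_indicator)
    also have "set_lebesgue_integral M A (\<lambda>v. a *\<^sub>R X (n + 1) v) = a *\<^sub>R set_lebesgue_integral M A (X (Suc n))"
      by simp
    also have "\<dots> = 0" using set_integral_future_zero[OF ind cent A] by simp
    finally show "set_lebesgue_integral M A g = set_lebesgue_integral M A f" by simp
  qed (use intf intg in auto)
  then have "AE w in M. cond_expectation M ?F f w = g w"
    by (rule cond_expectation_AE_eq[OF finite_measure_axioms sub])
  then have "(\<integral>\<^sup>+w. ennreal (norm (cond_expectation M ?F f w)) \<partial>M) = (\<integral>\<^sup>+w. ennreal (norm (g w)) \<partial>M)"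
    by (intro nn_integral_cong_AE) auto
  also have "\<dots> = (\<integral>\<^sup>+w. ennreal (norm_weight \<alpha> n) * ennreal (norm (partial_sum X n w)) \<partial>M)"
  proof (rule nn_integral_cong)
    fix w
    have "norm_weight \<alpha> n = \<bar>a - b\<bar>"
      using norm_weight_nonneg[OF \<alpha> n] by (simp add: norm_weight_def a_def b_def inverse_eq_divide)
    then show "ennreal (norm (g w)) = ennreal (norm_weight \<alpha> n) * ennreal (norm (partial_sum X n w))"
      by (simp add: g_def ennreal_mult)
  qed
  also have "\<dots> = ennreal (norm_weight \<alpha> n) * (\<integral>\<^sup>+w. ennreal (norm (partial_sum X n w)) \<partial>M)"
    using intS by (intro nn_integral_cmult) auto
  finally show ?thesis by (simp only: f_def[abs_def])
qed

lemma (in prob_space) quasimartingale_iff: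
  fixes X :: "nat \<Rightarrow> 'a \<Rightarrow> 'b::{banach,second_countable_topology}"
  assumes "indep_vars (\<lambda>_. borel) X {1..}" "\<And>n. n \<ge> 1 \<Longrightarrow> strongly_centered M (X n)" "0 < \<alpha>"
  shows "quasimartingale M (generated_filtration M X) (\<lambda>n w. partial_sum X n w /\<^sub>R (real n powr \<alpha>))
    \<longleftrightarrow> (\<Sum>m. ennreal (norm_weight \<alpha> (Suc m)) * (\<integral>\<^sup>+w. ennreal (norm (partial_sum X (Suc m) w)) \<partial>M)) < \<infinity>"
proof -
  note * = nn_integral_norm_cond_expectation[OF assms, of "Suc m" for m, simplified]
  show ?thesis unfolding quasimartingale_def by (simp add: *)
qed

section \<open>Symmetrization\<close>

text \<open>Jensen's inequality in the variable \<open>V\<close> for each fixed value of \<open>U\<close>.\<close>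

lemma (in prob_space) integral_norm_le_add_indep:
  fixes U V :: "'a \<Rightarrow> 'b::{banach,second_countable_topology}"
  assumes ind: "indep_var borel U borel V" and int: "integrable M U" "integrable M V"
    and V0: "(\<integral>w. V w \<partial>M) = 0"
  shows "(\<integral>w. norm (U w) \<partial>M) \<le> (\<integral>w. norm (U w + V w) \<partial>M)"
proof -
  have [measurable]: "U \<in> borel_measurable M" "V \<in> borel_measurable M" using int by auto
  let ?PU = "distr M borel U" and ?PV = "distr M borel V"
  interpret PU: prob_space ?PU by (rule prob_space_distr) simp
  interpret PV: prob_space ?PV by (rule prob_space_distr) simp
  interpret P: pair_prob_space ?PU ?PV ..
  have eq: "?PU \<Otimes>\<^sub>M ?PV = distr M (borel \<Otimes>\<^sub>M borel) (\<lambda>w. (U w, V w))"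
    using ind unfolding indep_var_distribution_eq by simp
  have "integrable M (\<lambda>w. norm (U w + V w))" using int by auto
  then have i: "integrable (?PU \<Otimes>\<^sub>M ?PV) (\<lambda>(u, v). norm (u + v))"
    unfolding eq by (subst integrable_distr_eq) (auto simp: split_beta')
  have iv: "integrable ?PV (\<lambda>v. v)" using int by (subst integrable_distr_eq) auto
  have v0: "(\<integral>v. v \<partial>?PV) = 0" using V0 by (subst integral_distr) auto
  have "(\<integral>w. norm (U w) \<partial>M) = (\<integral>u. norm u \<partial>?PU)" by (subst integral_distr) auto
  also have "\<dots> \<le> (\<integral>u. (\<integral>v. norm (u + v) \<partial>?PV) \<partial>?PU)"
  proof (rule integral_mono)
    show "integrable ?PU norm" using int by (subst integrable_distr_eq) auto
    show "integrable ?PU (\<lambda>u. \<integral>v. norm (u + v) \<partial>?PV)"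
      using P.integrable_fst'[OF i] by simp
    fix u :: 'b
    have "u = (\<integral>v. u + v \<partial>?PV)"
      using iv v0 by (subst Bochner_Integration.integral_add) (auto simp: PV.prob_space[simplified])
    then show "norm u \<le> (\<integral>v. norm (u + v) \<partial>?PV)"
      using integral_norm_bound[of ?PV "\<lambda>v. u + v"] by simp
  qed
  also have "\<dots> = (\<integral>x. (case x of (u, v) \<Rightarrow> norm (u + v)) \<partial>(?PU \<Otimes>\<^sub>M ?PV))"
    using P.integral_fst'[OF i] by simp
  also have "\<dots> = (\<integral>w. norm (U w + V w) \<partial>M)"
    unfolding eq by (subst integral_distr) (auto simp: split_beta')
  finally show ?thesis .
qed

text \<open>The sums over the positive and over the negative signs are independent and centered, so each has a
  smaller mean norm than their difference, which is the signed sum.\<close>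

lemma (in prob_space) integral_norm_sum_le_signs:
  fixes X :: "nat \<Rightarrow> 'a \<Rightarrow> 'b::{banach,second_countable_topology}"
  assumes ind: "indep_vars (\<lambda>_. borel) X {1..}" and cent: "\<And>n. n \<ge> 1 \<Longrightarrow> strongly_centered M (X n)"
    and K: "finite K" "K \<subseteq> {1..}" and \<sigma>: "\<And>k. \<sigma> k \<in> {-1, 1 :: real}"
  shows "(\<integral>w. norm (\<Sum>k\<in>K. X k w) \<partial>M) \<le> 2 * (\<integral>w. norm (\<Sum>k\<in>K. \<sigma> k *\<^sub>R X k w) \<partial>M)"
proof -
  define A B where "A = {k \<in> K. \<sigma> k = 1}" and "B = {k \<in> K. \<sigma> k \<noteq> 1}"
  have AB: "A \<subseteq> {1..}" "B \<subseteq> {1..}" "A \<inter> B = {}" "A \<union> B = K" "finite A" "finite B"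
    using K by (auto simp: A_def B_def)
  define S where "S J w = (\<Sum>k\<in>J. X k w)" for J w
  have int: "integrable M (S J)" if "J \<subseteq> {1..}" for J
    unfolding S_def[abs_def] using that cent
    by (intro Bochner_Integration.integrable_sum integrable_if_strongly_centered) auto
  have zero: "(\<integral>w. S J w \<partial>M) = 0" if "J \<subseteq> {1..}" for J
    unfolding S_def using that cent
    by (subst Bochner_Integration.integral_sum)
       (auto intro!: sum.neutral integral_strongly_centered integrable_if_strongly_centered)
  have indep: "indep_var borel (S I) borel (\<lambda>w. - S J w)"
    if "I \<subseteq> {1..}" "J \<subseteq> {1..}" "I \<inter> J = {}" for I J
  proof -
    have "indep_var borel ((\<lambda>y. \<Sum>k\<in>I. y k) \<circ> (\<lambda>w. restrict (\<lambda>i. X i w) I))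
       borel ((\<lambda>y. - (\<Sum>k\<in>J. y k)) \<circ> (\<lambda>w. restrict (\<lambda>i. X i w) J))"
      by (rule indep_var_compose[OF indep_var_restrict[OF ind \<open>I \<inter> J = {}\<close> \<open>I \<subseteq> _\<close> \<open>J \<subseteq> _\<close>]])
        (auto intro!: borel_measurable_sum borel_measurable_uminus)
    then show ?thesis by (simp add: comp_def S_def[abs_def])
  qed
  have le: "(\<integral>w. norm (S I w) \<partial>M) \<le> (\<integral>w. norm (S I w - S J w) \<partial>M)"
    if "I \<subseteq> {1..}" "J \<subseteq> {1..}" "I \<inter> J = {}" for I J
    using integral_norm_le_add_indep[OF indep[OF that] int[OF that(1)]] int[OF that(2)] zero[OF that(2)] by simp
  have sum: "(\<Sum>k\<in>K. X k w) = S A w + S B w" for w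
    using AB by (simp add: S_def sum.union_disjoint flip: AB(4))
  have signed: "(\<Sum>k\<in>K. \<sigma> k *\<^sub>R X k w) = S A w - S B w" for w
  proof -
    have "(\<Sum>k\<in>K. \<sigma> k *\<^sub>R X k w) = (\<Sum>k\<in>A. \<sigma> k *\<^sub>R X k w) + (\<Sum>k\<in>B. \<sigma> k *\<^sub>R X k w)"
      using AB by (simp add: sum.union_disjoint flip: AB(4))
    also have "(\<Sum>k\<in>A. \<sigma> k *\<^sub>R X k w) = S A w" by (simp add: S_def A_def)
    also have "(\<Sum>k\<in>B. \<sigma> k *\<^sub>R X k w) = (\<Sum>k\<in>B. - X k w)"
    proof (rule sum.cong[OF refl])
      fix k assume "k \<in> B"
      then have "\<sigma> k = -1" using \<sigma>[of k] by (auto simp: B_def)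
      then show "\<sigma> k *\<^sub>R X k w = - X k w" by simp
    qed
    finally show ?thesis by (simp add: S_def sum_negf)
  qed
  have "(\<integral>w. norm (S A w + S B w) \<partial>M) \<le> (\<integral>w. norm (S A w) + norm (S B w) \<partial>M)"
    using int AB by (intro integral_mono norm_triangle_ineq integrable_norm
        Bochner_Integration.integrable_add) auto
  also have "\<dots> = (\<integral>w. norm (S A w) \<partial>M) + (\<integral>w. norm (S B w) \<partial>M)"
    using int AB by (intro Bochner_Integration.integral_add integrable_norm) auto
  also have "\<dots> \<le> (\<integral>w. norm (S A w - S B w) \<partial>M) + (\<integral>w. norm (S B w - S A w) \<partial>M)"
    using AB by (intro add_mono le) auto
  also have "\<dots> = 2 * (\<integral>w. norm (S A w - S B w) \<partial>M)" by (simp add: norm_minus_commute)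
  finally show ?thesis by (simp add: sum signed)
qed

lemma integrable_rad_mean:
  fixes X :: "nat \<Rightarrow> 'a \<Rightarrow> 'b::{banach,second_countable_topology}"
  assumes "\<And>k. k \<in> set ks \<Longrightarrow> integrable M (X k)" "integrable M U"
  shows "integrable M (\<lambda>w. rad_mean (map (\<lambda>k. X k w) ks) (\<lambda>v. norm (U w + v)))"
  using assms
proof (induction ks arbitrary: U)
  case (Cons k ks)
  have "integrable M (\<lambda>w. rad_mean (map (\<lambda>k. X k w) ks) (\<lambda>v. norm (U w + X k w + v)))"
    "integrable M (\<lambda>w. rad_mean (map (\<lambda>k. X k w) ks) (\<lambda>v. norm (U w - X k w + v)))"
    by (rule Cons.IH; use Cons.prems in auto)+
  then show ?case by (simp add: algebra_simps)
qed simp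

text \<open>A lower bound valid for every deterministic choice of signs is valid for the average over the signs.
  The variable \<open>U\<close> collects the summands whose signs are fixed already.\<close>

lemma rad_mean_ge_if_signs_ge:
  fixes X :: "nat \<Rightarrow> 'a \<Rightarrow> 'b::{banach,second_countable_topology}"
  assumes "\<And>k. k \<in> set ks \<Longrightarrow> integrable M (X k)" "integrable M U" "distinct ks"
    and "\<And>\<sigma>. (\<And>k. \<sigma> k \<in> {-1, 1 :: real}) \<Longrightarrow> c \<le> (\<integral>w. norm (U w + (\<Sum>k\<in>set ks. \<sigma> k *\<^sub>R X k w)) \<partial>M)"
  shows "c \<le> (\<integral>w. rad_mean (map (\<lambda>k. X k w) ks) (\<lambda>v. norm (U w + v)) \<partial>M)"
  using assms
proof (induction ks arbitrary: U)
  case Nil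
  from Nil(4)[of "\<lambda>_. 1"] show ?case by simp
next
  case (Cons k ks)
  let ?R = "\<lambda>U w. rad_mean (map (\<lambda>k. X k w) ks) (\<lambda>v. norm (U w + v))"
  have int: "integrable M (\<lambda>w. U w + s *\<^sub>R X k w)" for s :: real using Cons.prems by auto
  have "c \<le> (\<integral>w. ?R (\<lambda>w. U w + s *\<^sub>R X k w) w \<partial>M)" if s: "s \<in> {-1, 1}" for s
  proof (rule Cons.IH[OF _ int])
    fix \<sigma> :: "nat \<Rightarrow> real" assume \<sigma>: "\<And>k. \<sigma> k \<in> {-1, 1}"
    have "c \<le> (\<integral>w. norm (U w + (\<Sum>j\<in>set (k # ks). (\<sigma>(k := s)) j *\<^sub>R X j w)) \<partial>M)"
      using \<sigma> s by (intro Cons.prems(4)) simp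
    moreover have "(\<Sum>j\<in>set ks. (\<sigma>(k := s)) j *\<^sub>R X j w) = (\<Sum>j\<in>set ks. \<sigma> j *\<^sub>R X j w)" for w
      using Cons.prems(3) by (intro sum.cong) auto
    ultimately show "c \<le> (\<integral>w. norm (U w + s *\<^sub>R X k w + (\<Sum>k\<in>set ks. \<sigma> k *\<^sub>R X k w)) \<partial>M)"
      using Cons.prems(3) by (simp add: add.assoc)
  qed (use Cons.prems in auto)
  from this[of 1] this[of "-1"]
  have "c \<le> ((\<integral>w. ?R (\<lambda>w. U w + X k w) w \<partial>M) + (\<integral>w. ?R (\<lambda>w. U w - X k w) w \<partial>M)) / 2" by simp
  also have "\<dots> = (\<integral>w. (?R (\<lambda>w. U w + X k w) w + ?R (\<lambda>w. U w - X k w) w) / 2 \<partial>M)"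
  proof -
    have "integrable M (?R (\<lambda>w. U w + X k w))" "integrable M (?R (\<lambda>w. U w - X k w))"
      using Cons.prems by (auto intro!: integrable_rad_mean)
    then show ?thesis by simp
  qed
  finally show ?case by (simp add: algebra_simps)
qed

lemma (in prob_space) symmetrization:
  fixes X :: "nat \<Rightarrow> 'a \<Rightarrow> 'b::{banach,second_countable_topology}"
  assumes ind: "indep_vars (\<lambda>_. borel) X {1..}" and cent: "\<And>n. n \<ge> 1 \<Longrightarrow> strongly_centered M (X n)"
  shows "(\<integral>\<^sup>+w. ennreal (norm (partial_sum X n w)) \<partial>M)
    \<le> 2 * (\<integral>\<^sup>+w. ennreal (rad_mean (map (\<lambda>k. X k w) [1..<n + 1]) norm) \<partial>M)"
proof -
  have int: "integrable M (X k)" if "k \<ge> 1" for k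
    using integrable_if_strongly_centered[OF cent[OF that]] .
  have set: "set [1..<n + 1] = {1..n}" by auto
  have "1 / 2 * (\<integral>w. norm (\<Sum>k = 1..n. X k w) \<partial>M)
     \<le> (\<integral>w. rad_mean (map (\<lambda>k. X k w) [1..<n + 1]) (\<lambda>v. norm (0 + v)) \<partial>M)"
  proof (rule rad_mean_ge_if_signs_ge)
    fix \<sigma> :: "nat \<Rightarrow> real" assume \<sigma>: "\<And>k. \<sigma> k \<in> {-1, 1}"
    have "(\<integral>w. norm (\<Sum>k = 1..n. X k w) \<partial>M) \<le> 2 * (\<integral>w. norm (\<Sum>k = 1..n. \<sigma> k *\<^sub>R X k w) \<partial>M)"
      by (rule integral_norm_sum_le_signs[OF ind cent _ _ \<sigma>]) auto
    then show "1 / 2 * (\<integral>w. norm (\<Sum>k = 1..n. X k w) \<partial>M)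
      \<le> (\<integral>w. norm (0 + (\<Sum>k\<in>set [1..<n + 1]. \<sigma> k *\<^sub>R X k w)) \<partial>M)"
      unfolding set by simp
  qed (use int in auto)
  then have le: "(\<integral>w. norm (partial_sum X n w) \<partial>M) \<le> 2 * (\<integral>w. rad_mean (map (\<lambda>k. X k w) [1..<n + 1]) norm \<partial>M)"
    by (simp add: partial_sum_def)
  have i1: "integrable M (partial_sum X n)"
    unfolding partial_sum_def[abs_def] using int by (intro Bochner_Integration.integrable_sum) auto
  have i2: "integrable M (\<lambda>w. rad_mean (map (\<lambda>k. X k w) [1..<n + 1]) norm)"
    using integrable_rad_mean[of "[1..<n + 1]" M X "\<lambda>_. 0"] int by (simp del: upt_Suc)
  have "(\<integral>\<^sup>+w. ennreal (norm (partial_sum X n w)) \<partial>M) = ennreal (\<integral>w. norm (partial_sum X n w) \<partial>M)"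
    using i1 by (intro nn_integral_eq_integral) auto
  also have "\<dots> \<le> ennreal (2 * (\<integral>w. rad_mean (map (\<lambda>k. X k w) [1..<n + 1]) norm \<partial>M))"
    using le by (rule ennreal_leI)
  also have "\<dots> = 2 * ennreal (\<integral>w. rad_mean (map (\<lambda>k. X k w) [1..<n + 1]) norm \<partial>M)"
    by (simp add: ennreal_mult integral_nonneg rad_mean_nonneg)
  also have "ennreal (\<integral>w. rad_mean (map (\<lambda>k. X k w) [1..<n + 1]) norm \<partial>M)
      = (\<integral>\<^sup>+w. ennreal (rad_mean (map (\<lambda>k. X k w) [1..<n + 1]) norm) \<partial>M)"
    using i2 by (intro nn_integral_eq_integral[symmetric]) (simp_all add: rad_mean_nonneg)
  finally show ?thesis .
qed

section \<open>A scalar series\<close>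

lemma powr_increment:
  fixes x s :: real
  assumes "0 < x"
  obtains z where "x < z" "z < x + 1" "(x + 1) powr s - x powr s = s * z powr (s - 1)"
proof -
  have "\<exists>z>x. z < x + 1 \<and> (x + 1) powr s - x powr s = (x + 1 - x) * (s * z powr (s - 1))"
    using assms by (intro MVT2) (auto intro!: derivative_eq_intros)
  then show ?thesis using that by auto
qed

lemma norm_weight_le:
  assumes "0 < \<alpha>" "\<alpha> < 1" "1 \<le> n"
  shows "norm_weight \<alpha> n \<le> real n powr (- 1 - \<alpha>)"
proof -
  obtain z where z: "real n < z" "(real n + 1) powr - \<alpha> - real n powr - \<alpha> = - \<alpha> * z powr (- \<alpha> - 1)"
    using powr_increment[of "real n" "- \<alpha>"] assms by auto
  have "norm_weight \<alpha> n = \<alpha> * z powr (- \<alpha> - 1)"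
    using z(2) by (simp add: norm_weight_def powr_minus_divide add.commute)
  also have "\<dots> \<le> 1 * real n powr (- \<alpha> - 1)"
    using assms z(1) by (intro mult_mono powr_mono2') auto
  also have "- \<alpha> - 1 = - 1 - \<alpha>" by simp
  finally show ?thesis by simp
qed

text \<open>The function \<open>min u (u\<^sup>\<beta>)\<close> on the half-line \<open>u \<ge> 0\<close>, for \<open>0 < \<beta> < 1\<close>.\<close>

definition tail_bound :: "real \<Rightarrow> real \<Rightarrow> real" where
  "tail_bound \<beta> u = (if u \<le> 1 then u else u powr \<beta>)"

lemma tail_bound_nonneg: "0 \<le> u \<Longrightarrow> 0 \<le> tail_bound \<beta> u"
  by (simp add: tail_bound_def)

text \<open>The sum is split at \<open>n = 1 / g\<close>. Below, the terms are at most \<open>g n powr (- \<alpha>)\<close>; above, they are at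
  most \<open>g\<^sup>\<beta> n powr (- 1 - \<gamma>)\<close> with \<open>\<gamma> = \<alpha> - \<beta>\<close>. Both partial sums telescope by the mean value
  theorem, and each is of order \<open>g\<^sup>\<alpha>\<close>.\<close>

lemma sum_norm_weight_tail_bound_le:
  assumes \<beta>: "0 < \<beta>" "\<beta> < \<alpha>" "\<alpha> < 1" and g: "0 \<le> g" "g \<le> 1"
  shows "(\<Sum>n=1..N. norm_weight \<alpha> n * tail_bound \<beta> (real n * g))
    \<le> (1 / (1 - \<alpha>) + 2 / (\<alpha> - \<beta>)) * g powr \<alpha>"
proof (cases "g = 0")
  case True
  then show ?thesis by (simp add: tail_bound_def)
next
  case False
  then have g0: "0 < g" using g by simp
  define F where "F N = (\<Sum>n=1..N. norm_weight \<alpha> n * tail_bound \<beta> (real n * g))" for N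
  define \<gamma> where "\<gamma> = \<alpha> - \<beta>"
  have \<gamma>: "0 < \<gamma>" "\<gamma> < 1" using \<beta> by (simp_all add: \<gamma>_def)
  define m where "m = nat \<lfloor>1 / g\<rfloor>"
  have inv: "1 \<le> 1 / g" using g0 g by simp
  have "real m = of_int \<lfloor>1 / g\<rfloor>" using g0 by (simp add: m_def)
  then have m1: "real m \<le> 1 / g" "1 / g < real m + 1" by simp_all
  have m: "1 \<le> m" unfolding m_def by (rule le_nat_floor) (use inv in simp)
  have F_small: "F N \<le> g * (real N powr (1 - \<alpha>) / (1 - \<alpha>))" if "N \<le> m" for N
    using that
  proof (induction N)
    case (Suc N)
    have "real (Suc N) \<le> 1 / g" using Suc.prems m1 by linarith
    then have le1: "real (Suc N) * g \<le> 1" using g0 by (simp add: field_simps)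
    have "norm_weight \<alpha> (Suc N) * tail_bound \<beta> (real (Suc N) * g)
       \<le> real (Suc N) powr (- 1 - \<alpha>) * (real (Suc N) * g)"
      using le1 g0 \<beta> unfolding tail_bound_def
      by (simp only: if_True) (intro mult_right_mono norm_weight_le, auto)
    also have "\<dots> = g * real (Suc N) powr (- \<alpha>)"
    proof -
      have "real (Suc N) powr (- 1 - \<alpha>) * real (Suc N) = real (Suc N) powr (- 1 - \<alpha>) * real (Suc N) powr 1" by simp
      also have "\<dots> = real (Suc N) powr (- \<alpha>)" by (simp only: powr_add[symmetric]) simp
      finally show ?thesis by (simp add: mult.assoc[symmetric] mult.commute)
    qed
    also have "real (Suc N) powr (- \<alpha>) \<le> real (Suc N) powr (1 - \<alpha>) / (1 - \<alpha>) - real N powr (1 - \<alpha>) / (1 - \<alpha>)"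
    proof (cases "N = 0")
      case True
      then show ?thesis using \<beta> by simp
    next
      case False
      obtain z where z: "z < real N + 1" "real N < z"
        "(real N + 1) powr (1 - \<alpha>) - real N powr (1 - \<alpha>) = (1 - \<alpha>) * z powr (1 - \<alpha> - 1)"
        using powr_increment[of "real N" "1 - \<alpha>"] False by auto
      have "real (Suc N) powr (- \<alpha>) \<le> z powr (- \<alpha>)"
        using z \<beta> by (intro powr_mono2') auto
      also have "\<dots> = (real (Suc N) powr (1 - \<alpha>) - real N powr (1 - \<alpha>)) / (1 - \<alpha>)"
        using z(3) \<beta> by (simp add: add.commute)
      finally show ?thesis by (simp add: diff_divide_distrib)
    qed
    finally have "norm_weight \<alpha> (Suc N) * tail_bound \<beta> (real (Suc N) * g)
       \<le> g * (real (Suc N) powr (1 - \<alpha>) / (1 - \<alpha>) - real N powr (1 - \<alpha>) / (1 - \<alpha>))"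
      using g0 by simp
    moreover have "F (Suc N) = F N + norm_weight \<alpha> (Suc N) * tail_bound \<beta> (real (Suc N) * g)"
      by (simp add: F_def)
    ultimately show ?case using Suc by (simp add: right_diff_distrib)
  qed (simp add: F_def)
  have F_large: "F N \<le> F m + g powr \<beta> * ((real m powr (- \<gamma>) - real N powr (- \<gamma>)) / \<gamma>)" if "m \<le> N" for N
    using that
  proof (induction N rule: dec_induct)
    case (step N)
    have "1 / g < real (Suc N)" using step.hyps m1 by linarith
    then have gt1: "\<not> real (Suc N) * g \<le> 1" using g0 by (simp add: field_simps)
    have "norm_weight \<alpha> (Suc N) * tail_bound \<beta> (real (Suc N) * g)
       \<le> real (Suc N) powr (- 1 - \<alpha>) * (real (Suc N) * g) powr \<beta>"
      using gt1 \<beta> unfolding tail_bound_def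
      by (simp only: if_False) (intro mult_right_mono norm_weight_le, auto)
    also have "\<dots> = g powr \<beta> * (real (Suc N) powr (- 1 - \<alpha>) * real (Suc N) powr \<beta>)"
      using g0 by (simp add: powr_mult)
    also have "real (Suc N) powr (- 1 - \<alpha>) * real (Suc N) powr \<beta> = real (Suc N) powr (- \<gamma> - 1)"
      by (simp only: powr_add[symmetric]) (simp add: \<gamma>_def algebra_simps)
    also have "\<dots> \<le> (real N powr (- \<gamma>) - real (Suc N) powr (- \<gamma>)) / \<gamma>"
    proof -
      have N: "0 < real N" using step.hyps m by simp
      obtain z where z: "z < real N + 1" "real N < z"
        "(real N + 1) powr (- \<gamma>) - real N powr (- \<gamma>) = - \<gamma> * z powr (- \<gamma> - 1)"
        using powr_increment[OF N, of "- \<gamma>"] by auto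
      have "real (Suc N) powr (- \<gamma> - 1) \<le> z powr (- \<gamma> - 1)"
        using z \<gamma> N by (intro powr_mono2') auto
      also have "\<dots> = (real N powr (- \<gamma>) - real (Suc N) powr (- \<gamma>)) / \<gamma>"
        using z(3) \<gamma> by (simp add: field_simps)
      finally show ?thesis .
    qed
    finally have "norm_weight \<alpha> (Suc N) * tail_bound \<beta> (real (Suc N) * g)
       \<le> g powr \<beta> * ((real N powr (- \<gamma>) - real (Suc N) powr (- \<gamma>)) / \<gamma>)"
      by (simp add: mult_left_mono)
    moreover have "F (Suc N) = F N + norm_weight \<alpha> (Suc N) * tail_bound \<beta> (real (Suc N) * g)"
      by (simp add: F_def)
    moreover have "g powr \<beta> * ((real m powr (- \<gamma>) - real N powr (- \<gamma>)) / \<gamma>)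
        + g powr \<beta> * ((real N powr (- \<gamma>) - real (Suc N) powr (- \<gamma>)) / \<gamma>)
        = g powr \<beta> * ((real m powr (- \<gamma>) - real (Suc N) powr (- \<gamma>)) / \<gamma>)"
      by (simp add: diff_divide_distrib right_diff_distrib)
    ultimately show ?case using step.IH by linarith
  qed simp
  have small: "g * (real N powr (1 - \<alpha>) / (1 - \<alpha>)) \<le> 1 / (1 - \<alpha>) * g powr \<alpha>" if "N \<le> m" for N
  proof -
    have "real N powr (1 - \<alpha>) \<le> (1 / g) powr (1 - \<alpha>)" using that m1 \<beta> by (intro powr_mono2) auto
    also have "\<dots> = g powr (\<alpha> - 1)" using g0 by (simp add: powr_divide powr_diff)
    finally have "g powr 1 * real N powr (1 - \<alpha>) \<le> g powr 1 * g powr (\<alpha> - 1)" by (intro mult_left_mono) auto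
    also have "\<dots> = g powr \<alpha>" by (simp only: powr_add[symmetric]) simp
    finally have "g * real N powr (1 - \<alpha>) \<le> g powr \<alpha>" using g0 by simp
    then show ?thesis using \<beta> by (simp add: divide_right_mono)
  qed
  have large: "g powr \<beta> * ((real m powr (- \<gamma>) - real N powr (- \<gamma>)) / \<gamma>) \<le> 2 / (\<alpha> - \<beta>) * g powr \<alpha>" for N
  proof -
    have "1 / (2 * g) \<le> real m" using m1 m by (simp add: field_simps)
    then have "real m powr (- \<gamma>) \<le> (1 / (2 * g)) powr (- \<gamma>)" using g0 \<gamma> by (intro powr_mono2') auto
    also have "\<dots> = 2 powr \<gamma> * g powr \<gamma>" using g0 by (simp add: powr_divide powr_minus powr_mult)
    also have "\<dots> \<le> 2 powr 1 * g powr \<gamma>" using \<gamma> by (intro mult_right_mono powr_mono) auto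
    also have "2 powr 1 * g powr \<gamma> = 2 * g powr \<gamma>" by simp
    finally have "real m powr (- \<gamma>) - real N powr (- \<gamma>) \<le> 2 * g powr \<gamma>"
      using powr_ge_zero[of "real N" "- \<gamma>"] by linarith
    then have "g powr \<beta> * ((real m powr (- \<gamma>) - real N powr (- \<gamma>)) / \<gamma>) \<le> g powr \<beta> * (2 * g powr \<gamma> / \<gamma>)"
      using \<gamma> by (intro mult_left_mono divide_right_mono) auto
    also have "\<dots> = 2 / \<gamma> * (g powr \<beta> * g powr \<gamma>)" by simp
    also have "g powr \<beta> * g powr \<gamma> = g powr \<alpha>" by (simp only: powr_add[symmetric]) (simp add: \<gamma>_def)
    finally show ?thesis by (simp add: \<gamma>_def)
  qed
  have "F N \<le> 1 / (1 - \<alpha>) * g powr \<alpha> + 2 / (\<alpha> - \<beta>) * g powr \<alpha>"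
  proof (cases "N \<le> m")
    case True
    have "0 \<le> 2 / (\<alpha> - \<beta>) * g powr \<alpha>" using \<beta> by simp
    then show ?thesis using F_small[OF True] small[OF True] by linarith
  next
    case False
    then show ?thesis using F_small[of m] small[of m] F_large[of N] large[of N] by simp
  qed
  then show ?thesis by (simp only: F_def distrib_right)
qed

section \<open>From a power saving to quasimartingales\<close>

lemma (in prob_space) sup_tail_bounds:
  shows "n \<ge> 1 \<Longrightarrow> measure M {w \<in> space M. norm (X n w) > t} \<le> sup_tail M X t"
    and "0 \<le> sup_tail M X t" "sup_tail M X t \<le> 1"
proof -
  have bdd: "bdd_above ((\<lambda>n. measure M {w \<in> space M. norm (X n w) > t}) ` {1..})"
    by (intro bdd_aboveI2[of _ _ 1] prob_le_1)
  have *: "measure M {w \<in> space M. norm (X n w) > t} \<le> sup_tail M X t" if "n \<ge> 1" for n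
    unfolding sup_tail_def using that by (intro cSUP_upper[OF _ bdd]) simp
  then show "n \<ge> 1 \<Longrightarrow> measure M {w \<in> space M. norm (X n w) > t} \<le> sup_tail M X t" .
  show "0 \<le> sup_tail M X t" by (rule order_trans[OF measure_nonneg *[of 1]]) simp
  show "sup_tail M X t \<le> 1" unfolding sup_tail_def by (rule cSUP_least) (auto intro: prob_le_1)
qed

lemma (in prob_space) measurable_sup_tail:
  fixes X :: "nat \<Rightarrow> 'a \<Rightarrow> 'b::{banach,second_countable_topology}"
  assumes "\<And>n. n \<ge> 1 \<Longrightarrow> X n \<in> borel_measurable M"
  shows "sup_tail M X \<in> borel_measurable borel"
proof -
  have "mono (\<lambda>t. - sup_tail M X t)"
  proof (rule monoI)
    fix s t :: real assume st: "s \<le> t"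
    have "sup_tail M X t \<le> sup_tail M X s"
      unfolding sup_tail_def[of M X t]
    proof (rule cSUP_least)
      fix n :: nat assume n: "n \<in> {1..}"
      have [measurable]: "X n \<in> borel_measurable M" using assms n by simp
      have "{w \<in> space M. norm (X n w) > s} \<in> sets M" by measurable
      then have "measure M {w \<in> space M. norm (X n w) > t} \<le> measure M {w \<in> space M. norm (X n w) > s}"
        using st by (intro finite_measure_mono) auto
      also have "\<dots> \<le> sup_tail M X s" using n by (intro sup_tail_bounds) auto
      finally show "measure M {w \<in> space M. norm (X n w) > t} \<le> sup_tail M X s" .
    qed auto
    then show "- sup_tail M X s \<le> - sup_tail M X t" by simp
  qed
  then have "(\<lambda>t. - (- sup_tail M X t)) \<in> borel_measurable borel"
    by (intro borel_measurable_uminus borel_measurable_mono)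
  then show ?thesis by simp
qed

text \<open>Symmetrization, the layer-cake bound and Tonelli's theorem reduce the claim to the expectation of
  \<open>\<phi>\<close> at the number \<open>R\<close> of those \<open>k \<le> n\<close> with \<open>\<parallel>X\<^sub>k\<parallel> > t\<close>, where \<open>E R \<le> u = n g(t)\<close>.\<close>

lemma (in prob_space) nn_integral_norm_partial_sum_le:
  fixes X :: "nat \<Rightarrow> 'a \<Rightarrow> 'b::{banach,second_countable_topology}"
  assumes ind: "indep_vars (\<lambda>_. borel) X {1..}" and cent: "\<And>n. n \<ge> 1 \<Longrightarrow> strongly_centered M (X n)"
    and \<beta>: "0 < \<beta>" "\<beta> < 1" and C: "0 \<le> C"
    and bound: "\<And>m. rad_sup TYPE('b) m \<le> C * real m powr \<beta>"
  shows "(\<integral>\<^sup>+w. ennreal (norm (partial_sum X n w)) \<partial>M)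
    \<le> 2 * (\<integral>\<^sup>+t\<in>{0<..}. ennreal ((2 * C + 1) * tail_bound \<beta> (real n * sup_tail M X t)) \<partial>lborel)"
proof -
  have rv: "X k \<in> borel_measurable M" if "k \<ge> 1" for k
    using cent[OF that] by (simp add: strongly_centered_def)
  define R where "R w t = (\<Sum>k=1..n. indicator {y. t < norm (X k y)} w :: real)" for w t
  define H where "H x = min x (C * x powr \<beta>)" for x
  have count: "real (length (filter (\<lambda>x. t < norm x) (map (\<lambda>k. X k w) [1..<n + 1]))) = R w t" for w t
  proof -
    have "length (filter (\<lambda>x. t < norm x) (map (\<lambda>k. X k w) [1..<n + 1])) = card (set (filter (\<lambda>k. t < norm (X k w)) [1..<n + 1]))"
      by (simp only: filter_map length_map comp_def) (rule distinct_card[symmetric], simp)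
    also have "set (filter (\<lambda>k. t < norm (X k w)) [1..<n + 1]) = {1..n} \<inter> {k. t < norm (X k w)}" by auto
    finally show ?thesis by (simp add: R_def indicator_def sum.If_cases)
  qed
  have R0: "0 \<le> R w t" for w t by (simp add: R_def sum_nonneg)
  have Rpair [measurable]: "(\<lambda>x. R (fst x) (snd x)) \<in> borel_measurable (M \<Otimes>\<^sub>M lborel)"
  proof -
    have "(\<lambda>x. indicator {y. snd x < norm (X k y)} (fst x) :: real) \<in> borel_measurable (M \<Otimes>\<^sub>M lborel)"
      if "k \<in> {1..n}" for k
    proof -
      have [measurable]: "X k \<in> borel_measurable M" using rv that by simp
      have "(\<lambda>x. if snd x < norm (X k (fst x)) then 1 else 0 :: real) \<in> borel_measurable (M \<Otimes>\<^sub>M lborel)"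
        by measurable
      then show ?thesis by (simp add: indicator_def)
    qed
    then show ?thesis unfolding R_def by (intro borel_measurable_sum)
  qed
  have H [measurable]: "H \<in> borel_measurable borel" unfolding H_def by measurable
  have Rt [measurable]: "(\<lambda>w. R w t) \<in> borel_measurable M" for t
  proof -
    have "(\<lambda>w. (w, t)) \<in> measurable M (M \<Otimes>\<^sub>M lborel)" by measurable
    from measurable_compose[OF this Rpair] show ?thesis by simp
  qed
  have ER: "(\<integral>\<^sup>+w. ennreal (R w t) \<partial>M) \<le> ennreal (real n * sup_tail M X t)" for t
  proof -
    have "(\<integral>\<^sup>+w. ennreal (R w t) \<partial>M) = (\<integral>\<^sup>+w. (\<Sum>k=1..n. indicator {w \<in> space M. t < norm (X k w)} w) \<partial>M)"
      unfolding R_def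
      by (intro nn_integral_cong) (auto simp flip: sum_ennreal intro!: sum.cong split: split_indicator)
    also have "\<dots> = (\<Sum>k=1..n. \<integral>\<^sup>+w. indicator {w \<in> space M. t < norm (X k w)} w \<partial>M)"
      using rv by (intro nn_integral_sum) (auto intro!: borel_measurable_indicator)
    also have "\<dots> = (\<Sum>k=1..n. ennreal (measure M {w \<in> space M. t < norm (X k w)}))"
      using rv by (intro sum.cong refl) (auto simp: emeasure_eq_measure)
    also have "\<dots> \<le> (\<Sum>k=1..n. ennreal (sup_tail M X t))"
      by (intro sum_mono ennreal_leI sup_tail_bounds) auto
    also have "\<dots> = ennreal (real n * sup_tail M X t)"
      by (simp add: ennreal_mult sup_tail_bounds ennreal_of_nat_eq_real_of_nat)
    finally show ?thesis .
  qed
  have EH: "(\<integral>\<^sup>+w. ennreal (H (R w t)) \<partial>M) \<le> ennreal ((2 * C + 1) * tail_bound \<beta> (real n * sup_tail M X t))" for t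
  proof -
    define u where "u = real n * sup_tail M X t"
    have u0: "0 \<le> u" by (simp add: u_def sup_tail_bounds)
    show ?thesis
    proof (cases "u \<le> 1")
      case True
      have "(\<integral>\<^sup>+w. ennreal (H (R w t)) \<partial>M) \<le> (\<integral>\<^sup>+w. ennreal (R w t) \<partial>M)"
        by (intro nn_integral_mono ennreal_leI) (simp add: H_def)
      also have "\<dots> \<le> ennreal u" using ER by (simp add: u_def)
      also have "\<dots> \<le> ennreal ((2 * C + 1) * u)" using u0 C by (intro ennreal_leI) (simp add: algebra_simps)
      finally show ?thesis using True by (simp add: tail_bound_def u_def)
    next
      case False
      then have u1: "1 < u" by simp
      \<comment> \<open>an affine majorant of the concave function \<open>C x\<^sup>\<beta>\<close>, adapted to the value \<open>u\<close> that bounds the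
        expectation\<close>
      have H_le: "H x \<le> C * u powr \<beta> + C * u powr (\<beta> - 1) * x" if x: "0 \<le> x" for x
      proof (cases "x \<le> u")
        case True
        then have "x powr \<beta> \<le> u powr \<beta>" using \<beta> x by (intro powr_mono2) auto
        then have "H x \<le> C * u powr \<beta>" unfolding H_def using C by (meson min.coboundedI2 mult_left_mono)
        then show ?thesis using C x by (simp add: add_increasing2)
      next
        case False
        have "x powr \<beta> = x powr (\<beta> - 1) * x" using False u1 by (simp add: powr_diff)
        also have "\<dots> \<le> u powr (\<beta> - 1) * x" using False u1 \<beta> by (intro mult_right_mono powr_mono2') auto
        finally have "H x \<le> C * (u powr (\<beta> - 1) * x)" unfolding H_def using C by (meson min.coboundedI2 mult_left_mono)
        then show ?thesis using C by (simp add: add_increasing mult.assoc)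
      qed
      have "(\<integral>\<^sup>+w. ennreal (H (R w t)) \<partial>M)
         \<le> (\<integral>\<^sup>+w. ennreal (C * u powr \<beta>) + ennreal (C * u powr (\<beta> - 1)) * ennreal (R w t) \<partial>M)"
      proof (rule nn_integral_mono)
        fix w
        have "ennreal (H (R w t)) \<le> ennreal (C * u powr \<beta> + C * u powr (\<beta> - 1) * R w t)"
          by (intro ennreal_leI H_le R0)
        then show "ennreal (H (R w t)) \<le> ennreal (C * u powr \<beta>) + ennreal (C * u powr (\<beta> - 1)) * ennreal (R w t)"
          using C R0[of w t] by (simp add: ennreal_mult)
      qed
      also have "\<dots> = ennreal (C * u powr \<beta>) + ennreal (C * u powr (\<beta> - 1)) * (\<integral>\<^sup>+w. ennreal (R w t) \<partial>M)"
        by (simp add: nn_integral_add nn_integral_cmult emeasure_space_1)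
      also have "\<dots> \<le> ennreal (C * u powr \<beta>) + ennreal (C * u powr (\<beta> - 1)) * ennreal u"
        using ER by (intro add_left_mono mult_left_mono) (simp_all add: u_def)
      also have "\<dots> = ennreal (C * u powr \<beta> + C * (u powr (\<beta> - 1) * u))"
        using C u0 by (simp add: ennreal_mult[symmetric] ennreal_plus[symmetric] mult.assoc del: ennreal_plus)
      also have "u powr (\<beta> - 1) * u = u powr \<beta>" using u1 by (simp add: powr_diff)
      also have "ennreal (C * u powr \<beta> + C * u powr \<beta>) \<le> ennreal ((2 * C + 1) * u powr \<beta>)"
        by (intro ennreal_leI) (simp add: algebra_simps)
      finally show ?thesis using False by (simp add: tail_bound_def u_def)
    qed
  qed
  have "(\<integral>\<^sup>+w. ennreal (rad_mean (map (\<lambda>k. X k w) [1..<n + 1]) norm) \<partial>M)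
    \<le> (\<integral>\<^sup>+w. \<integral>\<^sup>+t. ennreal (H (R w t)) * indicator {0<..} t \<partial>lborel \<partial>M)"
  proof (rule nn_integral_mono)
    fix w
    have "rad_sup TYPE('b) (length (filter (\<lambda>x. t < norm x) (map (\<lambda>k. X k w) [1..<n + 1]))) \<le> H (R w t)" for t
      using rad_sup_le[where 'b='b, of "length (filter (\<lambda>x. t < norm x) (map (\<lambda>k. X k w) [1..<n + 1]))"]
        bound[of "length (filter (\<lambda>x. t < norm x) (map (\<lambda>k. X k w) [1..<n + 1]))"]
      unfolding count H_def by simp
    then have "(\<integral>\<^sup>+t\<in>{0<..}. ennreal (rad_sup TYPE('b) (length (filter (\<lambda>x. t < norm x) (map (\<lambda>k. X k w) [1..<n + 1])))) \<partial>lborel)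
       \<le> (\<integral>\<^sup>+t. ennreal (H (R w t)) * indicator {0<..} t \<partial>lborel)"
      by (intro nn_integral_mono mult_right_mono ennreal_leI) auto
    with rad_mean_layer_cake[of "map (\<lambda>k. X k w) [1..<n + 1]"]
    show "ennreal (rad_mean (map (\<lambda>k. X k w) [1..<n + 1]) norm) \<le> (\<integral>\<^sup>+t. ennreal (H (R w t)) * indicator {0<..} t \<partial>lborel)"
      by (rule order_trans)
  qed
  also have "\<dots> = (\<integral>\<^sup>+t. \<integral>\<^sup>+w. ennreal (H (R w t)) * indicator {0<..} t \<partial>M \<partial>lborel)"
  proof -
    interpret pair_sigma_finite M lborel ..
    have "(\<lambda>x. ennreal (H (R (fst x) (snd x))) * indicator {0<..} (snd x)) \<in> borel_measurable (M \<Otimes>\<^sub>M lborel)"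
      by measurable
    then show ?thesis
      by (subst Fubini'[symmetric]) (simp_all add: split_beta')
  qed
  also have "\<dots> = (\<integral>\<^sup>+t. (\<integral>\<^sup>+w. ennreal (H (R w t)) \<partial>M) * indicator {0<..} t \<partial>lborel)"
    by (intro nn_integral_cong nn_integral_multc) measurable
  also have "\<dots> \<le> (\<integral>\<^sup>+t\<in>{0<..}. ennreal ((2 * C + 1) * tail_bound \<beta> (real n * sup_tail M X t)) \<partial>lborel)"
    by (intro nn_integral_mono mult_right_mono EH) auto
  finally show ?thesis
    using symmetrization[OF ind cent, of n] by (meson mult_left_mono order_trans zero_le)
qed

lemma quasimartingale_property_if_rad_sup_le:
  assumes p: "1 < p" and \<beta>: "0 < \<beta>" "\<beta> < 1 / p" and C: "0 \<le> C"
    and bound: "\<And>m. rad_sup TYPE('b::{banach,second_countable_topology}) m \<le> C * real m powr \<beta>"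
  shows "quasimartingale_property TYPE('b) TYPE('w) p"
  unfolding quasimartingale_property_def
proof (intro allI impI, elim conjE)
  fix M :: "'w measure" and X :: "nat \<Rightarrow> 'w \<Rightarrow> 'b"
  assume "prob_space M" and ind: "prob_space.indep_vars M (\<lambda>_. borel) X {1..}"
    and cent: "\<forall>n\<ge>1. strongly_centered M (X n)"
    and fin: "(\<integral>\<^sup>+t\<in>{0<..}. ennreal (sup_tail M X t powr (1 / p)) \<partial>lborel) < \<infinity>"
  interpret prob_space M by fact
  define \<alpha> where "\<alpha> = 1 / p"
  have \<alpha>: "0 < \<alpha>" "\<alpha> < 1" "\<beta> < \<alpha>" using p \<beta> by (simp_all add: \<alpha>_def)
  define K where "K = 1 / (1 - \<alpha>) + 2 / (\<alpha> - \<beta>)"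
  have K: "0 \<le> K" using \<alpha> by (simp add: K_def)
  have [measurable]: "sup_tail M X \<in> borel_measurable borel"
    using cent by (intro measurable_sup_tail) (auto simp: strongly_centered_def)
  let ?g = "sup_tail M X"
  let ?h = "\<lambda>m t. norm_weight \<alpha> (Suc m) * tail_bound \<beta> (real (Suc m) * ?g t)"
  have h0: "0 \<le> ?h m t" for m t
    using \<alpha> by (intro mult_nonneg_nonneg norm_weight_nonneg tail_bound_nonneg) (auto simp: sup_tail_bounds)
  have [measurable]: "?h m \<in> borel_measurable borel" for m
    unfolding tail_bound_def by measurable
  have "(\<Sum>m. ennreal (norm_weight \<alpha> (Suc m)) * (\<integral>\<^sup>+w. ennreal (norm (partial_sum X (Suc m) w)) \<partial>M))
     \<le> (\<Sum>m. ennreal (2 * (2 * C + 1)) * (\<integral>\<^sup>+t\<in>{0<..}. ennreal (?h m t) \<partial>lborel))"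
  proof (intro suminf_le summableI)
    fix m
    have [measurable]: "(\<lambda>t. tail_bound \<beta> (real (Suc m) * ?g t)) \<in> borel_measurable borel"
      unfolding tail_bound_def by measurable
    have "ennreal (norm_weight \<alpha> (Suc m)) * (\<integral>\<^sup>+w. ennreal (norm (partial_sum X (Suc m) w)) \<partial>M)
       \<le> ennreal (norm_weight \<alpha> (Suc m)) * (2 * (\<integral>\<^sup>+t\<in>{0<..}. ennreal ((2 * C + 1) * tail_bound \<beta> (real (Suc m) * ?g t)) \<partial>lborel))"
      using ind cent \<alpha> \<beta> C bound by (intro mult_left_mono nn_integral_norm_partial_sum_le) auto
    also have "(\<integral>\<^sup>+t\<in>{0<..}. ennreal ((2 * C + 1) * tail_bound \<beta> (real (Suc m) * ?g t)) \<partial>lborel)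
       = (\<integral>\<^sup>+t. ennreal (2 * C + 1) * (ennreal (tail_bound \<beta> (real (Suc m) * ?g t)) * indicator {0<..} t) \<partial>lborel)"
      using C by (intro nn_integral_cong) (simp add: ennreal_mult tail_bound_nonneg sup_tail_bounds mult.assoc)
    also have "\<dots> = ennreal (2 * C + 1) * (\<integral>\<^sup>+t\<in>{0<..}. ennreal (tail_bound \<beta> (real (Suc m) * ?g t)) \<partial>lborel)"
      by (rule nn_integral_cmult) measurable
    also have "ennreal (norm_weight \<alpha> (Suc m)) * (2 * (ennreal (2 * C + 1) * (\<integral>\<^sup>+t\<in>{0<..}. ennreal (tail_bound \<beta> (real (Suc m) * ?g t)) \<partial>lborel)))
       = ennreal (2 * (2 * C + 1)) * (ennreal (norm_weight \<alpha> (Suc m)) * (\<integral>\<^sup>+t\<in>{0<..}. ennreal (tail_bound \<beta> (real (Suc m) * ?g t)) \<partial>lborel))"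
    proof -
      have "ennreal (2 * (2 * C + 1)) = 2 * ennreal (2 * C + 1)" using C by (subst ennreal_mult) auto
      then show ?thesis by (simp only: mult_ac)
    qed
    also have "ennreal (norm_weight \<alpha> (Suc m)) * (\<integral>\<^sup>+t\<in>{0<..}. ennreal (tail_bound \<beta> (real (Suc m) * ?g t)) \<partial>lborel)
       = (\<integral>\<^sup>+t\<in>{0<..}. ennreal (?h m t) \<partial>lborel)"
    proof -
      have "(\<lambda>t. ennreal (tail_bound \<beta> (real (Suc m) * ?g t)) * indicator {0<..} t) \<in> borel_measurable lborel"
        by measurable
      from nn_integral_cmult[OF this, of "ennreal (norm_weight \<alpha> (Suc m))", symmetric] show ?thesis
        using \<alpha> by (simp add: ennreal_mult norm_weight_nonneg tail_bound_nonneg sup_tail_bounds mult.assoc)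
    qed
    finally show "ennreal (norm_weight \<alpha> (Suc m)) * (\<integral>\<^sup>+w. ennreal (norm (partial_sum X (Suc m) w)) \<partial>M)
       \<le> ennreal (2 * (2 * C + 1)) * (\<integral>\<^sup>+t\<in>{0<..}. ennreal (?h m t) \<partial>lborel)" .
  qed
  also have "\<dots> = ennreal (2 * (2 * C + 1)) * (\<integral>\<^sup>+t. (\<Sum>m. ennreal (?h m t) * indicator {0<..} t) \<partial>lborel)"
  proof -
    have "(\<lambda>t. ennreal (?h m t) * indicator {0<..} t) \<in> borel_measurable lborel" for m by measurable
    then show ?thesis by (simp only: nn_integral_suminf ennreal_suminf_cmult)
  qed
  also have "\<dots> \<le> ennreal (2 * (2 * C + 1)) * (\<integral>\<^sup>+t. ennreal K * (ennreal (?g t powr \<alpha>) * indicator {0<..} t) \<partial>lborel)"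
  proof (intro mult_left_mono nn_integral_mono)
    fix t
    have "(\<Sum>m. ennreal (?h m t)) \<le> ennreal (K * ?g t powr \<alpha>)"
    proof (rule suminf_le_const[OF summableI])
      fix N
      have "(\<Sum>m<N. ennreal (?h m t)) = ennreal (\<Sum>m<N. ?h m t)" using h0 by (intro sum_ennreal) auto
      also have "(\<Sum>m<N. ?h m t) = (\<Sum>n=1..N. norm_weight \<alpha> n * tail_bound \<beta> (real n * ?g t))"
        by (simp add: sum.atLeast1_atMost_eq)
      also have "ennreal \<dots> \<le> ennreal (K * ?g t powr \<alpha>)"
        unfolding K_def using \<alpha> \<beta> by (intro ennreal_leI sum_norm_weight_tail_bound_le) (auto simp: sup_tail_bounds)
      finally show "(\<Sum>m<N. ennreal (?h m t)) \<le> ennreal (K * ?g t powr \<alpha>)" .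
    qed
    then show "(\<Sum>m. ennreal (?h m t) * indicator {0<..} t) \<le> ennreal K * (ennreal (?g t powr \<alpha>) * indicator {0<..} t)"
      using K by (cases "t > 0") (simp_all add: ennreal_mult)
  qed auto
  also have "\<dots> = ennreal (2 * (2 * C + 1)) * (ennreal K * (\<integral>\<^sup>+t\<in>{0<..}. ennreal (?g t powr \<alpha>) \<partial>lborel))"
    by (subst nn_integral_cmult) auto
  also have "\<dots> < \<infinity>"
    using fin by (simp add: \<alpha>_def ennreal_mult_less_top)
  finally show "quasimartingale M (generated_filtration M X) (\<lambda>n w. partial_sum X n w /\<^sub>R (real n powr (1 / p)))"
    using quasimartingale_iff[OF ind _ \<alpha>(1)] cent by (simp add: \<alpha>_def)
qed

section \<open>From quasimartingales to growth\<close>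

lemma distr_rademacher_coordinate:
  "distr rademacher_space (measure_pmf (pmf_of_set {-1, 1})) (\<lambda>\<epsilon>. \<epsilon> k) = measure_pmf (pmf_of_set {-1, 1})"
  unfolding rademacher_space_def by (rule distr_PiM_component) (auto intro: prob_space_measure_pmf)

lemma AE_rademacher_coordinate: "AE \<epsilon> in rademacher_space. \<epsilon> k \<in> {-1, 1}"
proof -
  have "(\<lambda>\<epsilon>. \<epsilon> k) \<in> measurable rademacher_space (measure_pmf (pmf_of_set {-1, 1 :: real}))"
    unfolding rademacher_space_def by (rule measurable_component_singleton) simp
  moreover have "AE s in distr rademacher_space (measure_pmf (pmf_of_set {-1, 1})) (\<lambda>\<epsilon>. \<epsilon> k). s \<in> {-1, 1 :: real}"
    unfolding distr_rademacher_coordinate by (simp add: AE_measure_pmf_iff)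
  ultimately show ?thesis by (rule AE_distrD)
qed

lemma integral_rademacher_coordinate: "(\<integral>\<epsilon>. \<epsilon> k \<partial>rademacher_space) = 0"
proof -
  have "(\<integral>\<epsilon>. \<epsilon> k \<partial>rademacher_space)
     = (\<integral>s. s \<partial>distr rademacher_space (measure_pmf (pmf_of_set {-1, 1 :: real})) (\<lambda>\<epsilon>. \<epsilon> k))"
    by (subst integral_distr) (auto simp: rademacher_space_def intro!: measurable_component_singleton)
  also have "\<dots> = 0"
    unfolding distr_rademacher_coordinate by (subst integral_pmf_of_set) auto
  finally show ?thesis .
qed

text \<open>The joint distribution of the sequence \<open>\<epsilon>\<^sub>k x\<^sub>k\<close> on the space of all sequences, on which the
  variables become the coordinates.\<close>

definition rademacher_series_space :: "(nat \<Rightarrow> 'b::{banach,second_countable_topology}) \<Rightarrow> (nat \<Rightarrow> 'b) measure" where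
  "rademacher_series_space x = distr rademacher_space (Pi\<^sub>M UNIV (\<lambda>_. borel)) (\<lambda>\<epsilon> k. \<epsilon> k *\<^sub>R x k)"

lemma measurable_rademacher_series:
  fixes x :: "nat \<Rightarrow> 'b::{banach,second_countable_topology}"
  shows "(\<lambda>\<epsilon> k. \<epsilon> k *\<^sub>R x k) \<in> measurable rademacher_space (Pi\<^sub>M UNIV (\<lambda>_. borel))"
proof (rule measurable_PiM_single')
  fix k show "(\<lambda>\<epsilon>. \<epsilon> k *\<^sub>R x k) \<in> borel_measurable rademacher_space"
    by (intro borel_measurable_scaleR measurable_rademacher_coordinate) simp
qed auto

lemma prob_space_rademacher_series_space: "prob_space (rademacher_series_space x)"
  unfolding rademacher_series_space_def
  by (intro prob_space.prob_space_distr prob_space_rademacher_space measurable_rademacher_series)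

lemma indep_rademacher_series:
  fixes x :: "nat \<Rightarrow> 'b::{banach,second_countable_topology}"
  shows "prob_space.indep_vars (rademacher_series_space x) (\<lambda>_. borel) (\<lambda>k w. w k) I"
proof -
  interpret R: prob_space rademacher_space by (rule prob_space_rademacher_space)
  interpret M: prob_space "rademacher_series_space x" by (rule prob_space_rademacher_series_space)
  let ?N = "Pi\<^sub>M UNIV (\<lambda>_. borel) :: (nat \<Rightarrow> 'b) measure"
  have coord: "(\<lambda>w. w k) \<in> borel_measurable ?N" for k by simp
  have "R.indep_vars (\<lambda>_. borel) (\<lambda>k \<epsilon>. \<epsilon> k *\<^sub>R x k) UNIV"
    by (rule R.indep_vars_compose2[OF rademacher_indep]) simp
  then have e1: "rademacher_series_space x = Pi\<^sub>M UNIV (\<lambda>k. distr rademacher_space borel (\<lambda>\<epsilon>. \<epsilon> k *\<^sub>R x k))"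
    by (subst (asm) R.indep_vars_iff_distr_eq_PiM')
       (auto simp: rademacher_series_space_def restrict_UNIV
         intro!: borel_measurable_scaleR measurable_rademacher_coordinate)
  have e2: "distr (rademacher_series_space x) borel (\<lambda>w. w k) = distr rademacher_space borel (\<lambda>\<epsilon>. \<epsilon> k *\<^sub>R x k)" for k
    unfolding rademacher_series_space_def
    by (subst distr_distr[OF coord measurable_rademacher_series]) (simp add: comp_def)
  have e3: "distr (rademacher_series_space x) ?N (\<lambda>w. w) = rademacher_series_space x"
    by (rule distr_id2) (simp add: rademacher_series_space_def)
  have "distr (rademacher_series_space x) ?N (\<lambda>w. \<lambda>k\<in>UNIV. w k)
      = Pi\<^sub>M UNIV (\<lambda>k. distr (rademacher_series_space x) borel (\<lambda>w. w k))"
    by (simp only: restrict_UNIV e2 e3) (rule e1)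
  then have "M.indep_vars (\<lambda>_. borel) (\<lambda>k w. w k) UNIV"
    by (subst M.indep_vars_iff_distr_eq_PiM') (simp_all add: rademacher_series_space_def)
  then show ?thesis by (rule M.indep_vars_subset) simp
qed

lemma strongly_centered_rademacher_series:
  fixes x :: "nat \<Rightarrow> 'b::{banach,second_countable_topology}"
  shows "strongly_centered (rademacher_series_space x) (\<lambda>w. w k)"
  unfolding strongly_centered_def
proof (intro conjI allI impI)
  interpret R: prob_space rademacher_space by (rule prob_space_rademacher_space)
  note [measurable] = measurable_rademacher_coordinate
  have intR: "integrable rademacher_space (\<lambda>\<epsilon>. \<epsilon> k *\<^sub>R x k)"
    using AE_rademacher_coordinate[of k]
    by (intro R.integrable_const_bound[of _ "norm (x k)"]) (auto elim!: eventually_mono)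
  have intR1: "integrable rademacher_space (\<lambda>\<epsilon>. \<epsilon> k)"
    using AE_rademacher_coordinate[of k]
    by (intro R.integrable_const_bound[of _ 1]) (auto elim!: eventually_mono)
  show "(\<lambda>w. w k) \<in> borel_measurable (rademacher_series_space x)"
    by (simp add: rademacher_series_space_def)
  show "integrable (rademacher_series_space x) (\<lambda>w. norm (w k))"
    unfolding rademacher_series_space_def
    by (subst integrable_distr_eq[OF measurable_rademacher_series]) (use integrable_norm[OF intR] in auto)
  fix f :: "'b \<Rightarrow> real" assume f: "bounded_linear f"
  then have [measurable]: "f \<in> borel_measurable borel"
    by (intro borel_measurable_continuous_onI linear_continuous_on)
  have "(\<integral>w. f (w k) \<partial>rademacher_series_space x) = (\<integral>\<epsilon>. f (\<epsilon> k *\<^sub>R x k) \<partial>rademacher_space)"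
    unfolding rademacher_series_space_def
    by (subst integral_distr[OF measurable_rademacher_series]) auto
  also have "\<dots> = f (\<integral>\<epsilon>. \<epsilon> k *\<^sub>R x k \<partial>rademacher_space)"
    by (rule integral_bounded_linear[OF f intR])
  also have "(\<integral>\<epsilon>. \<epsilon> k *\<^sub>R x k \<partial>rademacher_space) = 0"
    using intR1 by (subst integral_scaleR_left) (auto simp: integral_rademacher_coordinate)
  finally show "(\<integral>w. f (w k) \<partial>rademacher_series_space x) = 0"
    using f by (simp add: linear_simps)
qed

lemma sup_tail_rademacher_series_integrable:
  fixes x :: "nat \<Rightarrow> 'b::{banach,second_countable_topology}"
  assumes x: "\<And>k. norm (x k) \<le> 1" and \<alpha>: "0 < \<alpha>"
  shows "(\<integral>\<^sup>+t\<in>{0<..}. ennreal (sup_tail (rademacher_series_space x) (\<lambda>k w. w k) t powr \<alpha>) \<partial>lborel) < \<infinity>"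
proof -
  let ?M = "rademacher_series_space x"
  interpret prob_space ?M by (rule prob_space_rademacher_series_space)
  have sets: "(\<lambda>w. w k) \<in> borel_measurable ?M" for k
    by (simp add: rademacher_series_space_def)
  have AE1: "AE w in ?M. norm (w k) \<le> 1" for k
  proof -
    have "AE \<epsilon> in rademacher_space. norm (\<epsilon> k *\<^sub>R x k) \<le> 1"
      using AE_rademacher_coordinate[of k] x[of k] by (auto elim!: eventually_mono)
    then show ?thesis
      unfolding rademacher_series_space_def
      by (subst AE_distr_iff[OF measurable_rademacher_series]) auto
  qed
  have zero: "sup_tail ?M (\<lambda>k w. w k) t = 0" if t: "1 \<le> t" for t
  proof -
    have "prob {w \<in> space ?M. norm (w k) > t} = 0" for k
    proof (subst prob_Collect_eq_0)
      show "{w \<in> space ?M. t < norm (w k)} \<in> sets ?M" using sets[of k] by measurable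
      show "AE w in ?M. \<not> t < norm (w k)" using AE1[of k] t by (auto elim!: eventually_mono)
    qed
    then show ?thesis by (simp add: sup_tail_def)
  qed
  have "(\<integral>\<^sup>+t\<in>{0<..}. ennreal (sup_tail ?M (\<lambda>k w. w k) t powr \<alpha>) \<partial>lborel) \<le> (\<integral>\<^sup>+t. indicator {0..1 :: real} t \<partial>lborel)"
  proof (rule nn_integral_mono)
    fix t :: real
    have "sup_tail ?M (\<lambda>k w. w k) t powr \<alpha> \<le> 1"
      using \<alpha> by (intro powr_le1) (auto simp: sup_tail_bounds)
    then show "ennreal (sup_tail ?M (\<lambda>k w. w k) t powr \<alpha>) * indicator {0<..} t \<le> indicator {0..1} t"
      using zero[of t] by (cases "t \<le> 1") (auto split: split_indicator simp: ennreal_le_1)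
  qed
  also have "\<dots> < \<infinity>" by simp
  finally show ?thesis .
qed

text \<open>The condition on \<open>x 0\<close> allows the sum to start at index \<open>0\<close>, like the coordinates of the Rademacher
  space.\<close>

lemma nn_integral_norm_rademacher_series:
  fixes x :: "nat \<Rightarrow> 'b::{banach,second_countable_topology}"
  assumes x0: "x 0 = 0"
  shows "(\<integral>\<^sup>+w. ennreal (norm (partial_sum (\<lambda>k w. w k) n w)) \<partial>rademacher_series_space x)
     = ennreal (rad_mean (map x [0..<Suc n]) norm)"
proof -
  have "(\<lambda>w. \<Sum>k=1..n. w k) \<in> borel_measurable (Pi\<^sub>M UNIV (\<lambda>_. borel) :: (nat \<Rightarrow> 'b) measure)"
    by (intro borel_measurable_sum) simp
  then have "(\<integral>\<^sup>+w. ennreal (norm (partial_sum (\<lambda>k w. w k) n w)) \<partial>rademacher_series_space x)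
     = (\<integral>\<^sup>+\<epsilon>. ennreal (norm (\<Sum>k=1..n. \<epsilon> k *\<^sub>R x k)) \<partial>rademacher_space)"
    unfolding rademacher_series_space_def partial_sum_def
    by (subst nn_integral_distr[OF measurable_rademacher_series]) auto
  also have "\<dots> = (\<integral>\<^sup>+\<epsilon>. ennreal (norm (\<Sum>i<length (map x [0..<Suc n]). \<epsilon> i *\<^sub>R map x [0..<Suc n] ! i)) \<partial>rademacher_space)"
  proof (intro nn_integral_cong arg_cong[where f = "\<lambda>v. ennreal (norm v)"])
    fix \<epsilon> :: "nat \<Rightarrow> real"
    have "(\<Sum>i<length (map x [0..<Suc n]). \<epsilon> i *\<^sub>R map x [0..<Suc n] ! i) = (\<Sum>i<Suc n. \<epsilon> i *\<^sub>R x i)"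
      by (intro sum.cong) (auto simp del: upt_Suc)
    also have "\<dots> = (\<Sum>k=1..n. \<epsilon> k *\<^sub>R x k)"
      by (subst sum.lessThan_Suc_shift) (simp add: x0 sum.atLeast1_atMost_eq)
    finally show "(\<Sum>k=1..n. \<epsilon> k *\<^sub>R x k) = (\<Sum>i<length (map x [0..<Suc n]). \<epsilon> i *\<^sub>R map x [0..<Suc n] ! i)" ..
  qed
  also have "\<dots> = ennreal (rad_mean (map x [0..<Suc n]) norm)"
    by (rule nn_integral_rademacher) auto
  finally show ?thesis .
qed

lemma summable_if_quasimartingale_property:
  fixes x :: "nat \<Rightarrow> 'b::{banach,second_countable_topology}"
  assumes p: "1 < p" and qm: "quasimartingale_property TYPE('b) TYPE(nat \<Rightarrow> 'b) p"
    and x: "x 0 = 0" "\<And>k. norm (x k) \<le> 1"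
  shows "summable (\<lambda>m. norm_weight (1 / p) (Suc m) * rad_mean (map x [0..<Suc (Suc m)]) norm)"
proof -
  let ?M = "rademacher_series_space x"
  interpret prob_space ?M by (rule prob_space_rademacher_series_space)
  note facts = indep_rademacher_series[of x "{1..}"] strongly_centered_rademacher_series[of x]
  have "quasimartingale ?M (generated_filtration ?M (\<lambda>k w. w k))
     (\<lambda>n w. partial_sum (\<lambda>k w. w k) n w /\<^sub>R (real n powr (1 / p)))"
    using qm facts sup_tail_rademacher_series_integrable[of x "1 / p", OF x(2)] p prob_space_axioms
    unfolding quasimartingale_property_def by simp
  then have "(\<Sum>m. ennreal (norm_weight (1 / p) (Suc m)) * ennreal (rad_mean (map x [0..<Suc (Suc m)]) norm)) < \<infinity>"
    using p by (subst (asm) quasimartingale_iff[OF facts(1) facts(2)])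
      (simp_all only: nn_integral_norm_rademacher_series[where x=x, OF x(1)], simp)
  moreover have nn: "0 \<le> norm_weight (1 / p) (Suc m)" "0 \<le> rad_mean (map x [0..<Suc (Suc m)]) norm" for m
    using p by (auto intro!: norm_weight_nonneg rad_mean_nonneg simp del: upt_Suc)
  ultimately have "(\<Sum>m. ennreal (norm_weight (1 / p) (Suc m) * rad_mean (map x [0..<Suc (Suc m)]) norm)) \<noteq> top"
    by (simp add: ennreal_mult less_top del: upt_Suc)
  then show ?thesis using nn by (intro summable_suminf_not_top mult_nonneg_nonneg)
qed

lemma sum_norm_weight:
  "a \<le> b \<Longrightarrow> (\<Sum>m=a..<b. norm_weight \<alpha> (Suc m)) = 1 / real (Suc a) powr \<alpha> - 1 / real (Suc b) powr \<alpha>"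
proof (induction b rule: dec_induct)
  case (step b)
  then show ?case by (simp add: norm_weight_def add.commute)
qed simp

text \<open>The vectors \<open>x k\<close> with \<open>2 ^ j \<le> k < 2 ^ (j + 1)\<close> form a family whose average is at least half of
  \<open>\<phi>(2 ^ j)\<close>. All later sums have at least this average norm, and the weights over the next dyadic block
  add up to a multiple of \<open>2 powr (- j \<alpha>)\<close>. Convergence of the series thus forces
  \<open>\<phi>(2 ^ j) 2 powr (- j \<alpha>)\<close> to tend to zero.\<close>

lemma quasimartingale_property_imp_rad_sup_small:
  assumes p: "1 < p" and qm: "quasimartingale_property TYPE('b::{banach,second_countable_topology}) TYPE(nat \<Rightarrow> 'b) p"
    and \<theta>: "0 < \<theta>"
  shows "\<exists>c. \<forall>m. rad_sup TYPE('b) m \<le> \<theta> * real m powr (1 / p) + c"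
proof -
  define \<alpha> where "\<alpha> = 1 / p"
  have \<alpha>: "0 < \<alpha>" using p by (simp add: \<alpha>_def)
  have "\<forall>j. \<exists>xs :: 'b list. length xs = 2 ^ j \<and> (\<forall>x\<in>set xs. norm x \<le> 1) \<and> rad_sup TYPE('b) (2 ^ j) \<le> 2 * rad_mean xs norm"
    using rad_sup_attained_up_to_2 by blast
  then obtain xs :: "nat \<Rightarrow> 'b list" where xs: "\<And>j. length (xs j) = 2 ^ j" "\<And>j. \<forall>x\<in>set (xs j). norm x \<le> 1"
    "\<And>j. rad_sup TYPE('b) (2 ^ j) \<le> 2 * rad_mean (xs j) norm"
    by metis
  define x where "x k = (if k = 0 then 0 else xs (floor_log k) ! (k - 2 ^ floor_log k))" for k
  have x0: "x 0 = 0" by (simp add: x_def)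
  have block: "map x [2 ^ j..<2 ^ Suc j] = xs j" for j
  proof (rule nth_equalityI)
    fix i assume i: "i < length (map x [2 ^ j..<2 ^ Suc j])"
    then have "floor_log (2 ^ j + i) = j" by (intro floor_log_eqI) auto
    then show "map x [2 ^ j..<2 ^ Suc j] ! i = xs j ! i" using i by (simp add: x_def)
  qed (simp add: xs)
  have x1: "norm (x k) \<le> 1" for k
  proof (cases "k = 0")
    case False
    then have "2 ^ floor_log k \<le> k" "k < 2 * 2 ^ floor_log k"
      using floor_log_exp2_le[of k] floor_log_exp2_gt[of k] by auto
    then have "k - 2 ^ floor_log k < length (xs (floor_log k))" by (simp add: xs)
    then show ?thesis using xs(2)[of "floor_log k"] False by (simp add: x_def)
  qed (simp add: x_def)
  define s where "s m = norm_weight \<alpha> (Suc m) * rad_mean (map x [0..<Suc (Suc m)]) norm" for m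
  have "summable s" unfolding s_def[abs_def] \<alpha>_def by (rule summable_if_quasimartingale_property[where x = x, OF p qm x0 x1])
  have ge: "rad_sup TYPE('b) (2 ^ j) / 2 \<le> rad_mean (map x [0..<n]) norm" if "2 ^ Suc j \<le> n" for j n
  proof -
    have "[0..<n] = [0..<2 ^ j] @ [2 ^ j..<2 ^ Suc j] @ [2 ^ Suc j..<n]"
      using that upt_add_eq_append[of 0 "2 ^ j" "n - 2 ^ j"] upt_add_eq_append[of "2 ^ j" "2 ^ Suc j" "n - 2 ^ Suc j"]
      by simp
    then have "map x [0..<n] = map x [0..<2 ^ j] @ xs j @ map x [2 ^ Suc j..<n]"
      by (simp only: map_append block)
    then have "rad_mean (xs j) norm \<le> rad_mean (map x [0..<n]) norm"
      using rad_mean_norm_append(1)[of "xs j" "map x [2 ^ Suc j..<n]"]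
        rad_mean_norm_append(2)[of "xs j @ map x [2 ^ Suc j..<n]" "map x [0..<2 ^ j]"] by simp
    then show ?thesis using xs(3)[of j] by simp
  qed
  define \<kappa> where "\<kappa> = (1 - 2 powr - \<alpha>) * 2 powr - \<alpha> / 2"
  have \<kappa>: "0 < \<kappa>" using \<alpha> by (simp add: \<kappa>_def powr_less_one)
  \<comment> \<open>the indices are shifted by one, since the \<open>m\<close>-th term belongs to the partial sum of length
    \<open>Suc m\<close>\<close>
  have block_ge: "\<kappa> * (rad_sup TYPE('b) (2 ^ j) * (2 ^ j) powr - \<alpha>) \<le> (\<Sum>m=2 ^ Suc j - 1..<2 ^ Suc (Suc j) - 1. s m)" for j
  proof -
    let ?a = "2 ^ Suc j - 1 :: nat" and ?b = "2 ^ Suc (Suc j) - 1 :: nat"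
    have "(\<Sum>m=?a..<?b. norm_weight \<alpha> (Suc m)) = 1 / (2 ^ Suc j) powr \<alpha> - 1 / (2 ^ Suc (Suc j)) powr \<alpha>"
      by (subst sum_norm_weight) (auto intro: diff_le_mono simp: Suc_diff_Suc)
    also have "\<dots> = 2 * \<kappa> * (2 ^ j) powr - \<alpha>"
    proof -
      have "(4::real) powr \<alpha> = 2 powr \<alpha> * 2 powr \<alpha>" by (simp flip: powr_mult)
      then show ?thesis by (simp add: \<kappa>_def powr_mult powr_minus field_simps)
    qed
    finally have w: "(\<Sum>m=?a..<?b. norm_weight \<alpha> (Suc m)) = 2 * \<kappa> * (2 ^ j) powr - \<alpha>" .
    have "\<kappa> * (rad_sup TYPE('b) (2 ^ j) * (2 ^ j) powr - \<alpha>)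
       = (\<Sum>m=?a..<?b. norm_weight \<alpha> (Suc m)) * (rad_sup TYPE('b) (2 ^ j) / 2)"
      unfolding w by simp
    also have "\<dots> = (\<Sum>m=?a..<?b. norm_weight \<alpha> (Suc m) * (rad_sup TYPE('b) (2 ^ j) / 2))"
      by (rule sum_distrib_right)
    also have "\<dots> \<le> (\<Sum>m=?a..<?b. s m)"
      unfolding s_def using \<alpha>
      by (intro sum_mono mult_left_mono ge norm_weight_nonneg) (auto simp del: upt_Suc)
    finally show ?thesis .
  qed
  define \<theta>' where "\<theta>' = \<theta> * 2 powr - \<alpha>"
  have \<theta>': "0 < \<theta>'" using \<theta> by (simp add: \<theta>'_def)
  obtain N where N: "\<And>m n. N \<le> m \<Longrightarrow> norm (sum s {m..<n}) < \<kappa> * \<theta>'"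
    using \<open>summable s\<close> \<kappa> \<theta>' unfolding summable_Cauchy by (metis mult_pos_pos)
  have dyadic: "rad_sup TYPE('b) (2 ^ j) \<le> \<theta>' * (2 ^ j) powr \<alpha>" if "N \<le> j" for j
  proof -
    have "j < 2 ^ j" by (rule less_exp)
    then have "N \<le> 2 ^ Suc j - 1" unfolding power_Suc using that by linarith
    then have "(\<Sum>m=2 ^ Suc j - 1..<2 ^ Suc (Suc j) - 1. s m) < \<kappa> * \<theta>'"
      using N[of "2 ^ Suc j - 1" "2 ^ Suc (Suc j) - 1"] by (simp add: abs_less_iff)
    then have "\<kappa> * (rad_sup TYPE('b) (2 ^ j) * (2 ^ j) powr - \<alpha>) < \<kappa> * \<theta>'"
      using block_ge[of j] by linarith
    then have "rad_sup TYPE('b) (2 ^ j) * (2 ^ j) powr - \<alpha> < \<theta>'" using \<kappa> by simp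
    then show ?thesis by (simp add: powr_minus field_simps)
  qed
  show ?thesis
  proof (intro exI[of _ "2 ^ N"] allI)
    fix m
    show "rad_sup TYPE('b) m \<le> \<theta> * real m powr (1 / p) + 2 ^ N"
    proof (cases "m \<le> 2 ^ N")
      case True
      then have "real m \<le> 2 ^ N" by (metis of_nat_le_iff of_nat_numeral of_nat_power)
      moreover have "0 \<le> \<theta> * real m powr (1 / p)" using \<theta> by simp
      ultimately show ?thesis using rad_sup_le[where 'b='b, of m] by linarith
    next
      case False
      then have "1 \<le> m" by (cases m) auto
      then obtain k where k: "2 ^ k \<le> m" "m < 2 ^ (k + 1)" using ex_power_ivl1[of 2 m] by auto
      have "N \<le> k + 1"
      proof (rule ccontr)
        assume "\<not> ?thesis"
        then have "(2::nat) ^ (k + 1) \<le> 2 ^ N" by (intro power_increasing) auto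
        then show False using k False by simp
      qed
      have "rad_sup TYPE('b) m \<le> rad_sup TYPE('b) (2 ^ (k + 1))" using k by (intro rad_sup_mono) simp
      also have "\<dots> \<le> \<theta>' * (2 ^ (k + 1)) powr \<alpha>" by (rule dyadic) fact
      also have "\<dots> = \<theta> * (2 ^ k) powr \<alpha>"
        by (simp add: \<theta>'_def powr_mult powr_minus field_simps)
      also have "\<dots> \<le> \<theta> * real m powr \<alpha>"
      proof -
        have "2 ^ k \<le> real m" using k(1) by (metis of_nat_le_iff of_nat_numeral of_nat_power)
        then show ?thesis using \<theta> \<alpha> by (intro mult_left_mono powr_mono2) auto
      qed
      finally show ?thesis by (simp add: \<alpha>_def add_increasing2)
    qed
  qed
qed

section \<open>The equivalence\<close>

lemma stable_type_imp_quasimartingale_property: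
  assumes p: "1 < p" "p < 2" and st: "stable_type TYPE('b::{banach,second_countable_topology}) p"
  shows "quasimartingale_property TYPE('b) TYPE('w) p"
proof -
  have half: "1 / 2 < 1 / p" using p by (simp add: field_simps)
  obtain \<beta> C where "0 < \<beta>" "\<beta> < 1 / p" "0 \<le> C" "\<And>m. rad_sup TYPE('b) m \<le> C * real m powr \<beta>"
    using rad_sup_power_saving[OF half stable_type_imp_rad_sup_small[OF p st]] by metis
  then show ?thesis by (rule quasimartingale_property_if_rad_sup_le[OF p(1)])
qed

lemma quasimartingale_property_imp_stable_type:
  assumes p: "1 < p" "p < 2"
    and qm: "quasimartingale_property TYPE('b::{banach,second_countable_topology}) TYPE(nat \<Rightarrow> 'b) p"
  shows "stable_type TYPE('b) p"
proof -
  have half: "1 / 2 < 1 / p" using p by (simp add: field_simps)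
  obtain \<beta> C where "0 < \<beta>" "\<beta> < 1 / p" "0 \<le> C" "\<And>m. rad_sup TYPE('b) m \<le> C * real m powr \<beta>"
    using rad_sup_power_saving[OF half quasimartingale_property_imp_rad_sup_small[OF p(1) qm]] by metis
  then show ?thesis using p by (intro stable_type_if_rad_sup_le[of p \<beta> C]) auto
qed

theorem theorem8:
  fixes p :: real
  assumes "1 < p" and "p < 2"
  shows "(stable_type TYPE('b::{banach,second_countable_topology}) p
            \<longleftrightarrow> quasimartingale_property TYPE('b) TYPE(nat \<Rightarrow> 'b) p)
       \<and> (stable_type TYPE('b) p \<longrightarrow> quasimartingale_property TYPE('b) TYPE('w) p)"
proof (intro conjI iffI impI)
  assume "stable_type TYPE('b) p"
  then show "quasimartingale_property TYPE('b) TYPE(nat \<Rightarrow> 'b) p"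
    and "quasimartingale_property TYPE('b) TYPE('w) p"
    by (rule stable_type_imp_quasimartingale_property[OF assms])+
next
  assume "quasimartingale_property TYPE('b) TYPE(nat \<Rightarrow> 'b) p"
  then show "stable_type TYPE('b) p"
    by (rule quasimartingale_property_imp_stable_type[OF assms])
qed

end
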